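(* Let $p\ge2$ and $0\le l\le L-1$. Then for all $\mu\in M_l^0$, $$\hat a_L(I_l\mu,I_l\mu)\le C\,\hat a_l(\mu,\mu),$$ with $C$ independent of the mesh sizes and of the levels.
   Context: Setting. $\Omega\subset\mathbb R^2$ is a polygonal domain. $\{\mathcal T_l\}_{l=0}^L$ is a shape-regular family of nested conforming triangulations of $\Omega$: $\mathcal T_0$ is quasi-uniform and $\mathcal T_l$ is a quasi-uniform refinement of $\mathcal T_{l-1}$; $h_l$ is the mesh size of $\mathcal T_l$, $\mathcal E_l$ its set of edges, $\mathcal V_l$ its set of vertices. A polynomial degree $p\ge2$ is fixed. For a triangle $T$ and an edge $F$: $\boldsymbol V(T)=(\mathcal P_p(T))^2$, $W(T)=\mathcal P_p(T)$, $M(F)=\mathcal P_p(F)$. $W_l$ = discontinuous piecewise $\mathcal P_p$ functions on $\mathcal T_l$; $W_l^c=W_l\cap C(\bar\Omega)$ with Lagrange nodal set $\mathcal N_l$, $\mathcal N_l^0\subset\mathcal N_l$ the nodes interior to elements; $M_l=\{\mu\in L^2(\cup\mathcal E_l): \mu|_F\in M(F)\ \forall F\in\mathcal E_l\}$, $M_l^0=\{\mu\in M_l:\mu|_{\partial\Omega}=0\}$. On level $l$, $\tau_l>0$ with $c_1h_l^{-1}\le\tau_l\le c_2h_l^{-1}$. Local solver on level $l$: for $T\in\mathcal T_l$ and $m\in L^2(\partial T)$, $(\boldsymbol Q_m,U_m)\in\boldsymbol V(T)\times W(T)$ solves $(\boldsymbol Q_m,\boldsymbol v)_T-(U_m,\operatorname{div}\boldsymbol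 v)_T=-\langle m,\boldsymbol v\cdot\boldsymbol n\rangle_{\partial T}$ and $-(\boldsymbol Q_m,\nabla w)_T+\langle \boldsymbol Q_m\cdot\boldsymbol n+\tau_l(U_m-m),w\rangle_{\partial T}=0$ for all $(\boldsymbol v,w)$. For $\mu\in M_l$, $(\boldsymbol Q_\mu,U_\mu)$ is defined elementwise with $m=\mu|_{\partial T}$. Energy form: $\hat a_l(\lambda,\mu)=\sum_{T\in\mathcal T_l}\big[(\boldsymbol Q_\lambda,\boldsymbol Q_\mu)_T+\tau_l\langle U_\lambda-\lambda,U_\mu-\mu\rangle_{\partial T}\big]$ for $\lambda,\mu\in M_l$ (and analogously $\hat a_L$ on $M_L$). Operator $I_l^W:M_l\to W_l^c$, by nodal values: at a vertex $z\in\mathcal V_l$, $I_l^W\lambda(z)=\frac{1}{|\mathcal E_l(z)|}\sum_{e\in\mathcal E_l(z)}\lambda_e(z)$ ($\mathcal E_l(z)$ = edges containing $z$, $\lambda_e=\lambda|_e$); at $z\in\mathcal N_l\setminus(\mathcal V_l\cup\mathcal N_l^0)$, $I_l^W\lambda(z)=\lambda(z)$; at $z\in\mathcal N_l^0$ (when $p\ge3$), $I_l^W\lambda(z)=U_\lambda(z)$. Intergrid transfer $I_l:M_l\to M_L$: $I_l\mu:=(I_l^W\mu)|_{\cup\mathcal E_L}$, the trace on the edges of $\mathcal T_L$. *)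

theory Defs
  imports "HOL-Analysis.Analysis"
begin

type_synonym pt = "real \<times> real"

text \<open>A triangle is represented by its set of three (non-collinear) vertices;
an edge by its set of two endpoints.\<close>

definition is_tri :: "pt set \<Rightarrow> bool" where
  "is_tri V \<longleftrightarrow> card V = 3 \<and> \<not> collinear V"

definition tri :: "pt set \<Rightarrow> pt set" where
  "tri V = convex hull V"

definition seg :: "pt set \<Rightarrow> pt set" where
  "seg e = convex hull e"

definition edges_of :: "pt set \<Rightarrow> pt set set" where
  "edges_of V = {e. e \<subseteq> V \<and> card e = 2}"

definition mesh_edges :: "pt set set \<Rightarrow> pt set set" where
  "mesh_edges \<T> = \<Union>(edges_of ` \<T>)"

definition polygonal_domain :: "pt set \<Rightarrow> bool" where
  "polygonal_domain \<Omega> \<longleftrightarrow> open \<Omega> \<and> bounded \<Omega> \<and> connected \<Omega> \<and> \<Omega> \<noteq> {} \<and>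
     \<Omega> = interior (closure \<Omega>) \<and>
     (\<exists>S. finite S \<and> (\<forall>s\<in>S. \<exists>a b. s = closed_segment a b) \<and> frontier \<Omega> = \<Union>S)"

definition conforming :: "pt set \<Rightarrow> pt set set \<Rightarrow> bool" where
  "conforming \<Omega> \<T> \<longleftrightarrow> finite \<T> \<and> \<T> \<noteq> {} \<and> (\<forall>V\<in>\<T>. is_tri V) \<and>
     \<Union>(tri ` \<T>) = closure \<Omega> \<and>
     (\<forall>V\<in>\<T>. \<forall>W\<in>\<T>. V \<noteq> W \<longrightarrow> tri V \<inter> tri W = convex hull (V \<inter> W))"

definition diam_tri :: "pt set \<Rightarrow> real" where
  "diam_tri V = diameter (tri V)"

definition meshsize :: "pt set set \<Rightarrow> real" where
  "meshsize \<T> = Max (diam_tri ` \<T>)"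

definition inradius :: "pt set \<Rightarrow> real" where
  "inradius V = Sup {r. \<exists>x. ball x r \<subseteq> tri V}"

definition shape_regular :: "real \<Rightarrow> pt set set \<Rightarrow> bool" where
  "shape_regular \<sigma> \<T> \<longleftrightarrow> (\<forall>V\<in>\<T>. diam_tri V \<le> \<sigma> * inradius V)"

definition quasi_uniform :: "real \<Rightarrow> pt set set \<Rightarrow> bool" where
  "quasi_uniform \<rho> \<T> \<longleftrightarrow> (\<forall>V\<in>\<T>. \<rho> * meshsize \<T> \<le> diam_tri V)"

definition refines :: "pt set set \<Rightarrow> pt set set \<Rightarrow> bool" where
  "refines \<T>' \<T> \<longleftrightarrow> (\<forall>V'\<in>\<T>'. \<exists>V\<in>\<T>. tri V' \<subseteq> tri V)"

definition mesh_family :: "pt set \<Rightarrow> real \<Rightarrow> real \<Rightarrow> (nat \<Rightarrow> pt set set) \<Rightarrow> nat \<Rightarrow> bool" where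
  "mesh_family \<Omega> \<sigma> \<rho> \<T> L \<longleftrightarrow>
     (\<forall>k\<le>L. conforming \<Omega> (\<T> k) \<and> shape_regular \<sigma> (\<T> k) \<and> quasi_uniform \<rho> (\<T> k)) \<and>
     (\<forall>k<L. refines (\<T> (Suc k)) (\<T> k))"

definition poly2 :: "nat \<Rightarrow> (pt \<Rightarrow> real) set" where
  "poly2 p = {f. \<exists>c::nat \<Rightarrow> nat \<Rightarrow> real. \<forall>x y.
      f (x, y) = (\<Sum>i\<le>p. \<Sum>j\<le>p - i. c i j * x ^ i * y ^ j)}"

definition vpoly2 :: "nat \<Rightarrow> (pt \<Rightarrow> pt) set" where
  "vpoly2 p = {v. (\<lambda>x. fst (v x)) \<in> poly2 p \<and> (\<lambda>x. snd (v x)) \<in> poly2 p}"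

definition grad :: "(pt \<Rightarrow> real) \<Rightarrow> pt \<Rightarrow> pt" where
  "grad w x = (deriv (\<lambda>s. w (s, snd x)) (fst x), deriv (\<lambda>s. w (fst x, s)) (snd x))"

definition divg :: "(pt \<Rightarrow> pt) \<Rightarrow> pt \<Rightarrow> real" where
  "divg v x = deriv (\<lambda>s. fst (v (s, snd x))) (fst x) + deriv (\<lambda>s. snd (v (fst x, s))) (snd x)"

definition edge_int :: "pt set \<Rightarrow> (pt \<Rightarrow> real) \<Rightarrow> real" where
  "edge_int e g = (SOME I. \<exists>a b. e = {a, b} \<and> a \<noteq> b \<and>
      I = dist a b * integral {0..1} (\<lambda>t::real. g ((1 - t) *\<^sub>R a + t *\<^sub>R b)))"

definition perp :: "pt \<Rightarrow> pt" where
  "perp v = (- snd v, fst v)"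

definition normal :: "pt set \<Rightarrow> pt set \<Rightarrow> pt" where
  "normal V e = (let c = the_elem (V - e); a = (SOME a. a \<in> e); b = the_elem (e - {a});
       u = perp (b - a) /\<^sub>R norm (b - a)
     in if inner u (c - a) < 0 then u else - u)"

definition local_sol :: "nat \<Rightarrow> real \<Rightarrow> pt set \<Rightarrow> (pt set \<Rightarrow> pt \<Rightarrow> real)
     \<Rightarrow> (pt \<Rightarrow> pt) \<Rightarrow> (pt \<Rightarrow> real) \<Rightarrow> bool" where
  "local_sol p \<tau> V m Q U \<longleftrightarrow> Q \<in> vpoly2 p \<and> U \<in> poly2 p \<and>
     (\<forall>v\<in>vpoly2 p.
        integral (tri V) (\<lambda>x. inner (Q x) (v x)) - integral (tri V) (\<lambda>x. U x * divg v x)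
        = - (\<Sum>e\<in>edges_of V. edge_int e (\<lambda>x. m e x * inner (v x) (normal V e)))) \<and>
     (\<forall>w\<in>poly2 p.
        - integral (tri V) (\<lambda>x. inner (Q x) (grad w x))
        + (\<Sum>e\<in>edges_of V. edge_int e (\<lambda>x. (inner (Q x) (normal V e) + \<tau> * (U x - m e x)) * w x))
        = 0)"

definition loc_Q :: "nat \<Rightarrow> real \<Rightarrow> pt set \<Rightarrow> (pt set \<Rightarrow> pt \<Rightarrow> real) \<Rightarrow> pt \<Rightarrow> pt" where
  "loc_Q p \<tau> V m = fst (THE QU. local_sol p \<tau> V m (fst QU) (snd QU))"

definition loc_U :: "nat \<Rightarrow> real \<Rightarrow> pt set \<Rightarrow> (pt set \<Rightarrow> pt \<Rightarrow> real) \<Rightarrow> pt \<Rightarrow> real" where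
  "loc_U p \<tau> V m = snd (THE QU. local_sol p \<tau> V m (fst QU) (snd QU))"

definition hat_a :: "nat \<Rightarrow> real \<Rightarrow> pt set set \<Rightarrow> (pt set \<Rightarrow> pt \<Rightarrow> real)
     \<Rightarrow> (pt set \<Rightarrow> pt \<Rightarrow> real) \<Rightarrow> real" where
  "hat_a p \<tau> \<T> lam mu = (\<Sum>V\<in>\<T>.
      integral (tri V) (\<lambda>x. inner (loc_Q p \<tau> V lam x) (loc_Q p \<tau> V mu x))
      + \<tau> * (\<Sum>e\<in>edges_of V. edge_int e
           (\<lambda>x. (loc_U p \<tau> V lam x - lam e x) * (loc_U p \<tau> V mu x - mu e x))))"

definition edge_poly :: "nat \<Rightarrow> pt set \<Rightarrow> (pt \<Rightarrow> real) \<Rightarrow> bool" where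
  "edge_poly p e g \<longleftrightarrow> (\<exists>a b c. e = {a, b} \<and> a \<noteq> b \<and>
      (\<forall>t\<in>{0..1::real}. g ((1 - t) *\<^sub>R a + t *\<^sub>R b) = (\<Sum>k\<le>p. c k * t ^ k)))"

definition Mspace :: "nat \<Rightarrow> pt set set \<Rightarrow> (pt set \<Rightarrow> pt \<Rightarrow> real) set" where
  "Mspace p \<T> = {mu. \<forall>e\<in>mesh_edges \<T>. edge_poly p e (mu e)}"

definition M0space :: "nat \<Rightarrow> pt set \<Rightarrow> pt set set \<Rightarrow> (pt set \<Rightarrow> pt \<Rightarrow> real) set" where
  "M0space p \<Omega> \<T> = {mu \<in> Mspace p \<T>.
      \<forall>e\<in>mesh_edges \<T>. seg e \<subseteq> frontier \<Omega> \<longrightarrow> (\<forall>x\<in>seg e. mu e x = 0)}"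

definition nodes :: "nat \<Rightarrow> pt set \<Rightarrow> pt set" where
  "nodes p V = {y. \<exists>a b c i j k. V = {a, b, c} \<and> i + j + k = p \<and>
      y = (real i / real p) *\<^sub>R a + (real j / real p) *\<^sub>R b + (real k / real p) *\<^sub>R c}"

definition nodal_val :: "nat \<Rightarrow> real \<Rightarrow> pt set set \<Rightarrow> (pt set \<Rightarrow> pt \<Rightarrow> real) \<Rightarrow> pt \<Rightarrow> real" where
  "nodal_val p \<tau> \<T> lam z =
     (if z \<in> \<Union>\<T> then
        (\<Sum>e\<in>{e\<in>mesh_edges \<T>. z \<in> e}. lam e z) / real (card {e\<in>mesh_edges \<T>. z \<in> e})
      else if \<exists>V\<in>\<T>. z \<in> interior (tri V) then
        loc_U p \<tau> (SOME V. V \<in> \<T> \<and> z \<in> interior (tri V)) lam z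
      else lam (SOME e. e \<in> mesh_edges \<T> \<and> z \<in> seg e) z)"

definition interp :: "nat \<Rightarrow> pt set \<Rightarrow> (pt \<Rightarrow> real) \<Rightarrow> pt \<Rightarrow> real" where
  "interp p V g = (THE P. P \<in> poly2 p \<and> (\<forall>z\<in>nodes p V. P z = g z))"

definition IW :: "nat \<Rightarrow> real \<Rightarrow> pt set set \<Rightarrow> (pt set \<Rightarrow> pt \<Rightarrow> real) \<Rightarrow> pt \<Rightarrow> real" where
  "IW p \<tau> \<T> lam x =
     (if \<exists>V\<in>\<T>. x \<in> tri V
      then interp p (SOME V. V \<in> \<T> \<and> x \<in> tri V) (nodal_val p \<tau> \<T> lam) x
      else 0)"

text \<open>I_l: trace of I_l^W on the edges (of the fine mesh; only fine edges are ever evaluated).\<close>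
definition Itrans :: "nat \<Rightarrow> real \<Rightarrow> pt set set \<Rightarrow> (pt set \<Rightarrow> pt \<Rightarrow> real) \<Rightarrow> pt set \<Rightarrow> pt \<Rightarrow> real" where
  "Itrans p \<tau> \<T> lam = (\<lambda>e x. IW p \<tau> \<T> lam x)"

end

theory Submission
  imports Defs
begin

text \<open>
  Let \<open>w\<close> be the interpolant \<open>I_l^W \<mu>\<close>. On a fine triangle \<open>T\<close> the trace of \<open>w\<close> is that of a polynomial
  of degree \<open>p\<close>, and testing the local problem with \<open>Q\<close> and \<open>U - w\<close> gives
  \<open>|Q|\<^sup>2 + \<tau> |U - w|\<^sup>2 = - (Q, grad w)\<close>, so the fine energy on \<open>T\<close> is at most \<open>|grad w|\<^sup>2\<close>; summing up,
  the fine energy is bounded by the squared \<open>H\<^sup>1\<close> seminorm of \<open>w\<close>, with constant 1.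

  On a coarse triangle, \<open>v = Q + grad U\<close> satisfies \<open>|v|\<^sup>2 = \<langle>U - \<mu>, v n\<rangle>\<close>, which with the discrete trace
  inequality bounds \<open>grad U\<close> by the energy. The gradient of \<open>w - U\<close> is controlled by its nodal values, and
  these by \<open>\<tau> |U - \<mu>|\<^sup>2\<close>: directly at nodes inside an edge, and at a vertex by passing from triangle to
  triangle around it. All polynomial estimates reduce to the positivity of a quadratic form on the
  coefficients over the reference triangle.
\<close>

section \<open>Linear systems and quadratic forms\<close>

text \<open>The powers of \<open>h\<close> cancel: in the plane the Dirichlet integral is scale
  invariant, while the squared maximum of a polynomial on an edge costs a factor
  \<open>1 / h\<close> against its edge integral, and \<open>c1 / h \<le> \<tau>\<close> pays for
  exactly that factor. On the fine mesh only the energy identity is used, with no inverse estimate,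
  so the ratio of the two mesh sizes never enters. The real obstacle is a vertex. The nodal value
  there averages traces on edges of several triangles, while the energy compares a trace only with
  the \<open>U\<close> of the triangles at its own edge. This calls for a bound on the number of
  triangles at a vertex and for a connectivity argument on their star. Since \<open>loc_Q\<close>,
  \<open>loc_U\<close> and \<open>interp\<close> are definite descriptions, existence and uniqueness
  must precede every estimate. Both come from elementary linear algebra on coefficient vectors. The
  constants on the reference triangle come from the same source: coercivity of a positive form is
  proved by elimination, not by compactness.\<close>

lemma underdetermined_system_kernel:
  fixes A :: "'i \<Rightarrow> 'j \<Rightarrow> real"
  assumes "finite I" "finite J" "card I < card J"
  shows "\<exists>x. (\<exists>j\<in>J. x j \<noteq> 0) \<and> (\<forall>i\<in>I. (\<Sum>j\<in>J. A i j * x j) = 0)"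
  using assms
proof (induction I arbitrary: J A rule: finite_induct)
  case empty
  then obtain j where "j \<in> J" by (metis card_gt_0_iff card.empty ex_in_conv)
  then show ?case by (intro exI[of _ "\<lambda>_. 1"]) auto
next
  case (insert i0 I)
  show ?case
  proof (cases "\<forall>j\<in>J. A i0 j = 0")
    case True
    have "card I < card J" using insert by simp
    from insert.IH[OF insert.prems(1) this, of A] True show ?thesis by force
  next
    case False
    then obtain k where k: "k \<in> J" "A i0 k \<noteq> 0" by auto
    \<comment> \<open>Gaussian elimination of the unknown \<open>k\<close> with pivot
      \<open>A i0 k\<close>.\<close>
    define B where "B i j = A i j - A i k / A i0 k * A i0 j" for i j
    have "card I < card (J - {k})" using insert k by (simp add: card_Diff_singleton)
    with insert.IH[of "J - {k}" B] insert.prems(1) obtain x where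
      x: "\<exists>j\<in>J-{k}. x j \<noteq> 0" "\<forall>i\<in>I. (\<Sum>j\<in>J-{k}. B i j * x j) = 0" by auto
    define s where "s = (\<Sum>j\<in>J-{k}. A i0 j * x j)"
    \<comment> \<open>The entry at \<open>k\<close> is the one that makes equation \<open>i0\<close>
      hold.\<close>
    define y where "y = x(k := - s / A i0 k)"
    have sumy: "(\<Sum>j\<in>J. A i j * y j) = A i k * (- s / A i0 k) + (\<Sum>j\<in>J-{k}. A i j * x j)" for i
    proof -
      have "(\<Sum>j\<in>J-{k}. A i j * y j) = (\<Sum>j\<in>J-{k}. A i j * x j)"
        by (rule sum.cong) (auto simp: y_def)
      then show ?thesis using k insert.prems(1) by (simp add: sum.remove[of J k] y_def)
    qed
    have "(\<Sum>j\<in>J. A i0 j * y j) = 0" using k by (simp add: sumy s_def)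
    moreover have "(\<Sum>j\<in>J. A i j * y j) = 0" if "i \<in> I" for i
    proof -
      have "0 = (\<Sum>j\<in>J-{k}. A i j * x j - A i k / A i0 k * (A i0 j * x j))"
        using x(2) that by (simp add: B_def left_diff_distrib mult.assoc)
      also have "\<dots> = (\<Sum>j\<in>J-{k}. A i j * x j) - A i k / A i0 k * s"
        by (simp add: sum_subtractf s_def sum_distrib_left)
      finally show ?thesis by (simp add: sumy)
    qed
    moreover have "\<exists>j\<in>J. y j \<noteq> 0" using x(1) by (auto simp: y_def)
    ultimately show ?thesis by (intro exI[of _ y]) auto
  qed
qed

text \<open>The right side becomes an additional column, so there is one more unknown than equations
  and a nonzero kernel vector exists. Injectivity forces its entry at \<open>None\<close> to be
  nonzero, and dividing by that entry gives the solution.\<close>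

lemma square_system_solvable:
  fixes A :: "'i \<Rightarrow> 'i \<Rightarrow> real"
  assumes "finite I" and inj: "\<And>x. (\<forall>i\<in>I. (\<Sum>j\<in>I. A i j * x j) = 0) \<Longrightarrow> \<forall>j\<in>I. x j = 0"
  shows "\<exists>x. \<forall>i\<in>I. (\<Sum>j\<in>I. A i j * x j) = b i"
proof -
  let ?J = "insert None (Some ` I)"
  define B where "B i j = (case j of None \<Rightarrow> - b i | Some j \<Rightarrow> A i j)" for i j
  have sumB: "(\<Sum>j\<in>?J. B i j * x j) = - b i * x None + (\<Sum>j\<in>I. A i j * x (Some j))" for i x
    using assms(1) by (subst sum.insert) (auto simp: B_def sum.reindex)
  have "card I < card ?J" using assms(1) by (simp add: card_image)
  from underdetermined_system_kernel[OF assms(1) _ this, of B] assms(1) obtain x where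
    x: "\<exists>j\<in>?J. x j \<noteq> 0" "\<forall>i\<in>I. - b i * x None + (\<Sum>j\<in>I. A i j * x (Some j)) = 0"
    by (auto simp: sumB)
  have nz: "x None \<noteq> 0"
  proof
    assume "x None = 0"
    with x(2) inj[of "\<lambda>j. x (Some j)"] have "\<forall>j\<in>I. x (Some j) = 0" by simp
    with x(1) \<open>x None = 0\<close> show False by auto
  qed
  show ?thesis
  proof (intro exI ballI)
    fix i assume "i \<in> I"
    have "(\<Sum>j\<in>I. A i j * (x (Some j) / x None)) = (\<Sum>j\<in>I. A i j * x (Some j)) / x None"
      by (simp add: sum_divide_distrib)
    also have "\<dots> = b i" using x(2) \<open>i \<in> I\<close> nz by (simp add: field_simps)
    finally show "(\<Sum>j\<in>I. A i j * (x (Some j) / x None)) = b i" .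
  qed
qed

text \<open>Completing the square in one variable leaves a form in the others that is still
  positive, so the margin is obtained by induction on the number of variables. \<open>A\<close> may
  be unsymmetric; \<open>b\<close> is its symmetrised row.\<close>

lemma quadratic_form_coercive:
  fixes A :: "'i \<Rightarrow> 'i \<Rightarrow> real"
  assumes "finite I"
    and "\<And>c. \<exists>i\<in>I. c i \<noteq> 0 \<Longrightarrow> (\<Sum>i\<in>I. \<Sum>j\<in>I. A i j * c i * c j) > 0"
  shows "\<exists>\<kappa>>0. \<forall>c. \<kappa> * (\<Sum>i\<in>I. (c i)\<^sup>2) \<le> (\<Sum>i\<in>I. \<Sum>j\<in>I. A i j * c i * c j)"
  using assms
proof (induction I arbitrary: A rule: finite_induct)
  case empty
  show ?case by (rule exI[of _ 1]) auto
next
  case (insert a I)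
  define \<alpha> where "\<alpha> = A a a"
  define b where "b j = (A a j + A j a) / 2" for j
  define \<beta> where "\<beta> c = (\<Sum>j\<in>I. b j * c j)" for c :: "'i \<Rightarrow> real"
  \<comment> \<open>Schur complement of the entry \<open>\<alpha>\<close>.\<close>
  define B where "B i j = A i j - b i * b j / \<alpha>" for i j
  let ?q = "\<lambda>J A c. \<Sum>i\<in>J. \<Sum>j\<in>J. (A i j :: real) * c i * c j"
  have "?q (insert a I) A (\<lambda>i. if i = a then 1 else 0) > 0"
    by (rule insert.prems) auto
  moreover have "?q (insert a I) A (\<lambda>i. if i = a then 1 else 0) = \<alpha>"
  proof -
    have "i \<noteq> a" if "i \<in> I" for i using that insert.hyps by auto
    then show ?thesis using insert.hyps by (simp add: \<alpha>_def)
  qed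
  ultimately have \<alpha>: "\<alpha> > 0" by simp
  have qB: "?q I B c = ?q I A c - (\<beta> c)\<^sup>2 / \<alpha>" for c
  proof -
    have "(\<beta> c)\<^sup>2 / \<alpha> = (\<Sum>i\<in>I. \<Sum>j\<in>I. b i * b j / \<alpha> * c i * c j)"
      unfolding \<beta>_def power2_eq_square sum_product
      by (simp add: sum_divide_distrib algebra_simps)
    then show ?thesis by (simp add: B_def sum_subtractf algebra_simps)
  qed
  have qA: "?q (insert a I) A c = \<alpha> * (c a + \<beta> c / \<alpha>)\<^sup>2 + ?q I B c" for c
  proof -
    have "?q (insert a I) A c = \<alpha> * (c a)\<^sup>2 + (\<Sum>j\<in>I. A a j * c a * c j) + ((\<Sum>i\<in>I. A i a * c i * c a) + ?q I A c)"
      using insert.hyps by (simp add: \<alpha>_def sum.distrib power2_eq_square algebra_simps)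
    also have "\<dots> = \<alpha> * (c a)\<^sup>2 + 2 * c a * \<beta> c + ?q I A c"
      by (simp add: \<beta>_def b_def sum_distrib_left sum.distrib[symmetric] algebra_simps)
        (simp add: add_divide_distrib algebra_simps sum.distrib)
    also have "\<dots> = \<alpha> * (c a + \<beta> c / \<alpha>)\<^sup>2 + ?q I B c"
      using \<alpha> unfolding qB by (simp add: power2_eq_square field_simps)
    finally show ?thesis .
  qed
  have "\<exists>\<kappa>>0. \<forall>c. \<kappa> * (\<Sum>i\<in>I. (c i)\<^sup>2) \<le> ?q I B c"
  proof (rule insert.IH)
    fix c :: "'i \<Rightarrow> real" assume c: "\<exists>i\<in>I. c i \<noteq> 0"
    \<comment> \<open>This entry at \<open>a\<close> annihilates the completed square, so the full
      form takes the value of the reduced one.\<close>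
    define d where "d = c(a := - \<beta> c / \<alpha>)"
    have ne: "i \<noteq> a" if "i \<in> I" for i using that insert.hyps by auto
    have \<beta>d: "\<beta> d = \<beta> c" unfolding \<beta>_def by (rule sum.cong) (auto simp: d_def ne)
    have qd: "?q I B d = ?q I B c" by (intro sum.cong) (auto simp: d_def ne)
    have "?q (insert a I) A d > 0" by (rule insert.prems) (use c ne in \<open>auto simp: d_def\<close>)
    then show "?q I B c > 0" unfolding qA \<beta>d qd by (simp add: d_def)
  qed
  then obtain \<kappa> where \<kappa>: "\<kappa> > 0" "\<And>c. \<kappa> * (\<Sum>i\<in>I. (c i)\<^sup>2) \<le> ?q I B c" by auto
  define M where "M = (\<Sum>i\<in>I. (b i)\<^sup>2) / \<alpha>\<^sup>2"
  have M: "M \<ge> 0" by (simp add: M_def sum_nonneg)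
  \<comment> \<open>\<open>c a\<close> is split into the completed square and
    \<open>\<beta> c / \<alpha>\<close>. The first bound lets \<open>\<alpha>\<close> pay for twice
    the square, the second lets \<open>\<kappa>\<close> pay for the remaining
    \<open>2 * M + 1\<close> copies of the coefficient sum.\<close>
  define k where "k = min (\<alpha>/2) (\<kappa> / (2 * M + 1))"
  have "k > 0" using \<alpha> \<kappa>(1) M by (simp add: k_def)
  moreover have "k \<le> \<alpha>/2" unfolding k_def by (rule min.cobounded1)
  ultimately have k: "k > 0" "k \<le> \<alpha>/2" by auto
  have "k \<le> \<kappa> / (2 * M + 1)" by (simp add: k_def)
  with M have k3: "k * (2 * M + 1) \<le> \<kappa>" by (subst (asm) pos_le_divide_eq) auto
  show ?case
  proof (intro exI conjI allI)
    show "k > 0" by fact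
    fix c
    let ?S = "\<Sum>i\<in>I. (c i)\<^sup>2" and ?y = "c a + \<beta> c / \<alpha>"
    have S: "?S \<ge> 0" by (simp add: sum_nonneg)
    have "(\<beta> c / \<alpha>)\<^sup>2 \<le> M * ?S"
      using Cauchy_Schwarz_ineq_sum[of b c I] \<alpha> by (simp add: \<beta>_def M_def field_simps)
    moreover have "(c a)\<^sup>2 \<le> 2 * ?y\<^sup>2 + 2 * (\<beta> c / \<alpha>)\<^sup>2"
    proof -
      have "2 * ?y\<^sup>2 + 2 * (\<beta> c / \<alpha>)\<^sup>2 - (c a)\<^sup>2 = (c a + 2 * (\<beta> c / \<alpha>))\<^sup>2"
        by (simp add: power2_eq_square algebra_simps)
      then show ?thesis by (smt (verit) zero_le_power2)
    qed
    ultimately have "(c a)\<^sup>2 + ?S \<le> 2 * ?y\<^sup>2 + (2 * M + 1) * ?S" by (simp add: algebra_simps)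
    then have "k * ((c a)\<^sup>2 + ?S) \<le> k * (2 * ?y\<^sup>2 + (2 * M + 1) * ?S)"
      using k(1) by (intro mult_left_mono) auto
    also have "\<dots> = (2 * k) * ?y\<^sup>2 + (k * (2 * M + 1)) * ?S" by (simp add: algebra_simps)
    also have "\<dots> \<le> \<alpha> * ?y\<^sup>2 + \<kappa> * ?S"
      using k k3 S by (intro add_mono mult_right_mono) auto
    also have "\<dots> \<le> ?q (insert a I) A c" unfolding qA using \<kappa>(2)[of c] by simp
    finally show "k * (\<Sum>i\<in>insert a I. (c i)\<^sup>2) \<le> ?q (insert a I) A c"
      using insert.hyps by simp
  qed
qed

section \<open>Polynomials in two variables\<close>

definition monom2 :: "nat \<times> nat \<Rightarrow> pt \<Rightarrow> real" where
  "monom2 k x = fst x ^ fst k * snd x ^ snd k"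

definition exps :: "nat \<Rightarrow> (nat \<times> nat) set" where
  "exps p = (SIGMA i:{..p}. {..p - i})"

lemma finite_exps [simp]: "finite (exps p)"
  by (simp add: exps_def)

lemma in_exps: "k \<in> exps p \<longleftrightarrow> fst k + snd k \<le> p"
  by (cases k) (auto simp: exps_def)

text \<open>One finite index set in place of the nested sums turns a polynomial into a coefficient
  vector, the form required by the linear algebra above.\<close>

lemma poly2_iff: "f \<in> poly2 p \<longleftrightarrow> (\<exists>c. f = (\<lambda>x. \<Sum>k\<in>exps p. c k * monom2 k x))"
proof
  assume "f \<in> poly2 p"
  then obtain c where c: "\<And>x y. f (x, y) = (\<Sum>i\<le>p. \<Sum>j\<le>p - i. c i j * x ^ i * y ^ j)"
    by (auto simp: poly2_def)
  have "f x = (\<Sum>k\<in>exps p. c (fst k) (snd k) * monom2 k x)" for x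
    by (cases x) (simp add: c exps_def sum.Sigma monom2_def case_prod_beta mult.assoc)
  then show "\<exists>c. f = (\<lambda>x. \<Sum>k\<in>exps p. c k * monom2 k x)"
    by (intro exI[of _ "\<lambda>k. c (fst k) (snd k)"]) auto
next
  assume "\<exists>c. f = (\<lambda>x. \<Sum>k\<in>exps p. c k * monom2 k x)"
  then obtain c where c: "f = (\<lambda>x. \<Sum>k\<in>exps p. c k * monom2 k x)" by auto
  show "f \<in> poly2 p" unfolding poly2_def mem_Collect_eq
    by (rule exI[of _ "\<lambda>i j. c (i, j)"])
      (simp add: c exps_def sum.Sigma monom2_def case_prod_beta mult.assoc)
qed

lemma poly2_add: "f \<in> poly2 p \<Longrightarrow> g \<in> poly2 p \<Longrightarrow> (\<lambda>x. f x + g x) \<in> poly2 p"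
proof -
  assume "f \<in> poly2 p" "g \<in> poly2 p"
  then obtain c d where cd: "f = (\<lambda>x. \<Sum>k\<in>exps p. c k * monom2 k x)"
    "g = (\<lambda>x. \<Sum>k\<in>exps p. d k * monom2 k x)" by (auto simp: poly2_iff)
  show ?thesis unfolding poly2_iff
    by (rule exI[of _ "\<lambda>k. c k + d k"]) (simp add: cd sum.distrib algebra_simps)
qed

lemma poly2_cmult: "f \<in> poly2 p \<Longrightarrow> (\<lambda>x. r * f x) \<in> poly2 p"
proof -
  assume "f \<in> poly2 p"
  then obtain c where c: "f = (\<lambda>x. \<Sum>k\<in>exps p. c k * monom2 k x)" by (auto simp: poly2_iff)
  show ?thesis unfolding poly2_iff
    by (rule exI[of _ "\<lambda>k. r * c k"]) (simp add: c sum_distrib_left algebra_simps)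
qed

lemma poly2_uminus: "f \<in> poly2 p \<Longrightarrow> (\<lambda>x. - f x) \<in> poly2 p"
  using poly2_cmult[of f p "-1"] by simp

lemma poly2_diff: "f \<in> poly2 p \<Longrightarrow> g \<in> poly2 p \<Longrightarrow> (\<lambda>x. f x - g x) \<in> poly2 p"
  using poly2_add[of f p "\<lambda>x. - g x"] poly2_uminus[of g p] by simp

lemma poly2_monom: "fst k + snd k \<le> p \<Longrightarrow> monom2 k \<in> poly2 p"
  unfolding poly2_iff
  by (rule exI[of _ "\<lambda>l. if l = k then 1 else 0"])
    (simp add: if_distrib[of "\<lambda>a. a * _"] sum.delta in_exps cong: if_cong)

lemma poly2_zero: "(\<lambda>x. 0) \<in> poly2 p"
  unfolding poly2_iff by (rule exI[of _ "\<lambda>_. 0"]) simp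

lemma poly2_const: "(\<lambda>x. r) \<in> poly2 p"
  using poly2_cmult[OF poly2_monom[of "(0,0)" p], of r] by (simp add: monom2_def)

lemma poly2_fst: "1 \<le> p \<Longrightarrow> fst \<in> poly2 p"
  using poly2_monom[of "(1,0)" p] by (simp add: monom2_def[abs_def])

lemma poly2_snd: "1 \<le> p \<Longrightarrow> snd \<in> poly2 p"
  using poly2_monom[of "(0,1)" p] by (simp add: monom2_def[abs_def])

lemma poly2_sum: "(\<And>i. i \<in> I \<Longrightarrow> f i \<in> poly2 p) \<Longrightarrow> (\<lambda>x. \<Sum>i\<in>I. f i x) \<in> poly2 p"
  by (induction I rule: infinite_finite_induct) (auto simp: poly2_zero intro: poly2_add)

lemma poly2_mult: 
  assumes "f \<in> poly2 p" "g \<in> poly2 q" "p + q \<le> n"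
  shows "(\<lambda>x. f x * g x) \<in> poly2 n"
proof -
  obtain c d where cd: "f = (\<lambda>x. \<Sum>k\<in>exps p. c k * monom2 k x)"
    "g = (\<lambda>x. \<Sum>k\<in>exps q. d k * monom2 k x)" using assms by (auto simp: poly2_iff)
  have "(\<lambda>x. f x * g x) = (\<lambda>x. \<Sum>k\<in>exps p. \<Sum>l\<in>exps q. (c k * d l) * monom2 (fst k + fst l, snd k + snd l) x)"
    by (simp add: cd sum_product monom2_def power_add algebra_simps)
  also have "\<dots> \<in> poly2 n"
    using assms(3) by (intro poly2_sum poly2_cmult poly2_monom) (auto simp: in_exps)
  finally show ?thesis .
qed

lemma poly2_power: "f \<in> poly2 1 \<Longrightarrow> (\<lambda>x. f x ^ n) \<in> poly2 n"
proof (induction n)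
  case (Suc n)
  then show ?case using poly2_mult[of f 1 "\<lambda>x. f x ^ n" n "Suc n"] by simp
qed (simp add: poly2_const)

lemma poly2_compose_affine:
  assumes "f \<in> poly2 p" "g \<in> poly2 1" "h \<in> poly2 1"
  shows "(\<lambda>x. f (g x, h x)) \<in> poly2 p"
proof -
  obtain c where c: "f = (\<lambda>x. \<Sum>k\<in>exps p. c k * monom2 k x)"
    using assms by (auto simp: poly2_iff)
  have "(\<lambda>x. f (g x, h x)) = (\<lambda>x. \<Sum>k\<in>exps p. c k * (g x ^ fst k * h x ^ snd k))"
    by (simp add: c monom2_def)
  also have "\<dots> \<in> poly2 p"
    by (intro poly2_sum poly2_cmult poly2_mult[OF poly2_power poly2_power] assms)
      (auto simp: in_exps)
  finally show ?thesis .
qed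

lemma sum_mult_zero_power: "(\<Sum>j\<le>n. c j * 0 ^ j) = (c 0 :: real)"
  by (induction n) auto

lemma poly2_along_line:
  assumes "f \<in> poly2 p"
  shows "\<exists>d. \<forall>t. f (u + t *\<^sub>R v) = (\<Sum>k\<le>p. d k * t ^ k)"
proof -
  \<comment> \<open>The parameter of the line is the first coordinate. Evaluating the second
    coordinate at 0 keeps just the terms with \<open>j = 0\<close>, because
    \<open>0 ^ 0 = 1\<close>.\<close>
  have "(\<lambda>x. f (fst u + fst v * fst x, snd u + snd v * fst x)) \<in> poly2 p"
    by (rule poly2_compose_affine[OF assms]; intro poly2_add poly2_const poly2_cmult poly2_fst) simp_all
  then obtain c where c: "\<And>x y. f (fst u + fst v * x, snd u + snd v * x) = (\<Sum>i\<le>p. \<Sum>j\<le>p - i. c i j * x ^ i * y ^ j)"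
    by (auto simp: poly2_def)
  have "f (u + t *\<^sub>R v) = (\<Sum>k\<le>p. c k 0 * t ^ k)" for t
  proof -
    have "f (u + t *\<^sub>R v) = f (fst u + fst v * t, snd u + snd v * t)"
      by (rule arg_cong[where f = f]) (simp add: prod_eq_iff mult.commute)
    also have "\<dots> = (\<Sum>i\<le>p. \<Sum>j\<le>p - i. c i j * t ^ i * 0 ^ j)" by (rule c)
    also have "\<dots> = (\<Sum>i\<le>p. c i 0 * t ^ i)"
      by (simp add: sum_mult_zero_power)
    finally show ?thesis .
  qed
  then show ?thesis by (intro exI[of _ "\<lambda>k. c k 0"]) simp
qed

lemma poly2_continuous: "f \<in> poly2 p \<Longrightarrow> continuous_on S f"
  by (auto simp: poly2_iff monom2_def intro!: continuous_intros)

section \<open>Polynomials determined by finitely many values\<close>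

lemma polyfun_zero_at_points:
  fixes c :: "nat \<Rightarrow> real"
  assumes "inj_on x {..p}" "\<And>i. i \<le> p \<Longrightarrow> (\<Sum>k\<le>p. c k * x i ^ k) = 0"
  shows "\<forall>k\<le>p. c k = 0"
proof (rule ccontr)
  assume "\<not> ?thesis"
  then have k: "\<exists>k\<le>p. c k \<noteq> 0" by auto
  have "card (x ` {..p}) \<le> card {z. (\<Sum>i\<le>p. c i * z ^ i) = 0}"
    using assms(2) polyfun_rootbound_finite[OF k] by (intro card_mono) auto
  also have "\<dots> \<le> p" by (rule polyfun_rootbound_card[OF k])
  finally show False using assms(1) by (simp add: card_image)
qed

lemma monom2_independent:
  assumes "\<And>x. (\<Sum>k\<in>exps p. c k * monom2 k x) = 0" "k \<in> exps p"
  shows "c k = 0"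
proof -
  have *: "(\<Sum>i\<le>p. \<Sum>j\<le>p - i. c (i, j) * x ^ i * y ^ j) = 0" for x y
    using assms(1)[of "(x, y)"] by (simp add: exps_def sum.Sigma monom2_def case_prod_beta mult.assoc)
  have **: "\<forall>i\<le>p. (\<Sum>j\<le>p - i. c (i, j) * y ^ j) = 0" for y
  proof -
    have "\<forall>x. (\<Sum>i\<le>p. (\<Sum>j\<le>p - i. c (i, j) * y ^ j) * x ^ i) = 0"
      using *[of _ y] by (simp add: sum_distrib_left sum_distrib_right mult_ac)
    then show ?thesis by (simp only: polyfun_eq_0)
  qed
  obtain i j where k: "k = (i, j)" "i \<le> p" "j \<le> p - i" using assms(2) by (auto simp: exps_def)
  have "\<forall>y. (\<Sum>j\<le>p - i. c (i, j) * y ^ j) = 0" using ** k by auto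
  then have "\<forall>j\<le>p - i. c (i, j) = 0" by (simp only: polyfun_eq_0)
  with k show ?thesis by simp
qed

text \<open>Unisolvence of the triangular lattice. The bottom row has one point more than the
  degree, so \<open>f\<close> vanishes on the first axis and is \<open>y\<close> times a polynomial
  of lower degree. That factor vanishes on the remaining rows, which form the next smaller
  lattice.\<close>

lemma poly2_zero_on_grid:
  assumes "f \<in> poly2 p" "\<And>i j. i + j \<le> p \<Longrightarrow> f (real i, real j) = 0"
  shows "f x = 0"
  using assms
proof (induction p arbitrary: f x)
  case 0
  then obtain c where "\<And>x y. f (x, y) = c" by (auto simp: poly2_def)
  with 0(2)[of 0 0] show ?case by (cases x) auto
next
  case (Suc p)
  obtain c where c: "\<And>x y. f (x, y) = (\<Sum>i\<le>Suc p. \<Sum>j\<le>Suc p - i. c i j * x ^ i * y ^ j)"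
    using Suc.prems(1) by (auto simp: poly2_def)
  have "\<forall>i\<le>Suc p. c i 0 = 0"
  proof (rule polyfun_zero_at_points)
    show "inj_on real {..Suc p}" by (auto simp: inj_on_def)
    fix i assume "i \<le> Suc p"
    then have "0 = f (real i, 0)" using Suc.prems(2)[of i 0] by simp
    also have "\<dots> = (\<Sum>k\<le>Suc p. c k 0 * real i ^ k)" unfolding c
      by (simp only: sum_mult_zero_power)
    finally show "(\<Sum>k\<le>Suc p. c k 0 * real i ^ k) = 0" by simp
  qed
  then have c0: "i \<le> Suc p \<Longrightarrow> c i 0 = 0" for i by blast
  define h where "h = (\<lambda>x. \<Sum>i\<le>p. \<Sum>j\<le>p - i. c i (Suc j) * fst x ^ i * snd x ^ j)"
  have h: "h \<in> poly2 p" by (auto simp: poly2_def h_def)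
  have fh: "f (x, y) = y * h (x, y)" for x y
  proof -
    have "f (x, y) = (\<Sum>i\<le>p. \<Sum>j\<le>Suc p - i. c i j * x ^ i * y ^ j)"
      unfolding c using c0[of "Suc p"] by simp
    also have "\<dots> = (\<Sum>i\<le>p. y * (\<Sum>j\<le>p - i. c i (Suc j) * x ^ i * y ^ j))"
    proof (intro sum.cong refl)
      fix i assume "i \<in> {..p}"
      then show "(\<Sum>j\<le>Suc p - i. c i j * x ^ i * y ^ j) = y * (\<Sum>j\<le>p - i. c i (Suc j) * x ^ i * y ^ j)"
        using c0[of i] by (simp only: Suc_diff_le atMost_iff sum.atMost_Suc_shift) (simp add: sum_distrib_left mult_ac)
    qed
    finally show ?thesis by (simp add: h_def sum_distrib_left)
  qed
  \<comment> \<open>The shift moves the row \<open>j = 1\<close> to \<open>j = 0\<close>, where the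
    induction hypothesis expects it.\<close>
  define g where "g = (\<lambda>x. h (fst x, snd x + 1))"
  have "g \<in> poly2 p" unfolding g_def
    by (rule poly2_compose_affine[OF h]; intro poly2_add poly2_const poly2_fst poly2_snd) simp_all
  moreover have "g (real i, real j) = 0" if "i + j \<le> p" for i j
    using Suc.prems(2)[of i "Suc j"] that by (simp add: fh g_def add.commute)
  ultimately have "g x = 0" for x by (rule Suc.IH)
  from this[of "(fst x, snd x - 1)"] show ?case by (cases x) (simp add: fh g_def)
qed

lemma poly2_zero_on_scaled_grid:
  assumes f: "f \<in> poly2 p" and r: "r \<noteq> 0" and "\<And>i j. i + j \<le> p \<Longrightarrow> f (r * real i, r * real j) = 0"
  shows "f x = 0"
proof -
  define g where "g = (\<lambda>x. f (r * fst x, r * snd x))"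
  have "g \<in> poly2 p" unfolding g_def
    by (rule poly2_compose_affine[OF f]; intro poly2_cmult poly2_fst poly2_snd) simp_all
  then have "g x = 0" for x by (rule poly2_zero_on_grid) (use assms(3) in \<open>simp add: g_def\<close>)
  from this[of "(fst x / r, snd x / r)"] show ?thesis using r by (simp add: g_def)
qed

section \<open>Gradient and divergence of polynomials\<close>

text \<open>\<open>grad\<close> is defined by partial derivatives. Identifying it from a total
  derivative makes the usual derivative rules available.\<close>

lemma grad_eqI: "(f has_derivative (\<lambda>h. inner g h)) (at x) \<Longrightarrow> grad f x = g"
proof -
  assume f: "(f has_derivative (\<lambda>h. inner g h)) (at x)"
  obtain x1 x2 where x: "x = (x1, x2)" by (cases x)
  have "((\<lambda>s. f (s, x2)) has_derivative (\<lambda>h. inner g (h, 0))) (at x1)"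
    by (rule has_derivative_compose[where g = f and f = "\<lambda>s. (s, x2)" and f' = "\<lambda>h. (h, 0)"])
      (use f x in \<open>auto intro!: derivative_eq_intros\<close>)
  then have "((\<lambda>s. f (s, x2)) has_real_derivative fst g) (at x1)"
    by (simp add: has_field_derivative_def inner_prod_def)
  moreover have "((\<lambda>s. f (x1, s)) has_derivative (\<lambda>h. inner g (0, h))) (at x2)"
    by (rule has_derivative_compose[where g = f and f = "\<lambda>s. (x1, s)" and f' = "\<lambda>h. (0, h)"])
      (use f x in \<open>auto intro!: derivative_eq_intros\<close>)
  then have "((\<lambda>s. f (x1, s)) has_real_derivative snd g) (at x2)"
    by (simp add: has_field_derivative_def inner_prod_def)
  ultimately show ?thesis by (simp add: grad_def x DERIV_imp_deriv prod_eq_iff)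
qed

lemma divg_eq: "divg v x = fst (grad (\<lambda>y. fst (v y)) x) + snd (grad (\<lambda>y. snd (v y)) x)"
  by (simp add: divg_def grad_def)

lemma vpoly2_iff: "v \<in> vpoly2 p \<longleftrightarrow> (\<lambda>x. fst (v x)) \<in> poly2 p \<and> (\<lambda>x. snd (v x)) \<in> poly2 p"
  by (simp add: vpoly2_def)

lemma vpoly2_add: "v \<in> vpoly2 p \<Longrightarrow> w \<in> vpoly2 p \<Longrightarrow> (\<lambda>x. v x + w x) \<in> vpoly2 p"
  by (auto simp: vpoly2_iff intro: poly2_add)

lemma vpoly2_scaleR: "v \<in> vpoly2 p \<Longrightarrow> (\<lambda>x. r *\<^sub>R v x) \<in> vpoly2 p"
  by (auto simp: vpoly2_iff intro: poly2_cmult)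

lemma vpoly2_zero: "(\<lambda>x. 0) \<in> vpoly2 p"
  by (auto simp: vpoly2_iff intro: poly2_zero)

lemma vpoly2_sum: "(\<And>i. i \<in> I \<Longrightarrow> f i \<in> vpoly2 p) \<Longrightarrow> (\<lambda>x. \<Sum>i\<in>I. f i x) \<in> vpoly2 p"
  by (induction I rule: infinite_finite_induct) (auto simp: vpoly2_zero intro: vpoly2_add)

lemma vpoly2_continuous: "v \<in> vpoly2 p \<Longrightarrow> continuous_on S v"
proof -
  assume "v \<in> vpoly2 p"
  then have "continuous_on S (\<lambda>x. (fst (v x), snd (v x)))"
    by (intro continuous_on_Pair poly2_continuous) (auto simp: vpoly2_iff)
  then show ?thesis by simp
qed

lemma monom2_has_derivative:
  "(monom2 k has_derivative
     (\<lambda>h. inner (real (fst k) * monom2 (fst k - 1, snd k) x, real (snd k) * monom2 (fst k, snd k - 1) x) h)) (at x)"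
proof -
  have "((\<lambda>y. fst y ^ i) has_derivative (\<lambda>h. real i * fst x ^ (i - 1) * fst h)) (at x)" for i and x :: pt
    using has_derivative_power[OF has_derivative_fst[OF has_derivative_ident], of i x UNIV]
    by (simp add: mult_ac)
  moreover have "((\<lambda>y. snd y ^ i) has_derivative (\<lambda>h. real i * snd x ^ (i - 1) * snd h)) (at x)" for i and x :: pt
    using has_derivative_power[OF has_derivative_snd[OF has_derivative_ident], of i x UNIV]
    by (simp add: mult_ac)
  ultimately have "((\<lambda>y. fst y ^ fst k * snd y ^ snd k) has_derivative
    (\<lambda>h. fst x ^ fst k * (real (snd k) * snd x ^ (snd k - 1) * snd h)
       + real (fst k) * fst x ^ (fst k - 1) * fst h * snd x ^ snd k)) (at x)"
    by (intro has_derivative_mult)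
  then show ?thesis
    unfolding monom2_def[abs_def] by (simp add: inner_prod_def mult_ac add.commute)
qed

text \<open>The degree bound is kept at \<open>p\<close> so that the gradient of the scalar unknown
  is an admissible test function in the local problem.\<close>

lemma poly2_has_gradient:
  assumes "f \<in> poly2 p"
  shows "\<exists>g\<in>vpoly2 p. \<forall>x. (f has_derivative (\<lambda>h. inner (g x) h)) (at x)"
proof -
  obtain c where c: "f = (\<lambda>x. \<Sum>k\<in>exps p. c k * monom2 k x)"
    using assms by (auto simp: poly2_iff)
  \<comment> \<open>At an exponent 0 the truncated subtraction returns 0 again, but the factor
    \<open>real 0\<close> removes the term.\<close>
  define G where "G k x = (real (fst k) * monom2 (fst k - 1, snd k) x, real (snd k) * monom2 (fst k, snd k - 1) x)" for k x
  have G: "G k \<in> vpoly2 p" if "k \<in> exps p" for k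
    using that unfolding vpoly2_iff G_def
    by (auto intro!: poly2_cmult poly2_monom simp: in_exps)
  have "(f has_derivative (\<lambda>h. \<Sum>k\<in>exps p. c k * inner (G k x) h)) (at x)" for x
    unfolding c G_def
    by (intro has_derivative_sum has_derivative_mult_right monom2_has_derivative)
  then have "(f has_derivative (\<lambda>h. inner (\<Sum>k\<in>exps p. c k *\<^sub>R G k x) h)) (at x)" for x
    by (simp add: inner_sum_left)
  moreover have "(\<lambda>x. \<Sum>k\<in>exps p. c k *\<^sub>R G k x) \<in> vpoly2 p"
    by (intro vpoly2_sum vpoly2_scaleR G)
  ultimately show ?thesis by (intro bexI[of _ "\<lambda>x. \<Sum>k\<in>exps p. c k *\<^sub>R G k x"]) auto
qed

lemma poly2_has_derivative:
  "f \<in> poly2 p \<Longrightarrow> (f has_derivative (\<lambda>h. inner (grad f x) h)) (at x)"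
  using poly2_has_gradient[of f p] grad_eqI by metis

lemma vpoly2_grad: "f \<in> poly2 p \<Longrightarrow> grad f \<in> vpoly2 p"
proof -
  assume "f \<in> poly2 p"
  from poly2_has_gradient[OF this] obtain g where g: "g \<in> vpoly2 p" "\<forall>x. (f has_derivative (\<lambda>h. inner (g x) h)) (at x)" by auto
  have "grad f = g" by (rule ext) (use g grad_eqI in blast)
  with g show ?thesis by simp
qed

lemma divg_poly2: "v \<in> vpoly2 p \<Longrightarrow> divg v \<in> poly2 p"
  using vpoly2_grad[of "\<lambda>x. fst (v x)" p] vpoly2_grad[of "\<lambda>x. snd (v x)" p]
  by (auto simp: vpoly2_iff divg_eq[abs_def] intro: poly2_add)

lemma grad_add:
  assumes "f \<in> poly2 p" "g \<in> poly2 p"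
  shows "grad (\<lambda>x. f x + g x) x = grad f x + grad g x"
  by (rule grad_eqI, simp add: inner_add_left)
    (intro has_derivative_add poly2_has_derivative[OF assms(1)] poly2_has_derivative[OF assms(2)])

lemma grad_cmult:
  assumes "f \<in> poly2 p"
  shows "grad (\<lambda>x. r * f x) x = r *\<^sub>R grad f x"
  by (rule grad_eqI, simp)
    (intro has_derivative_mult_right poly2_has_derivative[OF assms(1)])

lemma grad_diff:
  assumes "f \<in> poly2 p" "g \<in> poly2 p"
  shows "grad (\<lambda>x. f x - g x) x = grad f x - grad g x"
  by (rule grad_eqI, simp add: inner_diff_left)
    (intro has_derivative_diff poly2_has_derivative[OF assms(1)] poly2_has_derivative[OF assms(2)])

lemma divg_add:
  assumes "v \<in> vpoly2 p" "w \<in> vpoly2 p"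
  shows "divg (\<lambda>x. v x + w x) x = divg v x + divg w x"
  using assms by (simp add: divg_eq vpoly2_iff grad_add[of _ p])

lemma divg_scaleR:
  assumes "v \<in> vpoly2 p"
  shows "divg (\<lambda>x. r *\<^sub>R v x) x = r * divg v x"
  using assms by (simp add: divg_eq vpoly2_iff grad_cmult[of _ p] algebra_simps)

section \<open>Integration over triangles\<close>

definition det2 :: "pt \<Rightarrow> pt \<Rightarrow> real" where
  "det2 u v = fst u * snd v - snd u * fst v"

definition amap :: "pt \<Rightarrow> pt \<Rightarrow> pt \<Rightarrow> pt \<Rightarrow> pt" where
  "amap a b c x = a + fst x *\<^sub>R (b - a) + snd x *\<^sub>R (c - a)"

text \<open>Cramer's rule for the inverse of \<open>amap\<close>. The entries are the barycentric
  coordinates at \<open>b\<close> and \<open>c\<close>; the one at \<open>a\<close> is 1 minus their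
  sum.\<close>

definition acoord :: "pt \<Rightarrow> pt \<Rightarrow> pt \<Rightarrow> pt \<Rightarrow> pt" where
  "acoord a b c x = (det2 (x - a) (c - a) / det2 (b - a) (c - a), det2 (b - a) (x - a) / det2 (b - a) (c - a))"

definition ref_tri :: "pt set" where
  "ref_tri = {x. 0 \<le> fst x \<and> 0 \<le> snd x \<and> fst x + snd x \<le> 1}"

lemma amap_acoord:
  assumes "det2 (b - a) (c - a) \<noteq> 0"
  shows "amap a b c (acoord a b c x) = x"
proof -
  let ?D = "det2 (b - a) (c - a)"
  have "?D *\<^sub>R (amap a b c (acoord a b c x) - a) = ?D *\<^sub>R (x - a)"
    using assms unfolding amap_def acoord_def
    by (simp add: prod_eq_iff distrib_left mult.assoc[symmetric]) (simp add: det2_def algebra_simps)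
  then show ?thesis using assms by simp
qed

lemma acoord_amap:
  assumes "det2 (b - a) (c - a) \<noteq> 0"
  shows "acoord a b c (amap a b c x) = x"
proof -
  have "det2 (amap a b c x - a) (c - a) = fst x * det2 (b - a) (c - a)"
    "det2 (b - a) (amap a b c x - a) = snd x * det2 (b - a) (c - a)"
    by (simp_all add: det2_def amap_def algebra_simps)
  then show ?thesis using assms by (simp add: acoord_def prod_eq_iff)
qed

lemma continuous_on_acoord: "continuous_on S (acoord a b c)"
  unfolding acoord_def det2_def divide_inverse by (intro continuous_intros)

lemma continuous_on_amap: "continuous_on S (amap a b c)"
  unfolding amap_def by (intro continuous_intros)

lemma tri_amap: "tri {a, b, c} = amap a b c ` ref_tri"
proof (intro set_eqI iffI)
  fix x assume "x \<in> tri {a, b, c}"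
  then obtain u v where "x = a + u *\<^sub>R (b - a) + v *\<^sub>R (c - a)" "0 \<le> u" "0 \<le> v" "u + v \<le> 1"
    unfolding tri_def convex_hull_3_alt by blast
  then show "x \<in> amap a b c ` ref_tri"
    by (intro image_eqI[of _ _ "(u, v)"]) (auto simp: amap_def ref_tri_def)
next
  fix x assume "x \<in> amap a b c ` ref_tri"
  then show "x \<in> tri {a, b, c}"
    unfolding tri_def convex_hull_3_alt amap_def ref_tri_def by blast
qed

lemma tri_acoord:
  assumes "det2 (b - a) (c - a) \<noteq> 0"
  shows "x \<in> tri {a, b, c} \<longleftrightarrow> acoord a b c x \<in> ref_tri"
  unfolding tri_amap using amap_acoord[OF assms] acoord_amap[OF assms] by (metis image_iff)

lemma collinear_iff_det2: "collinear {a, b, c} \<longleftrightarrow> det2 (b - a) (c - a) = 0"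
proof -
  have "collinear {a, b, c} \<longleftrightarrow> collinear {0, b - a, c - a}"
    using collinear_3[of b a c] by (simp add: insert_commute)
  also have "\<dots> \<longleftrightarrow> det2 (b - a) (c - a) = 0"
  proof
    assume "collinear {0, b - a, c - a}"
    moreover have "det2 u (k *\<^sub>R u) = 0" "det2 u 0 = 0" "det2 0 u = 0" for k u
      by (auto simp: det2_def)
    ultimately show "det2 (b - a) (c - a) = 0" unfolding collinear_lemma by metis
  next
    assume D: "det2 (b - a) (c - a) = 0"
    define u v where "u = b - a" and "v = c - a"
    have uv: "fst u * snd v = snd u * fst v" using D by (simp add: det2_def u_def v_def)
    have "\<exists>k. v = k *\<^sub>R u" if "u \<noteq> 0"
    proof (cases "fst u = 0")
      case True
      then have "snd u \<noteq> 0" using that by (simp add: prod_eq_iff)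
      then show ?thesis using uv True
        by (intro exI[of _ "snd v / snd u"]) (auto simp: prod_eq_iff)
    next
      case False
      then show ?thesis using uv
        by (intro exI[of _ "fst v / fst u"]) (auto simp: prod_eq_iff field_simps)
    qed
    then show "collinear {0, b - a, c - a}"
      unfolding collinear_lemma u_def v_def by blast
  qed
  finally show ?thesis .
qed

lemma is_tri_iff:
  "is_tri V \<longleftrightarrow> (\<exists>a b c. V = {a, b, c} \<and> a \<noteq> b \<and> b \<noteq> c \<and> a \<noteq> c \<and> det2 (b - a) (c - a) \<noteq> 0)"
  unfolding is_tri_def card_3_iff using collinear_iff_det2 by blast

lemma is_tri_det2: "is_tri {a, b, c} \<Longrightarrow> det2 (b - a) (c - a) \<noteq> 0"
  by (simp add: is_tri_def collinear_iff_det2)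

lemma is_tri_distinct: "is_tri {a, b, c} \<Longrightarrow> a \<noteq> b \<and> b \<noteq> c \<and> a \<noteq> c"
  by (auto simp: is_tri_def card_insert_if split: if_splits)

lemma is_tri_cases:
  assumes "is_tri V"
  obtains a b c where "V = {a, b, c}" "a \<noteq> b" "b \<noteq> c" "a \<noteq> c" "det2 (b - a) (c - a) \<noteq> 0"
  using assms unfolding is_tri_iff by blast

section \<open>Change of variables between a triangle and the reference triangle\<close>

lemma nn_integral_swap2:
  fixes f :: "pt \<Rightarrow> ennreal"
  assumes [measurable]: "f \<in> borel_measurable borel"
  shows "(\<integral>\<^sup>+x. f (snd x, fst x) \<partial>lborel) = (\<integral>\<^sup>+x. f x \<partial>lborel)"
proof -
  have [measurable]: "f \<in> borel_measurable (borel \<Otimes>\<^sub>M borel)" using assms by (simp add: borel_prod)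
  have "(\<integral>\<^sup>+x. f (snd x, fst x) \<partial>(lborel \<Otimes>\<^sub>M lborel)) = (\<integral>\<^sup>+x. \<integral>\<^sup>+y. f (y, x) \<partial>lborel \<partial>lborel)"
    by (subst lborel.nn_integral_fst[symmetric]) auto
  also have "\<dots> = (\<integral>\<^sup>+x. f x \<partial>(lborel \<Otimes>\<^sub>M lborel))"
    by (rule lborel_pair.nn_integral_snd) auto
  finally show ?thesis by (simp add: lborel_prod)
qed

text \<open>Fubini reduces the planar substitution to two one-dimensional ones: the matrix is
  brought to triangular form, and each variable contributes one factor of the determinant.\<close>

lemma nn_integral_affine2:
  fixes f :: "pt \<Rightarrow> ennreal"
  assumes [measurable]: "f \<in> borel_measurable borel" and D: "\<alpha> * \<delta> - \<beta> * \<gamma> \<noteq> 0"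
  shows "(\<integral>\<^sup>+x. f x \<partial>lborel) = ennreal \<bar>\<alpha> * \<delta> - \<beta> * \<gamma>\<bar> *
    (\<integral>\<^sup>+x. f (s + \<alpha> * fst x + \<beta> * snd x, t + \<gamma> * fst x + \<delta> * snd x) \<partial>lborel)"
proof -
  have main: "(\<integral>\<^sup>+x. f x \<partial>lborel) = ennreal \<bar>\<alpha> * \<delta> - \<beta> * \<gamma>\<bar> *
    (\<integral>\<^sup>+x. f (s + \<alpha> * fst x + \<beta> * snd x, t + \<gamma> * fst x + \<delta> * snd x) \<partial>lborel)"
    if \<alpha>: "\<alpha> \<noteq> 0" and D: "\<alpha> * \<delta> - \<beta> * \<gamma> \<noteq> 0" and [measurable]: "f \<in> borel_measurable borel"
    for f :: "pt \<Rightarrow> ennreal" and \<alpha> \<beta> \<gamma> \<delta>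
  proof -
    have [measurable]: "f \<in> borel_measurable (borel \<Otimes>\<^sub>M borel)" using that by (simp add: borel_prod)
    \<comment> \<open>The second pivot after elimination of the first column; the determinant is
      \<open>\<alpha> * d\<close>.\<close>
    define d where "d = \<delta> - \<gamma> * \<beta> / \<alpha>"
    have d: "d \<noteq> 0" "\<alpha> * \<delta> - \<beta> * \<gamma> = \<alpha> * d" using D \<alpha> by (auto simp: d_def field_simps)
    have inner: "(\<integral>\<^sup>+u. f (u, t + \<gamma> * (u - s) / \<alpha> + d * y) \<partial>lborel)
        = ennreal \<bar>\<alpha>\<bar> * (\<integral>\<^sup>+x. f (s + \<alpha> * x + \<beta> * y, t + \<gamma> * x + \<delta> * y) \<partial>lborel)" for y
    proof -
      have "(\<integral>\<^sup>+u. f (u, t + \<gamma> * (u - s) / \<alpha> + d * y) \<partial>lborel)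
        = ennreal \<bar>\<alpha>\<bar> * (\<integral>\<^sup>+x. f ((s + \<beta> * y) + \<alpha> * x, t + \<gamma> * ((s + \<beta> * y) + \<alpha> * x - s) / \<alpha> + d * y) \<partial>lborel)"
        by (rule nn_integral_real_affine) (use \<alpha> in auto)
      also have "(\<lambda>x. f ((s + \<beta> * y) + \<alpha> * x, t + \<gamma> * ((s + \<beta> * y) + \<alpha> * x - s) / \<alpha> + d * y))
        = (\<lambda>x. f (s + \<alpha> * x + \<beta> * y, t + \<gamma> * x + \<delta> * y))"
        by (intro ext arg_cong[where f = f]) (use \<alpha> in \<open>simp add: d_def prod_eq_iff field_simps\<close>)
      finally show ?thesis .
    qed
    have "(\<integral>\<^sup>+x. f x \<partial>lborel) = (\<integral>\<^sup>+u. \<integral>\<^sup>+v. f (u, v) \<partial>lborel \<partial>lborel)"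
      by (subst lborel.nn_integral_fst) (auto simp: lborel_prod)
    also have "\<dots> = (\<integral>\<^sup>+u. ennreal \<bar>d\<bar> * (\<integral>\<^sup>+y. f (u, t + \<gamma> * (u - s) / \<alpha> + d * y) \<partial>lborel) \<partial>lborel)"
      by (intro nn_integral_cong nn_integral_real_affine) (use d in auto)
    also have "\<dots> = ennreal \<bar>d\<bar> * (\<integral>\<^sup>+u. \<integral>\<^sup>+y. f (u, t + \<gamma> * (u - s) / \<alpha> + d * y) \<partial>lborel \<partial>lborel)"
      by (rule nn_integral_cmult) auto
    also have "(\<integral>\<^sup>+u. \<integral>\<^sup>+y. f (u, t + \<gamma> * (u - s) / \<alpha> + d * y) \<partial>lborel \<partial>lborel)
       = (\<integral>\<^sup>+y. \<integral>\<^sup>+u. f (u, t + \<gamma> * (u - s) / \<alpha> + d * y) \<partial>lborel \<partial>lborel)"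
      by (rule lborel_pair.Fubini'[symmetric]) auto
    also have "\<dots> = ennreal \<bar>\<alpha>\<bar> * (\<integral>\<^sup>+y. \<integral>\<^sup>+x. f (s + \<alpha> * x + \<beta> * y, t + \<gamma> * x + \<delta> * y) \<partial>lborel \<partial>lborel)"
      unfolding inner by (rule nn_integral_cmult) auto
    also have "(\<integral>\<^sup>+y. \<integral>\<^sup>+x. f (s + \<alpha> * x + \<beta> * y, t + \<gamma> * x + \<delta> * y) \<partial>lborel \<partial>lborel)
      = (\<integral>\<^sup>+x. f (s + \<alpha> * fst x + \<beta> * snd x, t + \<gamma> * fst x + \<delta> * snd x) \<partial>(lborel \<Otimes>\<^sub>M lborel))"
      by (subst lborel_pair.nn_integral_snd[symmetric]) auto
    finally show ?thesis unfolding d(2) by (simp add: lborel_prod abs_mult ennreal_mult mult_ac)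
  qed
  show ?thesis
  proof (cases "\<alpha> = 0")
    case False
    then show ?thesis using main D assms(1) by blast
  next
    case True
    \<comment> \<open>With \<open>\<alpha> = 0\<close> a nonzero determinant forces
      \<open>\<beta>\<close> to be nonzero. Exchanging the columns amounts to exchanging the
      integration variables.\<close>
    then have "\<beta> \<noteq> 0" using D by auto
    from main[OF this, of \<gamma> \<alpha> \<delta> f] D have "(\<integral>\<^sup>+x. f x \<partial>lborel) = ennreal \<bar>\<beta> * \<gamma> - \<alpha> * \<delta>\<bar> *
      (\<integral>\<^sup>+x. f (s + \<beta> * fst x + \<alpha> * snd x, t + \<delta> * fst x + \<gamma> * snd x) \<partial>lborel)" by simp
    also have "(\<integral>\<^sup>+x. f (s + \<beta> * fst x + \<alpha> * snd x, t + \<delta> * fst x + \<gamma> * snd x) \<partial>lborel) =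
      (\<integral>\<^sup>+x. f (s + \<alpha> * fst x + \<beta> * snd x, t + \<gamma> * fst x + \<delta> * snd x) \<partial>lborel)"
      using nn_integral_swap2[of "\<lambda>x. f (s + \<alpha> * fst x + \<beta> * snd x, t + \<gamma> * fst x + \<delta> * snd x)"]
      by (simp add: ac_simps borel_prod[symmetric])
    finally show ?thesis by (simp add: abs_minus_commute)
  qed
qed

lemma amap_measurable [measurable]: "amap a b c \<in> borel_measurable borel"
  by (rule borel_measurable_continuous_onI[OF continuous_on_amap])

text \<open>As an identity of measures the substitution passes from nonnegative integrands to real
  ones.\<close>

lemma lborel_amap:
  assumes "det2 (b - a) (c - a) \<noteq> 0"
  shows "lborel = density (distr lborel borel (amap a b c)) (\<lambda>_. ennreal \<bar>det2 (b - a) (c - a)\<bar>)"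
proof (rule measure_eqI)
  fix X :: "pt set" assume "X \<in> sets lborel"
  then have [measurable]: "X \<in> sets borel" by simp
  have am: "amap a b c x = (fst a + fst (b - a) * fst x + fst (c - a) * snd x, snd a + snd (b - a) * fst x + snd (c - a) * snd x)" for x
    by (simp add: amap_def prod_eq_iff mult.commute)
  have "emeasure lborel X = (\<integral>\<^sup>+x. indicator X x \<partial>lborel)" by simp
  also have "\<dots> = ennreal \<bar>det2 (b - a) (c - a)\<bar> * (\<integral>\<^sup>+x. indicator X (amap a b c x) \<partial>lborel)"
    unfolding am using nn_integral_affine2[of "indicator X" "fst (b-a)" "snd (c-a)" "fst (c-a)" "snd (b-a)" "fst a" "snd a"] assms
    by (simp add: det2_def mult.commute)
  also have "\<dots> = emeasure (density (distr lborel borel (amap a b c)) (\<lambda>_. ennreal \<bar>det2 (b - a) (c - a)\<bar>)) X"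
  proof -
    have "amap a b c -` X \<in> sets borel" using measurable_sets[OF amap_measurable, of X a b c] by simp
    moreover have "(\<lambda>x. indicator X (amap a b c x)) = (indicator (amap a b c -` X) :: pt \<Rightarrow> ennreal)"
      by (auto simp: indicator_def)
    ultimately have "(\<integral>\<^sup>+x. indicator X (amap a b c x) \<partial>lborel) = emeasure lborel (amap a b c -` X)"
      by simp
    then show ?thesis by (simp add: emeasure_density_const emeasure_distr)
  qed
  finally show "emeasure lborel X = \<dots>" .
qed simp

text \<open>Passage from the gauge integral to the Lebesgue integral, where image measures and
  Fubini are available.\<close>

lemma integral_eq_lborel:
  fixes f :: "pt \<Rightarrow> real"
  assumes "compact S" "continuous_on S f"
  shows "integral S f = (\<integral>x. indicator S x *\<^sub>R f x \<partial>lborel)" "f integrable_on S"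
proof -
  have "set_integrable lborel S f"
    unfolding set_integrable_def by (rule borel_integrable_compact[OF assms])
  from set_borel_integral_eq_integral[OF this]
  show "integral S f = (\<integral>x. indicator S x *\<^sub>R f x \<partial>lborel)" "f integrable_on S"
    by (simp_all add: set_lebesgue_integral_def)
qed

lemma compact_tri: "finite V \<Longrightarrow> compact (tri V)"
  by (simp add: tri_def finite_imp_compact_convex_hull)

lemma compact_ref_tri: "compact ref_tri"
proof -
  have "ref_tri = tri {0, (1, 0), (0, 1)}"
    unfolding tri_amap by (auto simp: amap_def image_iff prod_eq_iff)
  then show ?thesis by (metis compact_tri finite.intros)
qed

lemma is_tri_finite: "is_tri V \<Longrightarrow> finite V"
  by (auto simp: is_tri_def intro: card_ge_0_finite)

lemma integral_tri:
  fixes f :: "pt \<Rightarrow> real"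
  assumes D: "det2 (b - a) (c - a) \<noteq> 0" and f: "continuous_on UNIV f"
  shows "integral (tri {a, b, c}) f = \<bar>det2 (b - a) (c - a)\<bar> * integral ref_tri (\<lambda>x. f (amap a b c x))"
proof -
  let ?T = "tri {a, b, c}" and ?A = "amap a b c" and ?D = "\<bar>det2 (b - a) (c - a)\<bar>"
  have T: "compact ?T" by (rule compact_tri) auto
  have [measurable]: "f \<in> borel_measurable borel" using f by (rule borel_measurable_continuous_onI)
  have [measurable]: "?T \<in> sets borel" using T by (rule borel_compact)
  have "integral ?T f = (\<integral>x. indicator ?T x *\<^sub>R f x \<partial>lborel)"
    using integral_eq_lborel[OF T continuous_on_subset[OF f]] by simp
  also have "\<dots> = (\<integral>x. indicator ?T x *\<^sub>R f x \<partial>(density (distr lborel borel ?A) (\<lambda>_. ennreal ?D)))"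
    using lborel_amap[OF D] by simp
  also have "\<dots> = ?D * (\<integral>x. indicator ?T (?A x) *\<^sub>R f (?A x) \<partial>lborel)"
    by (simp add: integral_density integral_distr)
  also have "(\<lambda>x. indicator ?T (?A x) *\<^sub>R f (?A x)) = (\<lambda>x. indicator ref_tri x *\<^sub>R f (?A x))"
    by (rule ext) (simp add: indicator_def tri_acoord[OF D] acoord_amap[OF D])
  also have "(\<integral>x. indicator ref_tri x *\<^sub>R f (?A x) \<partial>lborel) = integral ref_tri (\<lambda>x. f (?A x))"
    by (rule integral_eq_lborel(1)[OF compact_ref_tri, symmetric])
      (intro continuous_on_compose2[OF f] continuous_on_amap, auto)
  finally show ?thesis .
qed

lemma integral_ref_tri_swap:
  fixes f :: "pt \<Rightarrow> real"
  assumes f: "continuous_on UNIV f"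
  shows "integral ref_tri f = integral ref_tri (\<lambda>x. f (snd x, fst x))"
proof -
  have "ref_tri = tri {0, (0, 1), (1, 0)}"
    unfolding tri_amap by (auto simp: amap_def image_iff prod_eq_iff ref_tri_def add.commute)
  moreover have "amap 0 (0, 1) (1, 0) x = (snd x, fst x)" for x by (simp add: amap_def)
  ultimately show ?thesis using integral_tri[of "(0,1)" 0 "(1,0)" f] f by (simp add: det2_def)
qed

section \<open>Iterated integrals and the fundamental theorem of calculus on the reference
  triangle\<close>

lemma integral_ref_tri_iterated:
  fixes f :: "pt \<Rightarrow> real"
  assumes f: "continuous_on UNIV f"
  shows "integral ref_tri f = integral {0..1} (\<lambda>y. integral {0..1-y} (\<lambda>x. f (x, y)))"
proof -
  let ?g = "\<lambda>x. indicator ref_tri x *\<^sub>R f x"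
  let ?h = "\<lambda>y. integral {0..1-y} (\<lambda>x. f (x, y))"
  have "integrable lborel ?g"
    by (rule borel_integrable_compact[OF compact_ref_tri continuous_on_subset[OF f]]) simp
  then have int: "integrable (lborel \<Otimes>\<^sub>M lborel) (\<lambda>(x, y). ?g (x, y))"
    unfolding lborel_prod case_prod_beta' by simp
  have inner: "(\<integral>x. ?g (x, y) \<partial>lborel) = indicator {0..1} y *\<^sub>R ?h y" for y
  proof (cases "y \<in> {0..1}")
    case True
    then have "(\<lambda>x. ?g (x, y)) = (\<lambda>x. indicator {0..1-y} x *\<^sub>R f (x, y))"
      by (auto simp: indicator_def ref_tri_def fun_eq_iff le_diff_eq)
    moreover have "set_integrable lborel {0..1-y} (\<lambda>x. f (x, y))"
      unfolding set_integrable_def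
      by (intro borel_integrable_compact continuous_on_compose2[OF f] continuous_intros) auto
    from set_borel_integral_eq_integral(2)[OF this]
    have "(\<integral>x. indicator {0..1-y} x *\<^sub>R f (x, y) \<partial>lborel) = ?h y"
      by (simp add: set_lebesgue_integral_def)
    ultimately show ?thesis using True by simp
  next
    case False
    then have "(\<lambda>x. ?g (x, y)) = (\<lambda>x. 0)" by (auto simp: indicator_def ref_tri_def)
    then show ?thesis using False by simp
  qed
  have "integral ref_tri f = (\<integral>x. ?g x \<partial>(lborel \<Otimes>\<^sub>M lborel))"
    using integral_eq_lborel(1)[OF compact_ref_tri continuous_on_subset[OF f]] by (simp add: lborel_prod)
  also have "\<dots> = (\<integral>y. \<integral>x. ?g (x, y) \<partial>lborel \<partial>lborel)"
    using lborel_pair.integral_snd[OF int] unfolding case_prod_beta' by simp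
  also have "\<dots> = (\<integral>y. indicator {0..1} y *\<^sub>R ?h y \<partial>lborel)" unfolding inner ..
  also have "\<dots> = integral {0..1} ?h"
  proof -
    have "integrable lborel (\<lambda>y. \<integral>x. ?g (x, y) \<partial>lborel)"
      using lborel_pair.integrable_snd[OF int] by simp
    then have "set_integrable lborel {0..1} ?h" unfolding inner set_integrable_def .
    from set_borel_integral_eq_integral(2)[OF this] show ?thesis by (simp add: set_lebesgue_integral_def)
  qed
  finally show ?thesis .
qed

text \<open>Free of any integrability assumption: the orientation of an edge has to be irrelevant
  for every integrand of \<open>edge_int\<close>, also where both integrals take the default
  value.\<close>

lemma integral_flip_unit:
  fixes f :: "real \<Rightarrow> real"
  shows "integral {0..1} (\<lambda>t. f (1 - t)) = integral {0..1} f"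
proof -
  have *: "((\<lambda>t. f (1 - t)) has_integral i) {0..1}" if "(f has_integral i) {0..1}" for f :: "real \<Rightarrow> real" and i
  proof -
    have img: "(\<lambda>x. 1 - x) ` {0..1::real} = {0..1}" by (auto simp: image_iff intro: bexI[of _ "1 - _"])
    show ?thesis
      using has_integral_affinity[of f i 0 1 "-1" 1] that by (simp add: img cbox_interval)
  qed
  have "((\<lambda>t. f (1 - t)) has_integral i) {0..1} \<longleftrightarrow> (f has_integral i) {0..1}" for i
    using *[of f i] *[of "\<lambda>t. f (1 - t)" i] by auto
  then show ?thesis unfolding integral_def integrable_on_def by auto
qed

lemma integral_ref_tri_dx:
  assumes "\<And>x. (g has_derivative (\<lambda>h. inner (G x) h)) (at x)" "continuous_on UNIV G"
  shows "integral ref_tri (\<lambda>x. fst (G x)) = integral {0..1} (\<lambda>t. g (1 - t, t) - g (0, t))"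
proof -
  have "integral ref_tri (\<lambda>x. fst (G x)) = integral {0..1} (\<lambda>y. integral {0..1-y} (\<lambda>x. fst (G (x, y))))"
    by (rule integral_ref_tri_iterated) (intro continuous_intros assms)
  also have "\<dots> = integral {0..1} (\<lambda>t. g (1 - t, t) - g (0, t))"
  proof (rule integral_cong)
    fix y :: real assume y: "y \<in> {0..1}"
    have "((\<lambda>x. fst (G (x, y))) has_integral (g (1 - y, y) - g (0, y))) {0..1-y}"
    proof (rule fundamental_theorem_of_calculus)
      show "0 \<le> 1 - y" using y by simp
      fix x
      have "((\<lambda>s. g (s, y)) has_derivative (\<lambda>h. inner (G (x, y)) (h, 0))) (at x)"
        by (rule has_derivative_compose[where g = g and f = "\<lambda>s. (s, y)" and f' = "\<lambda>h. (h, 0)"])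
          (auto intro!: derivative_eq_intros assms)
      then show "((\<lambda>s. g (s, y)) has_vector_derivative fst (G (x, y))) (at x within {0..1-y})"
        by (auto simp: has_vector_derivative_def inner_prod_def mult.commute intro: has_derivative_at_withinI)
    qed
    then show "integral {0..1-y} (\<lambda>x. fst (G (x, y))) = g (1 - y, y) - g (0, y)" by (rule integral_unique)
  qed
  finally show ?thesis .
qed

lemma integral_ref_tri_dy:
  assumes g: "\<And>x. (g has_derivative (\<lambda>h. inner (G x) h)) (at x)" "continuous_on UNIV G"
  shows "integral ref_tri (\<lambda>x. snd (G x)) = integral {0..1} (\<lambda>t. g (1 - t, t) - g (t, 0))"
proof -
  have swap: "continuous_on UNIV (\<lambda>x::pt. (snd x, fst x))" by (intro continuous_intros)
  have "integral ref_tri (\<lambda>x. snd (G x)) = integral ref_tri (\<lambda>x. snd (G (snd x, fst x)))"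
    by (rule integral_ref_tri_swap) (intro continuous_intros g)
  also have "\<dots> = integral ref_tri (\<lambda>x. fst ((\<lambda>x. (snd (G (snd x, fst x)), fst (G (snd x, fst x)))) x))" by simp
  also have "\<dots> = integral {0..1} (\<lambda>t. (\<lambda>x. g (snd x, fst x)) (1 - t, t) - (\<lambda>x. g (snd x, fst x)) (0, t))"
  proof (rule integral_ref_tri_dx)
    fix x :: pt
    have "((\<lambda>x. g (snd x, fst x)) has_derivative (\<lambda>h. inner (G (snd x, fst x)) (snd h, fst h))) (at x)"
      by (rule has_derivative_compose[where g = g and f = "\<lambda>x. (snd x, fst x)" and f' = "\<lambda>h. (snd h, fst h)"])
        (auto intro!: derivative_eq_intros g)
    moreover have "(\<lambda>h. inner (G (snd x, fst x)) (snd h, fst h))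
        = inner (snd (G (snd x, fst x)), fst (G (snd x, fst x)))"
      by (rule ext) (simp add: inner_prod_def add.commute)
    ultimately show "((\<lambda>x. g (snd x, fst x)) has_derivative
      inner (snd (G (snd x, fst x)), fst (G (snd x, fst x)))) (at x)" by simp
  qed (intro continuous_intros continuous_on_compose2[OF g(2) swap] | simp)+
  also have "\<dots> = integral {0..1} (\<lambda>t. (\<lambda>t. g (1 - t, t) - g (t, 0)) (1 - (1 - t)) + (\<lambda>t. g (t, 1 - t) - g (1 - t, t)) t)"
    by simp
  also have "\<dots> = integral {0..1} (\<lambda>t. g (t, 1 - t)) - integral {0..1} (\<lambda>t. g (t, 0))"
  proof -
    have "continuous_on UNIV g" by (intro continuous_at_imp_continuous_on ballI has_derivative_continuous[OF g(1)])
    then have "continuous_on {0..1} (\<lambda>t. g (t, 1 - t))" "continuous_on {0..1} (\<lambda>t. g (t, 0))"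
      by (auto intro!: continuous_on_compose2[of UNIV g] continuous_intros)
    then show ?thesis by (simp add: integral_diff integrable_continuous_interval)
  qed
  \<comment> \<open>The reflection has traversed the hypotenuse backwards; this restores the
    direction of \<open>integral_ref_tri_dx\<close>.\<close>
  also have "integral {0..1} (\<lambda>t. g (t, 1 - t)) = integral {0..1} (\<lambda>t. g (1 - t, t))"
    using integral_flip_unit[of "\<lambda>t. g (t, 1 - t)"] by simp
  also have "\<dots> - integral {0..1} (\<lambda>t. g (t, 0)) = integral {0..1} (\<lambda>t. g (1 - t, t) - g (t, 0))"
  proof -
    have "continuous_on UNIV g" by (intro continuous_at_imp_continuous_on ballI has_derivative_continuous[OF g(1)])
    then have "continuous_on {0..1} (\<lambda>t. g (1 - t, t))" "continuous_on {0..1} (\<lambda>t. g (t, 0))"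
      by (auto intro!: continuous_on_compose2[of UNIV g] continuous_intros)
    then show ?thesis by (simp add: integral_diff integrable_continuous_interval)
  qed
  finally show ?thesis .
qed

section \<open>The divergence theorem on a triangle\<close>

lemma edges_of_tri:
  assumes "a \<noteq> b" "b \<noteq> c" "a \<noteq> c"
  shows "edges_of {a, b, c} = {{a, b}, {b, c}, {a, c}}"
proof (intro set_eqI iffI)
  fix e assume "e \<in> edges_of {a, b, c}"
  then obtain x y where "e = {x, y}" "x \<noteq> y" "x \<in> {a,b,c}" "y \<in> {a,b,c}"
    by (auto simp: edges_of_def card_2_iff)
  then show "e \<in> {{a, b}, {b, c}, {a, c}}" by auto
qed (use assms in \<open>auto simp: edges_of_def\<close>)

lemma sum_edges_of_tri:
  assumes "a \<noteq> b" "b \<noteq> c" "a \<noteq> c"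
  shows "(\<Sum>e\<in>edges_of {a, b, c}. F e) = F {a, b} + F {b, c} + (F {a, c} :: real)"
proof -
  have "{a, b} \<noteq> {b, c}" "{a, b} \<noteq> {a, c}" "{b, c} \<noteq> {a, c}"
    using assms by (auto simp: doubleton_eq_iff)
  then show ?thesis by (simp add: edges_of_tri[OF assms])
qed

lemma finite_edges_of: "finite V \<Longrightarrow> finite (edges_of V)"
  unfolding edges_of_def by (rule finite_subset[of _ "Pow V"]) auto

lemma edges_of_third_vertex:
  assumes "is_tri V" "e \<in> edges_of V"
  obtains a b c where "V = {a, b, c}" "e = {a, b}" "a \<noteq> b" "b \<noteq> c" "a \<noteq> c" "det2 (b - a) (c - a) \<noteq> 0"
proof -
  from assms(2) obtain a b where ab: "e = {a, b}" "a \<noteq> b" "a \<in> V" "b \<in> V"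
    by (auto simp: edges_of_def card_2_iff)
  have "card (V - {a, b}) = 1" using ab assms(1) by (simp add: is_tri_def card_Diff_subset)
  then obtain c where c: "V - {a, b} = {c}" by (auto simp: card_1_singleton_iff)
  have V: "V = {a, b, c}" using c ab by blast
  with ab c have "a \<noteq> b" "b \<noteq> c" "a \<noteq> c" by auto
  with V ab that is_tri_det2 assms(1) show ?thesis by metis
qed

text \<open>The choice in \<open>edge_int\<close> ranges over the two orderings of the endpoints,
  and both give the same value.\<close>

lemma edge_int_eq:
  assumes "a \<noteq> b"
  shows "edge_int {a, b} g = dist a b * integral {0..1} (\<lambda>t. g ((1 - t) *\<^sub>R a + t *\<^sub>R b))"
proof -
  let ?I = "\<lambda>a b. dist a b * integral {0..1} (\<lambda>t::real. g ((1 - t) *\<^sub>R a + t *\<^sub>R b))"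
  have sym: "?I b a = ?I a b"
    using integral_flip_unit[of "\<lambda>t. g ((1 - t) *\<^sub>R a + t *\<^sub>R b)"] by (simp add: dist_commute add.commute)
  show ?thesis unfolding edge_int_def
  proof (rule some_equality)
    show "\<exists>a' b'. {a, b} = {a', b'} \<and> a' \<noteq> b' \<and> ?I a b = ?I a' b'" using assms by blast
    fix I assume "\<exists>a' b'. {a, b} = {a', b'} \<and> a' \<noteq> b' \<and> I = ?I a' b'"
    then show "I = ?I a b" using sym by (auto simp: doubleton_eq_iff)
  qed
qed

lemma seg_doubleton: "seg {a, b} = closed_segment a b"
  by (simp add: seg_def segment_convex_hull)

lemma edge_int_cong:
  assumes "card e = 2" "\<And>x. x \<in> seg e \<Longrightarrow> f x = g x"
  shows "edge_int e f = edge_int e g"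
proof -
  obtain a b where ab: "e = {a, b}" "a \<noteq> b" using assms(1) by (auto simp: card_2_iff)
  have "integral {0..1} (\<lambda>t. f ((1 - t) *\<^sub>R a + t *\<^sub>R b)) = integral {0..1} (\<lambda>t. g ((1 - t) *\<^sub>R a + t *\<^sub>R b))"
    by (rule integral_cong, rule assms(2)) (auto simp: ab seg_doubleton in_segment)
  then show ?thesis by (simp add: ab edge_int_eq)
qed

text \<open>Whichever endpoint the choice operator returns, the sign test against the third vertex
  fixes the outward direction, which the sign of the determinant describes in both cases.\<close>

lemma normal_eq:
  assumes "a \<noteq> b" "b \<noteq> c" "a \<noteq> c" "det2 (b - a) (c - a) \<noteq> 0"
  shows "normal {a, b, c} {a, b} = - (sgn (det2 (b - a) (c - a)) / dist a b) *\<^sub>R perp (b - a)"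
proof -
  have c: "the_elem ({a, b, c} - {a, b}) = c"
    using assms by (simp add: insert_Diff_if)
  have "(SOME x. x \<in> {a, b}) \<in> {a, b}" by (rule someI[of _ a]) simp
  then consider "(SOME x. x \<in> {a, b}) = a" | "(SOME x. x \<in> {a, b}) = b" by auto
  then show ?thesis
  proof cases
    case 1
    have "the_elem ({a, b} - {a}) = b" using assms by (simp add: insert_Diff_if)
    moreover have "inner (perp (b - a) /\<^sub>R norm (b - a)) (c - a) = det2 (b - a) (c - a) / norm (b - a)"
      by (simp add: perp_def det2_def inner_prod_def divide_inverse algebra_simps)
    ultimately show ?thesis using assms unfolding normal_def Let_def c 1
      by (auto simp: sgn_if dist_norm norm_minus_commute mult_less_0_iff divide_inverse)
  next
    case 2
    have "the_elem ({a, b} - {b}) = a" using assms by (simp add: insert_Diff_if)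
    moreover have "inner (perp (a - b) /\<^sub>R norm (a - b)) (c - b) = - det2 (b - a) (c - a) / norm (a - b)"
      by (simp add: perp_def det2_def inner_prod_def divide_inverse algebra_simps)
    moreover have "perp (a - b) = - perp (b - a)" by (simp add: perp_def)
    ultimately show ?thesis using assms unfolding normal_def Let_def c 2
      by (auto simp: sgn_if dist_norm mult_less_0_iff zero_less_mult_iff divide_inverse)
  qed
qed

text \<open>The edge length cancels against the normalisation of the normal, so the flux becomes an
  integral of determinants.\<close>

lemma edge_int_normal:
  assumes "a \<noteq> b" "b \<noteq> c" "a \<noteq> c" "det2 (b - a) (c - a) \<noteq> 0"
  shows "edge_int {a, b} (\<lambda>x. inner (v x) (normal {a, b, c} {a, b}))
    = - sgn (det2 (b - a) (c - a)) * integral {0..1} (\<lambda>t. det2 (b - a) (v ((1 - t) *\<^sub>R a + t *\<^sub>R b)))"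
proof -
  have "inner u (perp (b - a)) = det2 (b - a) u" for u
    by (simp add: perp_def det2_def inner_prod_def algebra_simps)
  then show ?thesis using assms by (simp add: edge_int_eq normal_eq)
qed

lemma norm_normal:
  assumes "is_tri V" "e \<in> edges_of V"
  shows "norm (normal V e) = 1"
proof -
  from assms obtain a b c where abc: "V = {a, b, c}" "e = {a, b}" "a \<noteq> b" "b \<noteq> c" "a \<noteq> c" "det2 (b - a) (c - a) \<noteq> 0"
    by (rule edges_of_third_vertex)
  have "norm (perp u) = norm u" for u
    by (simp add: perp_def norm_prod_def add.commute)
  then show ?thesis using abc
    by (simp add: normal_eq dist_norm norm_minus_commute abs_sgn_eq)
qed

text \<open>In the basis \<open>b - a\<close>, \<open>c - a\<close> the field has components
  \<open>\<alpha>\<close> and \<open>\<beta>\<close>. The divergence is the trace of the derivative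
  and does not depend on the basis, so on the reference triangle each component can be integrated
  along its own axis.\<close>

lemma tri_divergence_theorem:
  assumes V: "is_tri V"
    and v1: "\<And>x. (v1 has_derivative (\<lambda>h. inner (G1 x) h)) (at x)" "continuous_on UNIV G1"
    and v2: "\<And>x. (v2 has_derivative (\<lambda>h. inner (G2 x) h)) (at x)" "continuous_on UNIV G2"
  shows "integral (tri V) (\<lambda>x. fst (G1 x) + snd (G2 x))
    = (\<Sum>e\<in>edges_of V. edge_int e (\<lambda>x. inner (v1 x, v2 x) (normal V e)))"
proof -
  obtain a b c where abc: "V = {a, b, c}" "a \<noteq> b" "b \<noteq> c" "a \<noteq> c" and D0: "det2 (b - a) (c - a) \<noteq> 0"
    using V by (rule is_tri_cases)
  define D where "D = det2 (b - a) (c - a)"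
  define v where "v x = (v1 x, v2 x)" for x
  define A where "A = amap a b c"
  define \<alpha> where "\<alpha> x = det2 (v (A x)) (c - a) / D" for x
  define \<beta> where "\<beta> x = det2 (b - a) (v (A x)) / D" for x
  define \<alpha>' where "\<alpha>' x = (1 / D) *\<^sub>R (snd (c - a) *\<^sub>R (inner (G1 (A x)) (b - a), inner (G1 (A x)) (c - a))
      - fst (c - a) *\<^sub>R (inner (G2 (A x)) (b - a), inner (G2 (A x)) (c - a)))" for x
  define \<beta>' where "\<beta>' x = (1 / D) *\<^sub>R (fst (b - a) *\<^sub>R (inner (G2 (A x)) (b - a), inner (G2 (A x)) (c - a))
      - snd (b - a) *\<^sub>R (inner (G1 (A x)) (b - a), inner (G1 (A x)) (c - a)))" for x
  have D: "D \<noteq> 0" using D0 by (simp add: D_def)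
  have contA: "continuous_on S A" for S unfolding A_def by (rule continuous_on_amap)
  have G1A: "continuous_on S (\<lambda>x. G1 (A x))" for S
    by (rule continuous_on_compose2[OF v1(2) contA]) simp
  have G2A: "continuous_on S (\<lambda>x. G2 (A x))" for S
    by (rule continuous_on_compose2[OF v2(2) contA]) simp
  have dA: "(A has_derivative (\<lambda>h. fst h *\<^sub>R (b - a) + snd h *\<^sub>R (c - a))) (at x)" for x
    unfolding A_def amap_def[abs_def]
    by (rule has_derivative_eq_rhs, (rule derivative_intros)+, simp)
  have d1: "((\<lambda>x. v1 (A x)) has_derivative (\<lambda>h. inner (G1 (A x)) (fst h *\<^sub>R (b - a) + snd h *\<^sub>R (c - a)))) (at x)" for x
    by (rule has_derivative_compose[OF dA v1(1)])
  have d2: "((\<lambda>x. v2 (A x)) has_derivative (\<lambda>h. inner (G2 (A x)) (fst h *\<^sub>R (b - a) + snd h *\<^sub>R (c - a)))) (at x)" for x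
    by (rule has_derivative_compose[OF dA v2(1)])
  have \<alpha>: "(\<alpha> has_derivative (\<lambda>h. inner (\<alpha>' x) h)) (at x)" for x
  proof -
    have "((\<lambda>x. (1 / D) * (snd (c - a) * v1 (A x) - fst (c - a) * v2 (A x))) has_derivative
       (\<lambda>h. (1 / D) * (snd (c - a) * inner (G1 (A x)) (fst h *\<^sub>R (b - a) + snd h *\<^sub>R (c - a))
         - fst (c - a) * inner (G2 (A x)) (fst h *\<^sub>R (b - a) + snd h *\<^sub>R (c - a))))) (at x)"
      by (intro has_derivative_mult_right has_derivative_diff d1 d2)
    moreover have "(\<lambda>x. (1 / D) * (snd (c - a) * v1 (A x) - fst (c - a) * v2 (A x))) = \<alpha>"
      by (rule ext) (simp add: \<alpha>_def det2_def v_def mult.commute)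
    moreover have "(\<lambda>h. (1 / D) * (snd (c - a) * inner (G1 (A x)) (fst h *\<^sub>R (b - a) + snd h *\<^sub>R (c - a))
         - fst (c - a) * inner (G2 (A x)) (fst h *\<^sub>R (b - a) + snd h *\<^sub>R (c - a)))) = (\<lambda>h. inner (\<alpha>' x) h)"
      unfolding \<alpha>'_def
      by (rule ext) (simp add: inner_prod_def inner_add_right inner_diff_right inner_diff_left algebra_simps)
    ultimately show ?thesis by simp
  qed
  have \<beta>: "(\<beta> has_derivative (\<lambda>h. inner (\<beta>' x) h)) (at x)" for x
  proof -
    have "((\<lambda>x. (1 / D) * (fst (b - a) * v2 (A x) - snd (b - a) * v1 (A x))) has_derivative
       (\<lambda>h. (1 / D) * (fst (b - a) * inner (G2 (A x)) (fst h *\<^sub>R (b - a) + snd h *\<^sub>R (c - a))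
         - snd (b - a) * inner (G1 (A x)) (fst h *\<^sub>R (b - a) + snd h *\<^sub>R (c - a))))) (at x)"
      by (intro has_derivative_mult_right has_derivative_diff d1 d2)
    moreover have "(\<lambda>x. (1 / D) * (fst (b - a) * v2 (A x) - snd (b - a) * v1 (A x))) = \<beta>"
      by (rule ext) (simp add: \<beta>_def det2_def v_def mult.commute)
    moreover have "(\<lambda>h. (1 / D) * (fst (b - a) * inner (G2 (A x)) (fst h *\<^sub>R (b - a) + snd h *\<^sub>R (c - a))
         - snd (b - a) * inner (G1 (A x)) (fst h *\<^sub>R (b - a) + snd h *\<^sub>R (c - a)))) = (\<lambda>h. inner (\<beta>' x) h)"
      unfolding \<beta>'_def
      by (rule ext) (simp add: inner_prod_def inner_add_right inner_diff_right inner_diff_left algebra_simps)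
    ultimately show ?thesis by simp
  qed
  have c\<alpha>': "continuous_on S \<alpha>'" and c\<beta>': "continuous_on S \<beta>'" for S
    unfolding \<alpha>'_def \<beta>'_def by (intro continuous_intros G1A G2A)+
  have c\<alpha>: "continuous_on S \<alpha>" and c\<beta>: "continuous_on S \<beta>" for S
    by (intro continuous_at_imp_continuous_on ballI has_derivative_continuous[OF \<alpha>]
        has_derivative_continuous[OF \<beta>])+
  have div: "fst (G1 (A x)) + snd (G2 (A x)) = fst (\<alpha>' x) + snd (\<beta>' x)" for x
  proof -
    have "D * (fst (\<alpha>' x) + snd (\<beta>' x)) = D * (fst (G1 (A x)) + snd (G2 (A x)))"
      using D unfolding \<alpha>'_def \<beta>'_def by (simp add: distrib_left) (simp add: D_def det2_def inner_prod_def algebra_simps)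
    then show ?thesis using D by simp
  qed
  have line: "(1 - t) *\<^sub>R a + t *\<^sub>R b = A (t, 0)" "(1 - t) *\<^sub>R b + t *\<^sub>R c = A (1 - t, t)"
    "(1 - t) *\<^sub>R a + t *\<^sub>R c = A (0, t)" for t
    unfolding A_def amap_def by (simp_all add: algebra_simps)
  have int: "(\<lambda>t. \<alpha> (1 - t, t)) integrable_on {0..1}" "(\<lambda>t. \<beta> (1 - t, t)) integrable_on {0..1}"
     "(\<lambda>t. \<alpha> (0, t)) integrable_on {0..1}" "(\<lambda>t. \<beta> (t, 0)) integrable_on {0..1}"
    by (intro integrable_continuous_interval continuous_on_compose2[OF c\<alpha>[of UNIV]]
      continuous_on_compose2[OF c\<beta>[of UNIV]] continuous_intros; simp)+
  have e1: "edge_int {a, b} (\<lambda>x. inner (v x) (normal V {a, b})) = - \<bar>D\<bar> * integral {0..1} (\<lambda>t. \<beta> (t, 0))"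
  proof -
    have "det2 (b - a) (v (A (t, 0))) = D * \<beta> (t, 0)" for t using D by (simp add: \<beta>_def)
    then show ?thesis unfolding abc(1)
      by (subst edge_int_normal) (use abc D0 in \<open>simp_all add: line D_def[symmetric] sgn_if\<close>)
  qed
  have e2: "edge_int {b, c} (\<lambda>x. inner (v x) (normal V {b, c}))
      = \<bar>D\<bar> * (integral {0..1} (\<lambda>t. \<alpha> (1 - t, t)) + integral {0..1} (\<lambda>t. \<beta> (1 - t, t)))"
  proof -
    \<comment> \<open>Rotating the vertices keeps the orientation. Both components contribute here,
      since \<open>c - b\<close> is the difference of the two basis vectors.\<close>
    have DD: "det2 (c - b) (a - b) = D" by (simp add: D_def det2_def algebra_simps)
    have "det2 (c - b) u = - (det2 u (c - a) + det2 (b - a) u)" for u by (simp add: det2_def algebra_simps)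
    then have *: "det2 (c - b) (v (A (1 - t, t))) = - D * (\<alpha> (1 - t, t) + \<beta> (1 - t, t))" for t
      using D by (simp add: \<alpha>_def \<beta>_def distrib_left)
    have "V = {b, c, a}" using abc by auto
    then show ?thesis using integral_add[OF int(1,2)]
      by (simp only:, subst edge_int_normal) (use abc D in \<open>simp_all add: line * DD sgn_if\<close>)
  qed
  have e3: "edge_int {a, c} (\<lambda>x. inner (v x) (normal V {a, c})) = - \<bar>D\<bar> * integral {0..1} (\<lambda>t. \<alpha> (0, t))"
  proof -
    \<comment> \<open>The third vertex is now listed in reversed order, which flips the sign of the
      determinant.\<close>
    have DD: "det2 (c - a) (b - a) = - D" by (simp add: D_def det2_def algebra_simps)
    have "det2 (c - a) u = - det2 u (c - a)" for u by (simp add: det2_def algebra_simps)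
    then have *: "det2 (c - a) (v (A (0, t))) = - D * \<alpha> (0, t)" for t using D by (simp add: \<alpha>_def)
    have "V = {a, c, b}" using abc by auto
    then show ?thesis
      by (simp only:, subst edge_int_normal) (use abc D in \<open>simp_all add: line * DD sgn_if\<close>)
  qed
  have "integral (tri V) (\<lambda>x. fst (G1 x) + snd (G2 x)) = \<bar>D\<bar> * integral ref_tri (\<lambda>x. fst (G1 (A x)) + snd (G2 (A x)))"
    unfolding abc(1) A_def D_def by (intro integral_tri D0 continuous_intros v1 v2)
  also have "integral ref_tri (\<lambda>x. fst (G1 (A x)) + snd (G2 (A x))) = integral ref_tri (\<lambda>x. fst (\<alpha>' x)) + integral ref_tri (\<lambda>x. snd (\<beta>' x))"
    unfolding div by (intro integral_add integral_eq_lborel(2) compact_ref_tri continuous_intros c\<alpha>' c\<beta>')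
  also have "\<dots> = integral {0..1} (\<lambda>t. \<alpha> (1 - t, t)) - integral {0..1} (\<lambda>t. \<alpha> (0, t))
     + (integral {0..1} (\<lambda>t. \<beta> (1 - t, t)) - integral {0..1} (\<lambda>t. \<beta> (t, 0)))"
    by (simp add: integral_ref_tri_dx[OF \<alpha> c\<alpha>'] integral_ref_tri_dy[OF \<beta> c\<beta>'] integral_diff int)
  also have "\<bar>D\<bar> * \<dots> = (\<Sum>e\<in>edges_of V. edge_int e (\<lambda>x. inner (v x) (normal V e)))"
    unfolding abc(1) by (subst sum_edges_of_tri)
      (use abc in \<open>simp_all add: e1[unfolded abc(1)] e2[unfolded abc(1)] e3[unfolded abc(1)] algebra_simps\<close>)
  finally show ?thesis by (simp add: v_def)
qed

lemma tri_integration_by_parts: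
  assumes V: "is_tri V" and w: "w \<in> poly2 p" and v: "v \<in> vpoly2 q"
  shows "integral (tri V) (\<lambda>x. w x * divg v x) =
    (\<Sum>e\<in>edges_of V. edge_int e (\<lambda>x. w x * inner (v x) (normal V e))) - integral (tri V) (\<lambda>x. inner (v x) (grad w x))"
proof -
  define f where "f x = fst (v x)" for x
  define g where "g x = snd (v x)" for x
  have fg: "f \<in> poly2 q" "g \<in> poly2 q" using v by (auto simp: vpoly2_iff f_def[abs_def] g_def[abs_def])
  have div: "divg v x = fst (grad f x) + snd (grad g x)" for x
    by (simp add: divg_eq f_def[abs_def] g_def[abs_def])
  have cont: "continuous_on S f" "continuous_on S g" "continuous_on S w" 
     "continuous_on S (grad f)" "continuous_on S (grad g)" "continuous_on S (grad w)" "continuous_on S v" for S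
    using fg w v vpoly2_grad vpoly2_continuous poly2_continuous by blast+
  have wf: "((\<lambda>x. w x * u x) has_derivative (\<lambda>h. inner (w x *\<^sub>R grad u x + u x *\<^sub>R grad w x) h)) (at x)"
    if "u \<in> poly2 q" for u x
    using has_derivative_mult[OF poly2_has_derivative[OF w] poly2_has_derivative[OF that], of x]
    by (simp add: inner_add_left mult.commute)
  have T: "compact (tri V)" using V by (intro compact_tri is_tri_finite)
  have "integral (tri V) (\<lambda>x. fst (w x *\<^sub>R grad f x + f x *\<^sub>R grad w x) + snd (w x *\<^sub>R grad g x + g x *\<^sub>R grad w x))
    = (\<Sum>e\<in>edges_of V. edge_int e (\<lambda>x. inner (w x * f x, w x * g x) (normal V e)))"
    by (rule tri_divergence_theorem[OF V wf[OF fg(1)] _ wf[OF fg(2)]]) (intro continuous_intros cont)+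
  also have "\<dots> = (\<Sum>e\<in>edges_of V. edge_int e (\<lambda>x. w x * inner (v x) (normal V e)))"
    by (simp add: f_def g_def inner_prod_def algebra_simps)
  also have "(\<lambda>x. fst (w x *\<^sub>R grad f x + f x *\<^sub>R grad w x) + snd (w x *\<^sub>R grad g x + g x *\<^sub>R grad w x))
    = (\<lambda>x. w x * divg v x + inner (v x) (grad w x))"
    by (simp add: div f_def g_def inner_prod_def algebra_simps)
  also have "integral (tri V) \<dots> = integral (tri V) (\<lambda>x. w x * divg v x) + integral (tri V) (\<lambda>x. inner (v x) (grad w x))"
    unfolding div by (intro integral_add integral_eq_lborel(2) T continuous_intros cont)
  finally show ?thesis by simp
qed

section \<open>Edge integrals and coefficient spaces\<close>

text \<open>A trace is known only through the parametrisation of its edge, so continuity is required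
  along it, in both directions. The cardinality guarantees that \<open>edge_int\<close> is a genuine
  line integral.\<close>

definition econt :: "pt set \<Rightarrow> (pt \<Rightarrow> real) \<Rightarrow> bool" where
  "econt e g \<longleftrightarrow> card e = 2 \<and> (\<forall>a b. e = {a, b} \<longrightarrow> continuous_on {0..1} (\<lambda>t. g ((1 - t) *\<^sub>R a + t *\<^sub>R b)))"

lemma econt_add: "econt e f \<Longrightarrow> econt e g \<Longrightarrow> econt e (\<lambda>x. f x + g x)"
  by (auto simp: econt_def intro!: continuous_intros)

lemma econt_diff: "econt e f \<Longrightarrow> econt e g \<Longrightarrow> econt e (\<lambda>x. f x - g x)"
  by (auto simp: econt_def intro!: continuous_intros)

lemma econt_mult: "econt e f \<Longrightarrow> econt e g \<Longrightarrow> econt e (\<lambda>x. f x * g x)"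
  by (auto simp: econt_def intro!: continuous_intros)

lemma econt_power: "econt e f \<Longrightarrow> econt e (\<lambda>x. f x ^ n)"
  by (auto simp: econt_def intro!: continuous_intros)

lemma econt_const: "card e = 2 \<Longrightarrow> econt e (\<lambda>x. r)"
  by (auto simp: econt_def intro!: continuous_intros)

lemma econt_continuous: "card e = 2 \<Longrightarrow> continuous_on UNIV f \<Longrightarrow> econt e f"
  by (auto simp: econt_def intro!: continuous_on_compose2[of UNIV f] continuous_intros)

lemma econt_card: "econt e g \<Longrightarrow> card e = 2"
  unfolding econt_def by blast

lemma econtD: "econt {a, b} g \<Longrightarrow> continuous_on {0..1} (\<lambda>t. g ((1 - t) *\<^sub>R a + t *\<^sub>R b))"
  unfolding econt_def by blast

lemma edge_int_add: "econt e f \<Longrightarrow> econt e g \<Longrightarrow> edge_int e (\<lambda>x. f x + g x) = edge_int e f + edge_int e g"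
proof -
  assume fg: "econt e f" "econt e g"
  then obtain a b where ab: "e = {a, b}" "a \<noteq> b" by (metis econt_card card_2_iff)
  show ?thesis using fg ab(2) unfolding ab(1)
    by (simp add: edge_int_eq integral_add integrable_continuous_interval econtD distrib_left
        del: scaleR_Pair)
qed

lemma edge_int_cmult: "card e = 2 \<Longrightarrow> edge_int e (\<lambda>x. r * f x) = r * edge_int e f"
  unfolding card_2_iff by (auto simp: edge_int_eq)

lemma edge_int_mono:
  assumes "econt e f" "econt e g" "\<And>x. x \<in> seg e \<Longrightarrow> f x \<le> g x"
  shows "edge_int e f \<le> edge_int e g"
proof -
  obtain a b where ab: "e = {a, b}" "a \<noteq> b" using assms(1) by (auto simp: econt_def card_2_iff)
  have "integral {0..1} (\<lambda>t. f ((1 - t) *\<^sub>R a + t *\<^sub>R b)) \<le> integral {0..1} (\<lambda>t. g ((1 - t) *\<^sub>R a + t *\<^sub>R b))"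
    using assms(1,2) unfolding ab
    by (intro integral_le integrable_continuous_interval econtD assms(3)) (auto simp: ab seg_doubleton in_segment)
  then show ?thesis by (simp add: ab edge_int_eq mult_left_mono)
qed

lemma edge_int_zero: "card e = 2 \<Longrightarrow> edge_int e (\<lambda>x. 0) = 0"
  using edge_int_cmult[of e 0 "\<lambda>x. 0"] by simp

lemma edge_int_nonneg: "econt e f \<Longrightarrow> (\<And>x. x \<in> seg e \<Longrightarrow> 0 \<le> f x) \<Longrightarrow> 0 \<le> edge_int e f"
  using edge_int_mono[of e "\<lambda>x. 0" f] econt_const[of e 0] by (simp add: econt_def edge_int_zero)

lemma edge_int_square_zero:
  assumes "econt e f" "edge_int e (\<lambda>x. (f x)\<^sup>2) = 0" "x \<in> seg e"
  shows "f x = 0"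
proof -
  obtain a b where ab: "e = {a, b}" "a \<noteq> b" using assms(1) by (auto simp: econt_def card_2_iff)
  have "integral {0..1} (\<lambda>t. (f ((1 - t) *\<^sub>R a + t *\<^sub>R b))\<^sup>2) = 0"
    using assms(2) ab by (simp add: edge_int_eq)
  then have "\<forall>t\<in>{0..1}. (f ((1 - t) *\<^sub>R a + t *\<^sub>R b))\<^sup>2 = 0"
    using econtD[OF assms(1)[unfolded ab(1)]] by (subst (asm) integral_eq_0_iff) (simp_all add: continuous_on_power)
  with assms(3) show ?thesis by (auto simp: ab seg_doubleton in_segment)
qed

section \<open>Integrals over the boundary of a triangle\<close>

text \<open>The integrand takes the edge as an argument because traces on two edges may differ at
  their common vertex, and the normal jumps there.\<close>

definition bd_int :: "pt set \<Rightarrow> (pt set \<Rightarrow> pt \<Rightarrow> real) \<Rightarrow> real" where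
  "bd_int V F = (\<Sum>e\<in>edges_of V. edge_int e (F e))"

lemma edges_card: "e \<in> edges_of V \<Longrightarrow> card e = 2"
  by (simp add: edges_of_def)

lemma bd_int_add:
  "(\<And>e. e \<in> edges_of V \<Longrightarrow> econt e (F e)) \<Longrightarrow> (\<And>e. e \<in> edges_of V \<Longrightarrow> econt e (G e)) \<Longrightarrow>
    bd_int V (\<lambda>e x. F e x + G e x) = bd_int V F + bd_int V G"
  by (simp add: bd_int_def edge_int_add sum.distrib)

lemma bd_int_cmult: "bd_int V (\<lambda>e x. r * F e x) = r * bd_int V F"
  by (simp add: bd_int_def edge_int_cmult edges_card sum_distrib_left)

lemma bd_int_diff:
  "(\<And>e. e \<in> edges_of V \<Longrightarrow> econt e (F e)) \<Longrightarrow> (\<And>e. e \<in> edges_of V \<Longrightarrow> econt e (G e)) \<Longrightarrow>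
    bd_int V (\<lambda>e x. F e x - G e x) = bd_int V F - bd_int V G"
  using bd_int_add[of V F "\<lambda>e x. - 1 * G e x"] bd_int_cmult[of V "-1" G]
    econt_mult[OF econt_const[of _ "-1"]] by (simp add: edges_card)

lemma bd_int_cong:
  "(\<And>e x. e \<in> edges_of V \<Longrightarrow> x \<in> seg e \<Longrightarrow> F e x = G e x) \<Longrightarrow> bd_int V F = bd_int V G"
  unfolding bd_int_def by (intro sum.cong refl edge_int_cong) (auto simp: edges_card)

lemma bd_int_mono:
  "(\<And>e. e \<in> edges_of V \<Longrightarrow> econt e (F e)) \<Longrightarrow> (\<And>e. e \<in> edges_of V \<Longrightarrow> econt e (G e)) \<Longrightarrow>
   (\<And>e x. e \<in> edges_of V \<Longrightarrow> x \<in> seg e \<Longrightarrow> F e x \<le> G e x) \<Longrightarrow> bd_int V F \<le> bd_int V G"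
  unfolding bd_int_def by (intro sum_mono edge_int_mono) auto

lemma bd_int_nonneg:
  "(\<And>e. e \<in> edges_of V \<Longrightarrow> econt e (F e)) \<Longrightarrow>
   (\<And>e x. e \<in> edges_of V \<Longrightarrow> x \<in> seg e \<Longrightarrow> 0 \<le> F e x) \<Longrightarrow> 0 \<le> bd_int V F"
  unfolding bd_int_def by (intro sum_nonneg edge_int_nonneg) auto

lemma bd_int_zero: "bd_int V (\<lambda>e x. 0) = 0"
  by (simp add: bd_int_def edge_int_zero edges_card)

lemma tri_integrable:
  "is_tri V \<Longrightarrow> continuous_on UNIV f \<Longrightarrow> (f :: pt \<Rightarrow> real) integrable_on tri V"
  by (intro integral_eq_lborel(2) compact_tri is_tri_finite) (auto intro: continuous_on_subset)

lemma tri_int_add: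
  "is_tri V \<Longrightarrow> continuous_on UNIV f \<Longrightarrow> continuous_on UNIV g \<Longrightarrow>
    integral (tri V) (\<lambda>x. f x + g x :: real) = integral (tri V) f + integral (tri V) g"
  by (intro integral_add tri_integrable)

lemma tri_int_diff:
  "is_tri V \<Longrightarrow> continuous_on UNIV f \<Longrightarrow> continuous_on UNIV g \<Longrightarrow>
    integral (tri V) (\<lambda>x. f x - g x :: real) = integral (tri V) f - integral (tri V) g"
  by (intro integral_diff tri_integrable)

lemma tri_int_mono:
  "is_tri V \<Longrightarrow> continuous_on UNIV f \<Longrightarrow> continuous_on UNIV g \<Longrightarrow> (\<And>x. f x \<le> g x) \<Longrightarrow>
    integral (tri V) (f :: pt \<Rightarrow> real) \<le> integral (tri V) g"
  by (intro integral_le tri_integrable)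

lemma tri_int_nonneg:
  "is_tri V \<Longrightarrow> continuous_on UNIV f \<Longrightarrow> (\<And>x. 0 \<le> f x) \<Longrightarrow> 0 \<le> integral (tri V) (f :: pt \<Rightarrow> real)"
  by (intro integral_nonneg tri_integrable)

lemma poly2_amap:
  assumes "f \<in> poly2 p"
  shows "(\<lambda>x. f (amap a b c x)) \<in> poly2 p"
proof -
  have "(\<lambda>x. f (fst a + fst (b - a) * fst x + fst (c - a) * snd x, snd a + snd (b - a) * fst x + snd (c - a) * snd x)) \<in> poly2 p"
    by (rule poly2_compose_affine[OF assms]; intro poly2_add poly2_const poly2_cmult poly2_fst poly2_snd) simp_all
  moreover have "amap a b c x = (fst a + fst (b - a) * fst x + fst (c - a) * snd x, snd a + snd (b - a) * fst x + snd (c - a) * snd x)" for x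
    by (simp add: amap_def prod_eq_iff mult.commute)
  ultimately show ?thesis by simp
qed

text \<open>The integral also vanishes over a square inside the triangle. Continuity gives a zero
  polynomial on that square, which contains a scaled lattice.\<close>

lemma poly2_square_ref_integral_zero:
  assumes f: "f \<in> poly2 p" and "integral ref_tri (\<lambda>x. (f x)\<^sup>2) = 0"
  shows "f x = 0"
proof -
  let ?B = "cbox (0, 0) (1/2, 1/2 :: real) :: pt set"
  have cont: "continuous_on S (\<lambda>x. (f x)\<^sup>2)" for S by (intro continuous_intros poly2_continuous[OF f])
  have sub: "?B \<subseteq> ref_tri" by (auto simp: ref_tri_def cbox_Pair_eq)
  have "integral ?B (\<lambda>x. (f x)\<^sup>2) \<le> integral ref_tri (\<lambda>x. (f x)\<^sup>2)"
    using sub by (intro integral_subset_le integrable_continuous integral_eq_lborel(2)[OF compact_ref_tri] cont) auto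
  moreover have "0 \<le> integral ?B (\<lambda>x. (f x)\<^sup>2)" by (intro integral_nonneg integrable_continuous cont) auto
  ultimately have "integral ?B (\<lambda>x. (f x)\<^sup>2) = 0" using assms(2) by simp
  moreover have "box (0, 0) (1/2, 1/2 :: real) \<noteq> ({} :: pt set)"
    by (simp add: box_ne_empty Basis_prod_def ball_Un)
  ultimately have z: "\<forall>x\<in>?B. f x = 0"
    by (subst (asm) integral_cbox_eq_0_iff) (auto intro: cont)
  show ?thesis
  proof (rule poly2_zero_on_scaled_grid[OF f])
    \<comment> \<open>With this spacing all lattice coordinates are at most
      \<open>p / (2 * (p + 1))\<close>, hence inside the square of side \<open>1/2\<close>.\<close>
    show "1 / (2 * real (Suc p)) \<noteq> 0" by simp
    fix i j assume "i + j \<le> p"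
    then show "f (1 / (2 * real (Suc p)) * real i, 1 / (2 * real (Suc p)) * real j) = 0"
      by (intro z[rule_format]) (auto simp: cbox_Pair_eq field_simps)
  qed
qed

lemma poly2_square_integral_zero:
  assumes V: "is_tri V" and f: "f \<in> poly2 p" and "integral (tri V) (\<lambda>x. (f x)\<^sup>2) = 0"
  shows "f x = 0"
proof -
  obtain a b c where abc: "V = {a, b, c}" and D: "det2 (b - a) (c - a) \<noteq> 0"
    using V by (rule is_tri_cases)
  have "integral ref_tri (\<lambda>x. (f (amap a b c x))\<^sup>2) = 0"
    using assms(3) D unfolding abc by (subst (asm) integral_tri) (auto intro!: continuous_intros poly2_continuous[OF f])
  then have "f (amap a b c y) = 0" for y
    by (rule poly2_square_ref_integral_zero[OF poly2_amap[OF f]])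
  from this[of "acoord a b c x"] show ?thesis by (simp add: amap_acoord[OF D])
qed

lemma vpoly2_square_integral_zero:
  assumes V: "is_tri V" and v: "v \<in> vpoly2 p" and z: "integral (tri V) (\<lambda>x. inner (v x) (v x)) = 0"
  shows "v x = 0"
proof -
  let ?f = "\<lambda>x. fst (v x)" and ?g = "\<lambda>x. snd (v x)"
  have fg: "?f \<in> poly2 p" "?g \<in> poly2 p" using v by (auto simp: vpoly2_iff)
  have "integral (tri V) (\<lambda>x. inner (v x) (v x)) = integral (tri V) (\<lambda>x. (?f x)\<^sup>2 + (?g x)\<^sup>2)"
    by (simp add: inner_prod_def power2_eq_square)
  also have "\<dots> = integral (tri V) (\<lambda>x. (?f x)\<^sup>2) + integral (tri V) (\<lambda>x. (?g x)\<^sup>2)"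
    by (intro tri_int_add V continuous_on_power poly2_continuous[OF fg(1)] poly2_continuous[OF fg(2)])
  finally have "integral (tri V) (\<lambda>x. (?f x)\<^sup>2) + integral (tri V) (\<lambda>x. (?g x)\<^sup>2) = 0" using z by simp
  moreover have "0 \<le> integral (tri V) (\<lambda>x. (?f x)\<^sup>2)" "0 \<le> integral (tri V) (\<lambda>x. (?g x)\<^sup>2)"
    by (intro tri_int_nonneg V continuous_on_power poly2_continuous[OF fg(1)] poly2_continuous[OF fg(2)]; simp)+
  ultimately have "?f x = 0" "?g x = 0"
    using poly2_square_integral_zero[OF V fg(1)] poly2_square_integral_zero[OF V fg(2)] by auto
  then show ?thesis by (simp add: prod_eq_iff)
qed

section \<open>Linear and bilinear forms on coefficient vectors\<close>

text \<open>Coefficient vectors are total functions. The last clause makes the values outside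
  \<open>I\<close> irrelevant, so that finitely many unit vectors determine the functional.\<close>

definition lin_coeffs :: "'i set \<Rightarrow> (('i \<Rightarrow> real) \<Rightarrow> real) \<Rightarrow> bool" where
  "lin_coeffs I F \<longleftrightarrow> (\<forall>x y. F (\<lambda>i. x i + y i) = F x + F y) \<and> (\<forall>r x. F (\<lambda>i. r * x i) = r * F x)
     \<and> (\<forall>x y. (\<forall>i\<in>I. x i = y i) \<longrightarrow> F x = F y)"

definition unit_coeff :: "'i \<Rightarrow> 'i \<Rightarrow> real" where
  "unit_coeff i j = (if j = i then 1 else 0)"

lemma lin_coeffs_expand:
  assumes "finite I" "lin_coeffs I F"
  shows "F x = (\<Sum>i\<in>I. x i * F (unit_coeff i))"
proof -
  have add: "F (\<lambda>i. x i + y i) = F x + F y" and sc: "F (\<lambda>i. r * x i) = r * F x" for x y r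
    using assms(2) by (auto simp: lin_coeffs_def)
  have "F (\<lambda>j. \<Sum>i\<in>J. x i * unit_coeff i j) = (\<Sum>i\<in>J. x i * F (unit_coeff i))" if "finite J" for J
    using that
  proof (induction J rule: finite_induct)
    case empty
    show ?case using sc[of 0 x] by simp
  next
    case (insert i J)
    then show ?case by (simp add: add sc)
  qed
  from this[OF assms(1)] have "F (\<lambda>j. \<Sum>i\<in>I. x i * unit_coeff i j) = (\<Sum>i\<in>I. x i * F (unit_coeff i))" .
  moreover have "F x = F (\<lambda>j. \<Sum>i\<in>I. x i * unit_coeff i j)"
  proof -
    have "\<forall>j\<in>I. x j = (\<Sum>i\<in>I. x i * unit_coeff i j)"
      using assms(1) by (simp add: unit_coeff_def if_distrib[where f = "\<lambda>u. _ * u"] cong: if_cong)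
    then show ?thesis using assms(2)[unfolded lin_coeffs_def, THEN conjunct2, THEN conjunct2, rule_format,
        of x "\<lambda>j. \<Sum>i\<in>I. x i * unit_coeff i j"] by blast
  qed
  ultimately show ?thesis by simp
qed

text \<open>Serves the inverse estimates: applied to integral or nodal products of polynomials, it
  bounds the coefficients with a constant that knows nothing of the mesh.\<close>

lemma bilinear_coeffs_coercive:
  assumes I: "finite I" and l: "\<And>y. lin_coeffs I (\<lambda>x. B x y)" and r: "\<And>x. lin_coeffs I (B x)"
    and pos: "\<And>c. \<exists>i\<in>I. c i \<noteq> 0 \<Longrightarrow> B c c > 0"
  shows "\<exists>\<kappa>>0. \<forall>c. \<kappa> * (\<Sum>i\<in>I. (c i)\<^sup>2) \<le> B c c"
proof -
  have *: "B c c = (\<Sum>i\<in>I. \<Sum>j\<in>I. B (unit_coeff i) (unit_coeff j) * c i * c j)" for c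
  proof -
    have "B c c = (\<Sum>i\<in>I. c i * B (unit_coeff i) c)" by (rule lin_coeffs_expand[OF I l])
    also have "\<dots> = (\<Sum>i\<in>I. c i * (\<Sum>j\<in>I. c j * B (unit_coeff i) (unit_coeff j)))"
      by (subst lin_coeffs_expand[OF I r]) simp
    finally show ?thesis by (simp add: sum_distrib_left mult_ac)
  qed
  show ?thesis unfolding * by (rule quadratic_form_coercive[OF I]) (use pos in \<open>simp add: *\<close>)
qed

text \<open>Trial and test functions share one coefficient space, so the system is square and
  uniqueness implies existence.\<close>

lemma bilinear_coeffs_solvable:
  assumes I: "finite I" and l: "\<And>y. lin_coeffs I (\<lambda>x. B x y)" and r: "\<And>x. lin_coeffs I (B x)"
    and f: "lin_coeffs I f" and inj: "\<And>x. (\<And>y. B x y = 0) \<Longrightarrow> \<forall>i\<in>I. x i = 0"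
  shows "\<exists>x. \<forall>y. B x y = f y"
proof -
  have "\<exists>x. \<forall>i\<in>I. (\<Sum>j\<in>I. B (unit_coeff j) (unit_coeff i) * x j) = f (unit_coeff i)"
  proof (rule square_system_solvable[OF I])
    fix x assume x: "\<forall>i\<in>I. (\<Sum>j\<in>I. B (unit_coeff j) (unit_coeff i) * x j) = 0"
    have "B x (unit_coeff i) = 0" if "i \<in> I" for i
      using x that by (subst lin_coeffs_expand[OF I l]) (simp add: mult.commute)
    then have "B x y = 0" for y by (subst lin_coeffs_expand[OF I r]) simp
    then show "\<forall>j\<in>I. x j = 0" by (rule inj)
  qed
  then obtain x where x: "\<forall>i\<in>I. (\<Sum>j\<in>I. B (unit_coeff j) (unit_coeff i) * x j) = f (unit_coeff i)" by auto
  have "B x (unit_coeff i) = f (unit_coeff i)" if "i \<in> I" for i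
    using x that by (subst lin_coeffs_expand[OF I l]) (simp add: mult.commute)
  then have "B x y = f y" for y
    by (subst lin_coeffs_expand[OF I r], subst lin_coeffs_expand[OF I f]) simp
  then show ?thesis by blast
qed

definition pol :: "nat \<Rightarrow> (nat \<times> nat \<Rightarrow> real) \<Rightarrow> pt \<Rightarrow> real" where
  "pol p c x = (\<Sum>k\<in>exps p. c k * monom2 k x)"

lemma pol_poly2: "pol p c \<in> poly2 p"
  by (auto simp: poly2_iff pol_def[abs_def])

lemma poly2_pol: "f \<in> poly2 p \<Longrightarrow> \<exists>c. f = pol p c"
  by (auto simp: poly2_iff pol_def[abs_def])

lemma pol_add: "pol p (\<lambda>k. c k + d k) x = pol p c x + pol p d x"
  by (simp add: pol_def sum.distrib distrib_right)

lemma pol_cmult: "pol p (\<lambda>k. r * c k) x = r * pol p c x"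
  by (simp add: pol_def sum_distrib_left mult.assoc)

lemma pol_cong: "(\<And>k. k \<in> exps p \<Longrightarrow> c k = d k) \<Longrightarrow> pol p c = pol p d"
  by (simp add: pol_def[abs_def])

lemma pol_zero_iff: "pol p c = (\<lambda>x. 0) \<longleftrightarrow> (\<forall>k\<in>exps p. c k = 0)"
proof
  assume "pol p c = (\<lambda>x. 0)"
  then have "\<And>x. (\<Sum>k\<in>exps p. c k * monom2 k x) = 0" by (metis pol_def)
  then show "\<forall>k\<in>exps p. c k = 0" using monom2_independent by blast
qed (simp add: pol_def[abs_def])

section \<open>The local solver\<close>

text \<open>Sum of the left sides of the two local equations, with the terms in the datum moved to
  \<open>hdg_rhs\<close>: a single bilinear form on pairs, ready for the square system.\<close>

definition hdg_form :: "pt set \<Rightarrow> real \<Rightarrow> (pt \<Rightarrow> pt) \<Rightarrow> (pt \<Rightarrow> real) \<Rightarrow> (pt \<Rightarrow> pt) \<Rightarrow> (pt \<Rightarrow> real) \<Rightarrow> real" where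
  "hdg_form V \<tau> Q U v w = integral (tri V) (\<lambda>x. inner (Q x) (v x)) - integral (tri V) (\<lambda>x. U x * divg v x)
    - integral (tri V) (\<lambda>x. inner (Q x) (grad w x))
    + bd_int V (\<lambda>e x. (inner (Q x) (normal V e) + \<tau> * U x) * w x)"

definition hdg_rhs :: "pt set \<Rightarrow> real \<Rightarrow> (pt set \<Rightarrow> pt \<Rightarrow> real) \<Rightarrow> (pt \<Rightarrow> pt) \<Rightarrow> (pt \<Rightarrow> real) \<Rightarrow> real" where
  "hdg_rhs V \<tau> m v w = \<tau> * bd_int V (\<lambda>e x. m e x * w x) - bd_int V (\<lambda>e x. m e x * inner (v x) (normal V e))"

lemma vpoly2_econt: "card e = 2 \<Longrightarrow> v \<in> vpoly2 p \<Longrightarrow> econt e (\<lambda>x. inner (v x) n)"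
  by (intro econt_continuous continuous_intros vpoly2_continuous)

lemma poly2_econt: "card e = 2 \<Longrightarrow> w \<in> poly2 p \<Longrightarrow> econt e w"
  by (intro econt_continuous poly2_continuous)

lemma grad_zero: "grad (\<lambda>x. 0) x = 0"
  by (rule grad_eqI) simp

lemma divg_zero: "divg (\<lambda>x. 0) x = 0"
  by (simp add: divg_eq grad_zero)

text \<open>Testing with \<open>w = 0\<close> and with \<open>v = 0\<close> recovers the two
  equations from their sum.\<close>

lemma local_sol_iff:
  assumes V: "is_tri V" and m: "\<And>e. e \<in> edges_of V \<Longrightarrow> econt e (m e)"
  shows "local_sol p \<tau> V m Q U \<longleftrightarrow> Q \<in> vpoly2 p \<and> U \<in> poly2 p \<and>
    (\<forall>v\<in>vpoly2 p. \<forall>w\<in>poly2 p. hdg_form V \<tau> Q U v w = hdg_rhs V \<tau> m v w)"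
proof (cases "Q \<in> vpoly2 p \<and> U \<in> poly2 p")
  case True
  then have Q: "Q \<in> vpoly2 p" and U: "U \<in> poly2 p" by auto
  let ?L1 = "\<lambda>v. integral (tri V) (\<lambda>x. inner (Q x) (v x)) - integral (tri V) (\<lambda>x. U x * divg v x)"
  let ?R1 = "\<lambda>v. - bd_int V (\<lambda>e x. m e x * inner (v x) (normal V e))"
  let ?L2 = "\<lambda>w. - integral (tri V) (\<lambda>x. inner (Q x) (grad w x)) + bd_int V (\<lambda>e x. (inner (Q x) (normal V e) + \<tau> * U x) * w x)"
  let ?R2 = "\<lambda>w. \<tau> * bd_int V (\<lambda>e x. m e x * w x)"
  have 2: "bd_int V (\<lambda>e x. (inner (Q x) (normal V e) + \<tau> * (U x - m e x)) * w x)
    = bd_int V (\<lambda>e x. (inner (Q x) (normal V e) + \<tau> * U x) * w x) - \<tau> * bd_int V (\<lambda>e x. m e x * w x)"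
    if "w \<in> poly2 p" for w
  proof -
    have "bd_int V (\<lambda>e x. (inner (Q x) (normal V e) + \<tau> * (U x - m e x)) * w x)
      = bd_int V (\<lambda>e x. (inner (Q x) (normal V e) + \<tau> * U x) * w x - \<tau> * (m e x * w x))"
      by (simp add: algebra_simps)
    also have "\<dots> = bd_int V (\<lambda>e x. (inner (Q x) (normal V e) + \<tau> * U x) * w x) - bd_int V (\<lambda>e x. \<tau> * (m e x * w x))"
      by (rule bd_int_diff; intro econt_mult econt_add econt_const vpoly2_econt[OF _ Q]
          poly2_econt[OF _ U] poly2_econt[OF _ that] m edges_card)
    finally show ?thesis by (simp add: bd_int_cmult)
  qed
  have ls: "local_sol p \<tau> V m Q U \<longleftrightarrow> (\<forall>v\<in>vpoly2 p. ?L1 v = ?R1 v) \<and> (\<forall>w\<in>poly2 p. ?L2 w = ?R2 w)"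
  proof -
    have "(- integral (tri V) (\<lambda>x. inner (Q x) (grad w x))
        + bd_int V (\<lambda>e x. (inner (Q x) (normal V e) + \<tau> * (U x - m e x)) * w x) = 0) \<longleftrightarrow> ?L2 w = ?R2 w"
      if "w \<in> poly2 p" for w
      unfolding 2[OF that] by linarith
    then show ?thesis
      using Q U unfolding local_sol_def bd_int_def[symmetric] by (simp only: simp_thms cong: ball_cong)
  qed
  have hf: "hdg_form V \<tau> Q U v w = hdg_rhs V \<tau> m v w \<longleftrightarrow> ?L1 v + ?L2 w = ?R1 v + ?R2 w" for v w
    by (simp add: hdg_form_def hdg_rhs_def algebra_simps)
  have z1: "?L1 (\<lambda>x. 0) = 0" "?R1 (\<lambda>x. 0) = 0" by (simp_all add: divg_zero bd_int_zero)
  have z2: "?L2 (\<lambda>x. 0) = 0" "?R2 (\<lambda>x. 0) = 0" by (simp_all add: grad_zero bd_int_zero)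
  show ?thesis
  proof
    assume "local_sol p \<tau> V m Q U"
    then show "Q \<in> vpoly2 p \<and> U \<in> poly2 p \<and>
      (\<forall>v\<in>vpoly2 p. \<forall>w\<in>poly2 p. hdg_form V \<tau> Q U v w = hdg_rhs V \<tau> m v w)"
      unfolding ls hf using Q U by simp
  next
    assume *: "Q \<in> vpoly2 p \<and> U \<in> poly2 p \<and>
      (\<forall>v\<in>vpoly2 p. \<forall>w\<in>poly2 p. hdg_form V \<tau> Q U v w = hdg_rhs V \<tau> m v w)"
    then have **: "?L1 v + ?L2 w = ?R1 v + ?R2 w" if "v \<in> vpoly2 p" "w \<in> poly2 p" for v w
      using that unfolding hf by blast
    show "local_sol p \<tau> V m Q U" unfolding ls
    proof (intro conjI ballI)
      fix v assume "v \<in> vpoly2 p"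
      from **[OF this poly2_zero] z2 show "?L1 v = ?R1 v" by linarith
    next
      fix w assume "w \<in> poly2 p"
      from **[OF vpoly2_zero this] z1 show "?L2 w = ?R2 w" by linarith
    qed
  qed
qed (auto simp: local_sol_def)

lemma hdg_form_add_left:
  assumes V: "is_tri V" and Q: "Q \<in> vpoly2 p" "Q' \<in> vpoly2 p" and U: "U \<in> poly2 p" "U' \<in> poly2 p"
    and v: "v \<in> vpoly2 p" and w: "w \<in> poly2 p"
  shows "hdg_form V \<tau> (\<lambda>x. Q x + Q' x) (\<lambda>x. U x + U' x) v w = hdg_form V \<tau> Q U v w + hdg_form V \<tau> Q' U' v w"
proof -
  note C = vpoly2_continuous[OF Q(1)] vpoly2_continuous[OF Q(2)] poly2_continuous[OF U(1)] poly2_continuous[OF U(2)]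
    vpoly2_continuous[OF v] poly2_continuous[OF w] poly2_continuous[OF divg_poly2[OF v]] vpoly2_continuous[OF vpoly2_grad[OF w]]
  have 1: "integral (tri V) (\<lambda>x. inner (Q x + Q' x) (v x)) = integral (tri V) (\<lambda>x. inner (Q x) (v x)) + integral (tri V) (\<lambda>x. inner (Q' x) (v x))"
    unfolding inner_add_left by (intro tri_int_add V continuous_intros C)
  have 2: "integral (tri V) (\<lambda>x. (U x + U' x) * divg v x) = integral (tri V) (\<lambda>x. U x * divg v x) + integral (tri V) (\<lambda>x. U' x * divg v x)"
    unfolding distrib_right by (intro tri_int_add V continuous_intros C)
  have 3: "integral (tri V) (\<lambda>x. inner (Q x + Q' x) (grad w x)) = integral (tri V) (\<lambda>x. inner (Q x) (grad w x)) + integral (tri V) (\<lambda>x. inner (Q' x) (grad w x))"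
    unfolding inner_add_left by (intro tri_int_add V continuous_intros C)
  have "bd_int V (\<lambda>e x. (inner (Q x + Q' x) (normal V e) + \<tau> * (U x + U' x)) * w x)
    = bd_int V (\<lambda>e x. (inner (Q x) (normal V e) + \<tau> * U x) * w x + (inner (Q' x) (normal V e) + \<tau> * U' x) * w x)"
    by (simp add: inner_add_left algebra_simps)
  also have "\<dots> = bd_int V (\<lambda>e x. (inner (Q x) (normal V e) + \<tau> * U x) * w x) + bd_int V (\<lambda>e x. (inner (Q' x) (normal V e) + \<tau> * U' x) * w x)"
    by (rule bd_int_add; intro econt_continuous continuous_intros C edges_card)
  finally show ?thesis unfolding hdg_form_def 1 2 3 by simp
qed

lemma hdg_form_scale_left:
  "hdg_form V \<tau> (\<lambda>x. r *\<^sub>R Q x) (\<lambda>x. r * U x) v w = r * hdg_form V \<tau> Q U v w"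
proof -
  have "bd_int V (\<lambda>e x. (inner (r *\<^sub>R Q x) (normal V e) + \<tau> * (r * U x)) * w x)
    = bd_int V (\<lambda>e x. r * ((inner (Q x) (normal V e) + \<tau> * U x) * w x))"
    by (simp add: algebra_simps)
  then have "bd_int V (\<lambda>e x. (inner (r *\<^sub>R Q x) (normal V e) + \<tau> * (r * U x)) * w x)
    = r * bd_int V (\<lambda>e x. (inner (Q x) (normal V e) + \<tau> * U x) * w x)"
    by (simp only: bd_int_cmult)
  then show ?thesis unfolding hdg_form_def by (simp add: mult.assoc right_diff_distrib distrib_left)
qed

lemma hdg_form_add_right:
  assumes V: "is_tri V" and Q: "Q \<in> vpoly2 p" and U: "U \<in> poly2 p"
    and v: "v \<in> vpoly2 p" "v' \<in> vpoly2 p" and w: "w \<in> poly2 p" "w' \<in> poly2 p"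
  shows "hdg_form V \<tau> Q U (\<lambda>x. v x + v' x) (\<lambda>x. w x + w' x) = hdg_form V \<tau> Q U v w + hdg_form V \<tau> Q U v' w'"
proof -
  note C = vpoly2_continuous[OF Q] poly2_continuous[OF U] vpoly2_continuous[OF v(1)] vpoly2_continuous[OF v(2)]
    poly2_continuous[OF w(1)] poly2_continuous[OF w(2)] poly2_continuous[OF divg_poly2[OF v(1)]] poly2_continuous[OF divg_poly2[OF v(2)]]
    vpoly2_continuous[OF vpoly2_grad[OF w(1)]] vpoly2_continuous[OF vpoly2_grad[OF w(2)]]
  have 1: "integral (tri V) (\<lambda>x. inner (Q x) (v x + v' x)) = integral (tri V) (\<lambda>x. inner (Q x) (v x)) + integral (tri V) (\<lambda>x. inner (Q x) (v' x))"
    unfolding inner_add_right by (intro tri_int_add V continuous_intros C)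
  have 2: "integral (tri V) (\<lambda>x. U x * divg (\<lambda>x. v x + v' x) x) = integral (tri V) (\<lambda>x. U x * divg v x) + integral (tri V) (\<lambda>x. U x * divg v' x)"
    unfolding distrib_left divg_add[OF v] by (intro tri_int_add V continuous_intros C)
  have 3: "integral (tri V) (\<lambda>x. inner (Q x) (grad (\<lambda>x. w x + w' x) x)) = integral (tri V) (\<lambda>x. inner (Q x) (grad w x)) + integral (tri V) (\<lambda>x. inner (Q x) (grad w' x))"
    unfolding inner_add_right grad_add[OF w] by (intro tri_int_add V continuous_intros C)
  have "bd_int V (\<lambda>e x. (inner (Q x) (normal V e) + \<tau> * U x) * (w x + w' x))
    = bd_int V (\<lambda>e x. (inner (Q x) (normal V e) + \<tau> * U x) * w x + (inner (Q x) (normal V e) + \<tau> * U x) * w' x)"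
    by (simp add: algebra_simps)
  also have "\<dots> = bd_int V (\<lambda>e x. (inner (Q x) (normal V e) + \<tau> * U x) * w x) + bd_int V (\<lambda>e x. (inner (Q x) (normal V e) + \<tau> * U x) * w' x)"
    by (rule bd_int_add; intro econt_continuous continuous_intros C edges_card)
  finally show ?thesis unfolding hdg_form_def 1 2 3 by simp
qed

lemma hdg_form_scale_right:
  assumes "v \<in> vpoly2 p" "w \<in> poly2 p"
  shows "hdg_form V \<tau> Q U (\<lambda>x. r *\<^sub>R v x) (\<lambda>x. r * w x) = r * hdg_form V \<tau> Q U v w"
proof -
  have "(\<lambda>e x. (inner (Q x) (normal V e) + \<tau> * U x) * (r * w x))
    = (\<lambda>e x. r * ((inner (Q x) (normal V e) + \<tau> * U x) * w x))"
    by (simp add: algebra_simps)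
  then have "bd_int V (\<lambda>e x. (inner (Q x) (normal V e) + \<tau> * U x) * (r * w x))
    = r * bd_int V (\<lambda>e x. (inner (Q x) (normal V e) + \<tau> * U x) * w x)"
    by (simp only: bd_int_cmult)
  moreover have "integral (tri V) (\<lambda>x. U x * (r * divg v x)) = r * integral (tri V) (\<lambda>x. U x * divg v x)"
    by (simp add: mult.left_commute)
  ultimately show ?thesis
    unfolding hdg_form_def divg_scaleR[OF assms(1)] grad_cmult[OF assms(2)]
    by (simp add: right_diff_distrib distrib_left)
qed

lemma hdg_rhs_add:
  assumes m: "\<And>e. e \<in> edges_of V \<Longrightarrow> econt e (m e)"
    and v: "v \<in> vpoly2 p" "v' \<in> vpoly2 p" and w: "w \<in> poly2 p" "w' \<in> poly2 p"
  shows "hdg_rhs V \<tau> m (\<lambda>x. v x + v' x) (\<lambda>x. w x + w' x) = hdg_rhs V \<tau> m v w + hdg_rhs V \<tau> m v' w'"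
proof -
  have 1: "bd_int V (\<lambda>e x. m e x * inner (v x + v' x) (normal V e))
     = bd_int V (\<lambda>e x. m e x * inner (v x) (normal V e)) + bd_int V (\<lambda>e x. m e x * inner (v' x) (normal V e))"
    unfolding inner_add_left distrib_left
    by (rule bd_int_add; intro econt_mult m vpoly2_econt[OF _ v(1)] vpoly2_econt[OF _ v(2)] edges_card)
  have 2: "bd_int V (\<lambda>e x. m e x * (w x + w' x)) = bd_int V (\<lambda>e x. m e x * w x) + bd_int V (\<lambda>e x. m e x * w' x)"
    unfolding distrib_left
    by (rule bd_int_add; intro econt_mult m poly2_econt[OF _ w(1)] poly2_econt[OF _ w(2)] edges_card)
  show ?thesis unfolding hdg_rhs_def 1 2 by (simp add: algebra_simps)
qed

lemma hdg_rhs_scale: "hdg_rhs V \<tau> m (\<lambda>x. r *\<^sub>R v x) (\<lambda>x. r * w x) = r * hdg_rhs V \<tau> m v w"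
proof -
  have "bd_int V (\<lambda>e x. m e x * (r * w x)) = r * bd_int V (\<lambda>e x. m e x * w x)"
    by (simp add: mult.left_commute bd_int_cmult)
  moreover have "bd_int V (\<lambda>e x. m e x * inner (r *\<^sub>R v x) (normal V e)) = r * bd_int V (\<lambda>e x. m e x * inner (v x) (normal V e))"
    by (simp add: mult.left_commute bd_int_cmult)
  ultimately show ?thesis unfolding hdg_rhs_def by (simp add: algebra_simps)
qed

text \<open>Zero data means zero energy, so \<open>Q\<close> and the trace of \<open>U\<close>
  vanish. Testing with \<open>grad U\<close> then makes the gradient vanish, and a constant with
  zero trace is zero.\<close>

lemma hdg_form_injective:
  assumes V: "is_tri V" and \<tau>: "\<tau> > 0" and Q: "Q \<in> vpoly2 p" and U: "U \<in> poly2 p"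
    and z: "\<And>v w. v \<in> vpoly2 p \<Longrightarrow> w \<in> poly2 p \<Longrightarrow> hdg_form V \<tau> Q U v w = 0"
  shows "Q = (\<lambda>x. 0)" "U = (\<lambda>x. 0)"
proof -
  note C = vpoly2_continuous[OF Q] poly2_continuous[OF U]
  have "bd_int V (\<lambda>e x. (inner (Q x) (normal V e) + \<tau> * U x) * U x)
    = bd_int V (\<lambda>e x. U x * inner (Q x) (normal V e) + \<tau> * (U x)\<^sup>2)"
    by (simp add: algebra_simps power2_eq_square)
  also have "\<dots> = bd_int V (\<lambda>e x. U x * inner (Q x) (normal V e)) + bd_int V (\<lambda>e x. \<tau> * (U x)\<^sup>2)"
    by (rule bd_int_add; intro econt_continuous continuous_intros C edges_card)
  \<comment> \<open>When the form is tested with the solution itself, integration by parts cancels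
    everything except the two squares.\<close>
  finally have "integral (tri V) (\<lambda>x. inner (Q x) (Q x)) + \<tau> * bd_int V (\<lambda>e x. (U x)\<^sup>2) = 0"
    using z[OF Q U] tri_integration_by_parts[OF V U Q] unfolding hdg_form_def bd_int_def[symmetric]
    by (simp add: bd_int_cmult)
  moreover have "0 \<le> integral (tri V) (\<lambda>x. inner (Q x) (Q x))"
    by (intro tri_int_nonneg V continuous_intros C) simp
  moreover have b0: "0 \<le> bd_int V (\<lambda>e x. (U x)\<^sup>2)"
    by (intro bd_int_nonneg econt_continuous continuous_intros C edges_card) auto
  moreover have "0 \<le> \<tau> * bd_int V (\<lambda>e x. (U x)\<^sup>2)" using \<tau> b0 by simp
  ultimately have QQ: "integral (tri V) (\<lambda>x. inner (Q x) (Q x)) = 0" and UU: "bd_int V (\<lambda>e x. (U x)\<^sup>2) = 0"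
    using \<tau> by (auto simp: add_nonneg_eq_0_iff)
  show Q0: "Q = (\<lambda>x. 0)" using vpoly2_square_integral_zero[OF V Q QQ] by blast
  have "edge_int e (\<lambda>x. (U x)\<^sup>2) = 0" if "e \<in> edges_of V" for e
  proof -
    have "\<forall>e\<in>edges_of V. edge_int e (\<lambda>x. (U x)\<^sup>2) = 0"
      using UU unfolding bd_int_def
      by (subst (asm) sum_nonneg_eq_0_iff)
        (auto intro!: finite_edges_of is_tri_finite V edge_int_nonneg econt_continuous continuous_intros C edges_card)
    then show ?thesis using that by blast
  qed
  then have Ue: "U x = 0" if "e \<in> edges_of V" "x \<in> seg e" for e x
    using that edge_int_square_zero[OF poly2_econt[OF edges_card U]] by blast
  have "bd_int V (\<lambda>e x. U x * inner (v x) (normal V e)) = 0" for v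
    using bd_int_cong[of V "\<lambda>e x. U x * inner (v x) (normal V e)" "\<lambda>e x. 0"] Ue by (simp add: bd_int_zero)
  then have "integral (tri V) (\<lambda>x. inner (grad U x) (grad U x)) = 0"
    using z[OF vpoly2_grad[OF U] poly2_zero] tri_integration_by_parts[OF V U vpoly2_grad[OF U]]
    unfolding hdg_form_def bd_int_def[symmetric] by (simp add: Q0 grad_zero bd_int_zero)
  then have "grad U x = 0" for x using vpoly2_square_integral_zero[OF V vpoly2_grad[OF U]] by blast
  then have "(U has_derivative (\<lambda>h. 0)) (at x)" for x
    using poly2_has_derivative[OF U, of x] by simp
  then obtain k where k: "\<And>x. U x = k"
    using has_derivative_zero_constant[of UNIV U] by auto
  obtain a b c where abc: "V = {a, b, c}" "a \<noteq> b" "b \<noteq> c" "a \<noteq> c"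
    using V by (rule is_tri_cases)
  have "U a = 0" by (rule Ue[of "{a, b}"]) (auto simp: abc edges_of_tri seg_doubleton)
  with k show "U = (\<lambda>x. 0)" by auto
qed

lemma local_sol_unique:
  assumes V: "is_tri V" and \<tau>: "\<tau> > 0" and m: "\<And>e. e \<in> edges_of V \<Longrightarrow> econt e (m e)"
    and s: "local_sol p \<tau> V m Q U" "local_sol p \<tau> V m Q' U'"
  shows "Q = Q'" "U = U'"
proof -
  from s have Q: "Q \<in> vpoly2 p" "Q' \<in> vpoly2 p" and U: "U \<in> poly2 p" "U' \<in> poly2 p"
    by (auto simp: local_sol_def)
  have Qm: "(\<lambda>x. Q x + (-1) *\<^sub>R Q' x) \<in> vpoly2 p" by (intro vpoly2_add vpoly2_scaleR Q)
  have Um: "(\<lambda>x. U x + (-1) * U' x) \<in> poly2 p" by (intro poly2_add poly2_cmult U)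
  have *: "hdg_form V \<tau> (\<lambda>x. Q x + (-1) *\<^sub>R Q' x) (\<lambda>x. U x + (-1) * U' x) v w = 0"
    if vw: "v \<in> vpoly2 p" "w \<in> poly2 p" for v w
  proof -
    have "hdg_form V \<tau> (\<lambda>x. Q x + (-1) *\<^sub>R Q' x) (\<lambda>x. U x + (-1) * U' x) v w
      = hdg_form V \<tau> Q U v w + hdg_form V \<tau> (\<lambda>x. (-1) *\<^sub>R Q' x) (\<lambda>x. (-1) * U' x) v w"
      by (rule hdg_form_add_left[OF V Q(1) vpoly2_scaleR[OF Q(2)] U(1) poly2_cmult[OF U(2)] vw])
    also have "\<dots> = hdg_form V \<tau> Q U v w + (-1) * hdg_form V \<tau> Q' U' v w"
      by (simp only: hdg_form_scale_left)
    also have "\<dots> = 0" using s vw by (simp add: local_sol_iff[OF V m])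
    finally show ?thesis .
  qed
  note z = hdg_form_injective[OF V \<tau> Qm Um *]
  show "Q = Q'"
  proof
    fix x show "Q x = Q' x" using fun_cong[OF z(1), of x] by simp
  qed
  show "U = U'"
  proof
    fix x show "U x = U' x" using fun_cong[OF z(2), of x] by simp
  qed
qed

lemma local_sol_exists:
  assumes V: "is_tri V" and \<tau>: "\<tau> > 0" and m: "\<And>e. e \<in> edges_of V \<Longrightarrow> econt e (m e)"
  shows "\<exists>Q U. local_sol p \<tau> V m Q U"
proof -
  \<comment> \<open>Blocks 0 and 1 carry the components of \<open>Q\<close>, block 2 carries
    \<open>U\<close>.\<close>
  define I where "I = {0, 1, 2 :: nat} \<times> exps p"
  define PQ where "PQ c x = (pol p (\<lambda>k. c (0 :: nat, k)) x, pol p (\<lambda>k. c (1, k)) x)" for c x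
  define PU where "PU c = pol p (\<lambda>k. c (2 :: nat, k))" for c
  have PQ: "PQ c \<in> vpoly2 p" for c by (auto simp: vpoly2_iff PQ_def pol_poly2)
  have PU: "PU c \<in> poly2 p" for c by (auto simp: PU_def pol_poly2)
  have add: "PQ (\<lambda>i. c i + d i) = (\<lambda>x. PQ c x + PQ d x)" "PU (\<lambda>i. c i + d i) = (\<lambda>x. PU c x + PU d x)" for c d
    by (auto simp: PQ_def PU_def pol_add)
  have scale: "PQ (\<lambda>i. r * c i) = (\<lambda>x. r *\<^sub>R PQ c x)" "PU (\<lambda>i. r * c i) = (\<lambda>x. r * PU c x)" for r c
    by (auto simp: PQ_def PU_def pol_cmult)
  have cong: "PQ c = PQ d \<and> PU c = PU d" if "\<forall>i\<in>I. c i = d i" for c d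
    unfolding PQ_def PU_def using that
    by (auto intro!: ext fun_cong[OF pol_cong] pol_cong simp: I_def)
  have rep: "\<exists>d. v = PQ d \<and> w = PU d" if vw: "v \<in> vpoly2 p" "w \<in> poly2 p" for v w
  proof -
    from vw(1) have "(\<lambda>x. fst (v x)) \<in> poly2 p" "(\<lambda>x. snd (v x)) \<in> poly2 p" by (simp_all add: vpoly2_iff)
    from this[THEN poly2_pol] poly2_pol[OF vw(2)] obtain c0 c1 c2 where
      c0: "(\<lambda>x. fst (v x)) = pol p c0" and c1: "(\<lambda>x. snd (v x)) = pol p c1" and c2: "w = pol p c2" by blast
    define d where "d i = (if fst i = 0 then c0 (snd i) else if fst i = 1 then c1 (snd i) else c2 (snd i))" for i :: "nat \<times> nat \<times> nat"
    have "v x = PQ d x" for x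
      using fun_cong[OF c0, of x] fun_cong[OF c1, of x] by (simp add: PQ_def d_def prod_eq_iff)
    then have "v = PQ d" by blast
    moreover have "w = PU d" by (simp add: PU_def d_def c2)
    ultimately show ?thesis by blast
  qed
  have "\<exists>c. \<forall>d. hdg_form V \<tau> (PQ c) (PU c) (PQ d) (PU d) = hdg_rhs V \<tau> m (PQ d) (PU d)"
  proof (rule bilinear_coeffs_solvable)
    show "finite I" by (simp add: I_def)
    show "lin_coeffs I (\<lambda>c. hdg_form V \<tau> (PQ c) (PU c) (PQ d) (PU d))" for d
      unfolding lin_coeffs_def
    proof (intro conjI allI impI)
      fix x y :: "nat \<times> nat \<times> nat \<Rightarrow> real" assume "\<forall>i\<in>I. x i = y i"
      then show "hdg_form V \<tau> (PQ x) (PU x) (PQ d) (PU d) = hdg_form V \<tau> (PQ y) (PU y) (PQ d) (PU d)"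
        using cong by metis
    qed (simp_all only: add scale hdg_form_scale_left hdg_form_add_left[OF V PQ PQ PU PU PQ PU])
    show "lin_coeffs I (\<lambda>d. hdg_form V \<tau> (PQ c) (PU c) (PQ d) (PU d))" for c
      unfolding lin_coeffs_def
    proof (intro conjI allI impI)
      fix x y :: "nat \<times> nat \<times> nat \<Rightarrow> real" assume "\<forall>i\<in>I. x i = y i"
      then show "hdg_form V \<tau> (PQ c) (PU c) (PQ x) (PU x) = hdg_form V \<tau> (PQ c) (PU c) (PQ y) (PU y)"
        using cong by metis
    qed (simp_all only: add scale hdg_form_scale_right[OF PQ PU] hdg_form_add_right[OF V PQ PU PQ PQ PU PU])
    show "lin_coeffs I (\<lambda>d. hdg_rhs V \<tau> m (PQ d) (PU d))"
      unfolding lin_coeffs_def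
    proof (intro conjI allI impI)
      fix x y :: "nat \<times> nat \<times> nat \<Rightarrow> real" assume "\<forall>i\<in>I. x i = y i"
      then show "hdg_rhs V \<tau> m (PQ x) (PU x) = hdg_rhs V \<tau> m (PQ y) (PU y)"
        using cong by metis
    qed (simp_all only: add scale hdg_rhs_scale hdg_rhs_add[OF m PQ PQ PU PU])
  next
    fix c assume c: "\<And>d. hdg_form V \<tau> (PQ c) (PU c) (PQ d) (PU d) = 0"
    have *: "hdg_form V \<tau> (PQ c) (PU c) v w = 0" if "v \<in> vpoly2 p" "w \<in> poly2 p" for v w
      using rep[OF that] c by blast
    note z = hdg_form_injective[OF V \<tau> PQ PU *]
    have "pol p (\<lambda>k. c (0, k)) x = 0" "pol p (\<lambda>k. c (1, k)) x = 0" "pol p (\<lambda>k. c (2, k)) x = 0" for x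
      using fun_cong[OF z(1), of x] fun_cong[OF z(2), of x] by (simp_all add: PQ_def PU_def zero_prod_def)
    then have "pol p (\<lambda>k. c (0, k)) = (\<lambda>x. 0)" "pol p (\<lambda>k. c (1, k)) = (\<lambda>x. 0)" "pol p (\<lambda>k. c (2, k)) = (\<lambda>x. 0)"
      by blast+
    then show "\<forall>i\<in>I. c i = 0" by (auto simp: pol_zero_iff I_def)
  qed
  then obtain c where c: "\<And>d. hdg_form V \<tau> (PQ c) (PU c) (PQ d) (PU d) = hdg_rhs V \<tau> m (PQ d) (PU d)" by auto
  have "local_sol p \<tau> V m (PQ c) (PU c)"
  proof (rule local_sol_iff[OF V m, THEN iffD2]; (intro conjI ballI PQ PU)?)
    fix v w assume "v \<in> vpoly2 p" "w \<in> poly2 p"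
    from rep[OF this] show "hdg_form V \<tau> (PQ c) (PU c) v w = hdg_rhs V \<tau> m v w" using c by blast
  qed
  then show ?thesis by blast
qed

text \<open>The gate to the descriptions \<open>loc_Q\<close> and \<open>loc_U\<close>: every later
  property of the local solution is drawn from here.\<close>

lemma local_sol_loc:
  assumes V: "is_tri V" and \<tau>: "\<tau> > 0" and m: "\<And>e. e \<in> edges_of V \<Longrightarrow> econt e (m e)"
  shows "local_sol p \<tau> V m (loc_Q p \<tau> V m) (loc_U p \<tau> V m)"
proof -
  obtain Q U where QU: "local_sol p \<tau> V m Q U" using local_sol_exists[OF assms] by blast
  have "(THE QU. local_sol p \<tau> V m (fst QU) (snd QU)) = (Q, U)"
  proof (rule the_equality)
    show "local_sol p \<tau> V m (fst (Q, U)) (snd (Q, U))" using QU by simp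
    fix X assume X: "local_sol p \<tau> V m (fst X) (snd X)"
    show "X = (Q, U)" using local_sol_unique[OF V \<tau> m X QU] by (simp add: prod_eq_iff)
  qed
  then show ?thesis using QU by (simp add: loc_Q_def loc_U_def)
qed

text \<open>The constant is 1 whatever the shape and size of the triangle and the value of
  \<open>\<tau>\<close>. This is what keeps the number of levels between coarse and fine mesh out of
  the final bound.\<close>

lemma local_sol_energy_le_gradient:
  assumes V: "is_tri V" and w: "w \<in> poly2 p" and \<tau>: "\<tau> > 0"
    and m: "\<And>e x. e \<in> edges_of V \<Longrightarrow> x \<in> seg e \<Longrightarrow> m e x = w x"
    and s: "local_sol p \<tau> V m Q U"
  shows "integral (tri V) (\<lambda>x. inner (Q x) (Q x)) + \<tau> * bd_int V (\<lambda>e x. (U x - m e x)\<^sup>2)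
    \<le> integral (tri V) (\<lambda>x. inner (grad w x) (grad w x))"
proof -
  from s have Q: "Q \<in> vpoly2 p" and U: "U \<in> poly2 p" by (auto simp: local_sol_def)
  have D: "(\<lambda>x. U x - w x) \<in> poly2 p" by (intro poly2_diff U w)
  note C = vpoly2_continuous[OF Q] poly2_continuous[OF U] poly2_continuous[OF w]
    vpoly2_continuous[OF vpoly2_grad[OF w]] vpoly2_continuous[OF vpoly2_grad[OF U]]
    poly2_continuous[OF divg_poly2[OF Q]] vpoly2_continuous[OF vpoly2_grad[OF D]]
  let ?n = "\<lambda>e. normal V e"
  have E1: "integral (tri V) (\<lambda>x. inner (Q x) (Q x)) - integral (tri V) (\<lambda>x. U x * divg Q x)
      = - bd_int V (\<lambda>e x. w x * inner (Q x) (?n e))"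
  proof -
    have "bd_int V (\<lambda>e x. m e x * inner (Q x) (?n e)) = bd_int V (\<lambda>e x. w x * inner (Q x) (?n e))"
      by (rule bd_int_cong) (simp add: m)
    then show ?thesis using s Q unfolding local_sol_def bd_int_def[symmetric] by simp
  qed
  have E2: "integral (tri V) (\<lambda>x. inner (Q x) (grad (\<lambda>x. U x - w x) x))
     = bd_int V (\<lambda>e x. (U x - w x) * inner (Q x) (?n e)) + \<tau> * bd_int V (\<lambda>e x. (U x - w x)\<^sup>2)"
  proof -
    have "integral (tri V) (\<lambda>x. inner (Q x) (grad (\<lambda>x. U x - w x) x))
       = bd_int V (\<lambda>e x. (inner (Q x) (?n e) + \<tau> * (U x - m e x)) * (U x - w x))"
      using s D unfolding local_sol_def bd_int_def[symmetric] by fastforce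
    also have "\<dots> = bd_int V (\<lambda>e x. (U x - w x) * inner (Q x) (?n e) + \<tau> * (U x - w x)\<^sup>2)"
      by (rule bd_int_cong) (simp add: m power2_eq_square algebra_simps)
    also have "\<dots> = bd_int V (\<lambda>e x. (U x - w x) * inner (Q x) (?n e)) + bd_int V (\<lambda>e x. \<tau> * (U x - w x)\<^sup>2)"
      by (rule bd_int_add; intro econt_continuous continuous_intros C edges_card)
    finally show ?thesis by (simp add: bd_int_cmult)
  qed
  have E3: "integral (tri V) (\<lambda>x. (U x - w x) * divg Q x)
    = bd_int V (\<lambda>e x. (U x - w x) * inner (Q x) (?n e)) - integral (tri V) (\<lambda>x. inner (Q x) (grad (\<lambda>x. U x - w x) x))"
    using tri_integration_by_parts[OF V D Q] by (simp add: bd_int_def)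
  have E4: "integral (tri V) (\<lambda>x. w x * divg Q x)
    = bd_int V (\<lambda>e x. w x * inner (Q x) (?n e)) - integral (tri V) (\<lambda>x. inner (Q x) (grad w x))"
    using tri_integration_by_parts[OF V w Q] by (simp add: bd_int_def)
  have E5: "integral (tri V) (\<lambda>x. (U x - w x) * divg Q x)
    = integral (tri V) (\<lambda>x. U x * divg Q x) - integral (tri V) (\<lambda>x. w x * divg Q x)"
    unfolding left_diff_distrib by (intro tri_int_diff V continuous_intros C)
  have bm: "bd_int V (\<lambda>e x. (U x - m e x)\<^sup>2) = bd_int V (\<lambda>e x. (U x - w x)\<^sup>2)"
    by (rule bd_int_cong) (simp add: m)
  \<comment> \<open>All boundary fluxes cancel between the five identities, and only the coupling of
    \<open>Q\<close> with \<open>grad w\<close> survives.\<close>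
  have id: "integral (tri V) (\<lambda>x. inner (Q x) (Q x)) + \<tau> * bd_int V (\<lambda>e x. (U x - m e x)\<^sup>2)
    = - integral (tri V) (\<lambda>x. inner (Q x) (grad w x))"
    unfolding bm using E1 E2 E3 E4 E5 by linarith
  \<comment> \<open>Young's inequality with equal weights: one of the two copies of the squared norm
    of \<open>Q\<close> is absorbed on the left.\<close>
  have "integral (tri V) (\<lambda>x. - 2 * inner (Q x) (grad w x)) \<le> integral (tri V) (\<lambda>x. inner (Q x) (Q x) + inner (grad w x) (grad w x))"
  proof (intro tri_int_mono V continuous_intros C)
    fix x
    have "0 \<le> inner (Q x + grad w x) (Q x + grad w x)" by simp
    then show "- 2 * inner (Q x) (grad w x) \<le> inner (Q x) (Q x) + inner (grad w x) (grad w x)"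
      unfolding inner_add_left inner_add_right using inner_commute[of "grad w x" "Q x"] by linarith
  qed
  moreover have "integral (tri V) (\<lambda>x. inner (Q x) (Q x) + inner (grad w x) (grad w x))
    = integral (tri V) (\<lambda>x. inner (Q x) (Q x)) + integral (tri V) (\<lambda>x. inner (grad w x) (grad w x))"
    by (intro tri_int_add V continuous_intros C)
  moreover have "0 \<le> \<tau> * bd_int V (\<lambda>e x. (U x - m e x)\<^sup>2)"
    unfolding bm using \<tau> by (intro mult_nonneg_nonneg bd_int_nonneg econt_continuous continuous_intros C edges_card) auto
  ultimately show ?thesis using id by simp
qed

section \<open>Inverse estimates on the reference triangle\<close>

lemma monom2_bound: "x \<in> ref_tri \<Longrightarrow> 0 \<le> monom2 k x \<and> monom2 k x \<le> 1"
  by (auto simp: monom2_def ref_tri_def intro!: mult_le_one power_le_one)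

lemma ref_int_add:
  "continuous_on UNIV f \<Longrightarrow> continuous_on UNIV g \<Longrightarrow>
    integral ref_tri (\<lambda>x. f x + g x :: real) = integral ref_tri f + integral ref_tri g"
  by (intro integral_add integral_eq_lborel(2) compact_ref_tri) (auto intro: continuous_on_subset)

text \<open>The Gram form of the monomials is positive, so the integral controls the coefficients.
  These control the values by Cauchy-Schwarz, since monomials are at most 1 on the reference
  triangle.\<close>

lemma ref_sup_le_L2:
  "\<exists>K>0. \<forall>f\<in>poly2 p. \<forall>x\<in>ref_tri. (f x)\<^sup>2 \<le> K * integral ref_tri (\<lambda>x. (f x)\<^sup>2)"
proof -
  let ?B = "\<lambda>c d. integral ref_tri (\<lambda>x. pol p c x * pol p d x)"
  note cont = poly2_continuous[OF pol_poly2]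
  have r: "lin_coeffs (exps p) (?B c)" for c
    unfolding lin_coeffs_def
  proof (intro conjI allI impI)
    fix x y :: "nat \<times> nat \<Rightarrow> real" assume "\<forall>k\<in>exps p. x k = y k"
    then show "?B c x = ?B c y" using pol_cong[of p x y] by simp
  next
    fix x y show "?B c (\<lambda>k. x k + y k) = ?B c x + ?B c y"
      unfolding pol_add distrib_left by (intro ref_int_add continuous_intros cont)
  next
    fix r x show "?B c (\<lambda>k. r * x k) = r * ?B c x"
      unfolding pol_cmult by (simp add: mult.left_commute)
  qed
  have l: "lin_coeffs (exps p) (\<lambda>c. ?B c d)" for d
    using r[of d] by (simp add: mult.commute)
  have pos: "?B c c > 0" if "\<exists>k\<in>exps p. c k \<noteq> 0" for c
  proof -
    have "0 \<le> integral ref_tri (\<lambda>x. (pol p c x)\<^sup>2)"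
      by (intro integral_nonneg integral_eq_lborel(2) compact_ref_tri continuous_intros cont) simp
    moreover have "integral ref_tri (\<lambda>x. (pol p c x)\<^sup>2) \<noteq> 0"
    proof
      assume "integral ref_tri (\<lambda>x. (pol p c x)\<^sup>2) = 0"
      then have "pol p c = (\<lambda>x. 0)" using poly2_square_ref_integral_zero[OF pol_poly2] by blast
      with that show False by (auto simp: pol_zero_iff)
    qed
    ultimately show ?thesis by (simp add: power2_eq_square)
  qed
  obtain \<kappa> where \<kappa>: "\<kappa> > 0" "\<And>c. \<kappa> * (\<Sum>k\<in>exps p. (c k)\<^sup>2) \<le> ?B c c"
    using bilinear_coeffs_coercive[OF finite_exps l r pos] by blast
  let ?N = "real (card (exps p))"
  \<comment> \<open>The \<open>+ 1\<close> makes the constant visibly positive.\<close>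
  have "(f x)\<^sup>2 \<le> (?N + 1) / \<kappa> * integral ref_tri (\<lambda>x. (f x)\<^sup>2)" if f: "f \<in> poly2 p" and x: "x \<in> ref_tri" for f x
  proof -
    obtain c where c: "f = pol p c" using poly2_pol[OF f] by auto
    have "(f x)\<^sup>2 \<le> (\<Sum>k\<in>exps p. (c k)\<^sup>2) * (\<Sum>k\<in>exps p. (monom2 k x)\<^sup>2)"
      unfolding c pol_def by (rule Cauchy_Schwarz_ineq_sum)
    also have "(\<Sum>k\<in>exps p. (monom2 k x)\<^sup>2) \<le> (\<Sum>k\<in>exps p. 1)"
      using monom2_bound[OF x] by (intro sum_mono) (simp add: power_le_one)
    also have "(\<Sum>k\<in>exps p. 1::real) \<le> ?N + 1" by simp
    finally have "(f x)\<^sup>2 \<le> (\<Sum>k\<in>exps p. (c k)\<^sup>2) * (?N + 1)"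
      by (simp add: mult_left_mono sum_nonneg)
    also have "(\<Sum>k\<in>exps p. (c k)\<^sup>2) \<le> ?B c c / \<kappa>"
      using \<kappa> by (simp add: pos_le_divide_eq mult.commute)
    finally show ?thesis by (simp add: c power2_eq_square mult_right_mono mult.commute)
  qed
  moreover have "(?N + 1) / \<kappa> > 0" using \<kappa>(1) by (intro divide_pos_pos) auto
  ultimately show ?thesis by blast
qed

lemma grad_pol: "grad (pol p c) x = (\<Sum>k\<in>exps p. c k *\<^sub>R grad (monom2 k) x)"
proof (rule grad_eqI)
  have "(pol p c has_derivative (\<lambda>h. \<Sum>k\<in>exps p. c k * inner (grad (monom2 k) x) h)) (at x)"
    unfolding pol_def[abs_def]
    by (intro has_derivative_sum has_derivative_mult_right poly2_has_derivative[OF poly2_monom[OF order_refl]])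
  then show "(pol p c has_derivative inner (\<Sum>k\<in>exps p. c k *\<^sub>R grad (monom2 k) x)) (at x)"
    by (rule has_derivative_eq_rhs) (simp add: inner_sum_left fun_eq_iff)
qed

lemma grad_monom2_bound:
  assumes "x \<in> ref_tri" "k \<in> exps p"
  shows "(fst (grad (monom2 k) x))\<^sup>2 \<le> (real p)\<^sup>2" "(snd (grad (monom2 k) x))\<^sup>2 \<le> (real p)\<^sup>2"
proof -
  have g: "grad (monom2 k) x = (real (fst k) * monom2 (fst k - 1, snd k) x, real (snd k) * monom2 (fst k, snd k - 1) x)"
    by (rule grad_eqI[OF monom2_has_derivative])
  have k: "fst k \<le> p" "snd k \<le> p" using assms(2) by (auto simp: in_exps)
  have *: "(real i * monom2 l x)\<^sup>2 \<le> (real p)\<^sup>2" if "i \<le> p" for i l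
  proof (rule power_mono)
    show "real i * monom2 l x \<le> real p"
      using mult_mono[of "real i" "real p" "monom2 l x" 1] monom2_bound[OF assms(1)] that by simp
    show "0 \<le> real i * monom2 l x" using monom2_bound[OF assms(1)] by simp
  qed
  show "(fst (grad (monom2 k) x))\<^sup>2 \<le> (real p)\<^sup>2" "(snd (grad (monom2 k) x))\<^sup>2 \<le> (real p)\<^sup>2"
    using * k by (simp_all add: g)
qed

text \<open>Same scheme with the sum over the Lagrange nodes in place of the integral. Its
  positivity is unisolvence of the lattice, and the partial derivatives of the monomials are bounded
  by \<open>p\<close>.\<close>

lemma ref_grad_le_nodal:
  assumes p: "p > 0"
  shows "\<exists>K>0. \<forall>f\<in>poly2 p. \<forall>M. (\<forall>i j. i + j \<le> p \<longrightarrow> (f (real i / real p, real j / real p))\<^sup>2 \<le> M) \<longrightarrow>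
    (\<forall>x\<in>ref_tri. inner (grad f x) (grad f x) \<le> K * M)"
proof -
  define nd where "nd k = (real (fst k) / real p, real (snd k) / real p)" for k :: "nat \<times> nat"
  let ?B = "\<lambda>c d. \<Sum>k\<in>exps p. pol p c (nd k) * pol p d (nd k)"
  have r: "lin_coeffs (exps p) (?B c)" for c
    unfolding lin_coeffs_def
  proof (intro conjI allI impI)
    fix x y :: "nat \<times> nat \<Rightarrow> real" assume "\<forall>k\<in>exps p. x k = y k"
    then show "?B c x = ?B c y" using pol_cong[of p x y] by simp
  qed (simp_all add: pol_add pol_cmult distrib_left sum.distrib sum_distrib_left mult.left_commute)
  have l: "lin_coeffs (exps p) (\<lambda>c. ?B c d)" for d
    using r[of d] by (simp add: mult.commute)
  have pos: "?B c c > 0" if c: "\<exists>k\<in>exps p. c k \<noteq> 0" for c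
  proof -
    have "0 \<le> ?B c c" by (intro sum_nonneg) simp
    moreover have "?B c c \<noteq> 0"
    proof
      assume "?B c c = 0"
      then have z: "\<forall>k\<in>exps p. pol p c (nd k) = 0"
        by (subst (asm) sum_nonneg_eq_0_iff) auto
      have "pol p c x = 0" for x
      proof (rule poly2_zero_on_scaled_grid[OF pol_poly2])
        show "1 / real p \<noteq> 0" using p by simp
        fix i j assume "i + j \<le> p"
        then show "pol p c (1 / real p * real i, 1 / real p * real j) = 0"
          using z[rule_format, of "(i, j)"] by (simp add: in_exps nd_def)
      qed
      then have "pol p c = (\<lambda>x. 0)" by blast
      with c show False by (auto simp: pol_zero_iff)
    qed
    ultimately show ?thesis by simp
  qed
  obtain \<kappa> where \<kappa>: "\<kappa> > 0" "\<And>c. \<kappa> * (\<Sum>k\<in>exps p. (c k)\<^sup>2) \<le> ?B c c"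
    using bilinear_coeffs_coercive[OF finite_exps l r pos] by blast
  let ?N = "real (card (exps p))" and ?P = "real p"
  have "inner (grad f x) (grad f x) \<le> ((2 * ?N\<^sup>2 * ?P\<^sup>2 + 1) / \<kappa>) * M"
    if f: "f \<in> poly2 p" and M: "\<forall>i j. i + j \<le> p \<longrightarrow> (f (real i / real p, real j / real p))\<^sup>2 \<le> M" and x: "x \<in> ref_tri" for f M x
  proof -
    obtain c where c: "f = pol p c" using poly2_pol[OF f] by auto
    let ?S = "\<Sum>k\<in>exps p. (c k)\<^sup>2"
    have S0: "?S \<ge> 0" by (simp add: sum_nonneg)
    have "(f (real 0 / ?P, real 0 / ?P))\<^sup>2 \<le> M" using M[rule_format, of 0 0] by simp
    then have M0: "M \<ge> 0" using zero_le_power2[of "f (real 0 / ?P, real 0 / ?P)"] by linarith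
    have "\<kappa> * ?S \<le> ?B c c" by (rule \<kappa>)
    also have "\<dots> \<le> (\<Sum>k\<in>exps p. M)"
      by (rule sum_mono) (use M in \<open>simp add: c nd_def in_exps power2_eq_square\<close>)
    finally have S: "?S \<le> ?N * M / \<kappa>" using \<kappa>(1) by (simp add: pos_le_divide_eq mult.commute)
    have "(fst (grad f x))\<^sup>2 = (\<Sum>k\<in>exps p. c k * fst (grad (monom2 k) x))\<^sup>2"
      by (simp add: c grad_pol fst_sum)
    also have "\<dots> \<le> ?S * (\<Sum>k\<in>exps p. (fst (grad (monom2 k) x))\<^sup>2)" by (rule Cauchy_Schwarz_ineq_sum)
    also have "\<dots> \<le> ?S * (\<Sum>k\<in>exps p. ?P\<^sup>2)"
      using S0 grad_monom2_bound[OF x] by (intro mult_left_mono sum_mono) auto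
    finally have 1: "(fst (grad f x))\<^sup>2 \<le> ?S * (?N * ?P\<^sup>2)" by simp
    have "(snd (grad f x))\<^sup>2 = (\<Sum>k\<in>exps p. c k * snd (grad (monom2 k) x))\<^sup>2"
      by (simp add: c grad_pol snd_sum)
    also have "\<dots> \<le> ?S * (\<Sum>k\<in>exps p. (snd (grad (monom2 k) x))\<^sup>2)" by (rule Cauchy_Schwarz_ineq_sum)
    also have "\<dots> \<le> ?S * (\<Sum>k\<in>exps p. ?P\<^sup>2)"
      using S0 grad_monom2_bound[OF x] by (intro mult_left_mono sum_mono) auto
    finally have 2: "(snd (grad f x))\<^sup>2 \<le> ?S * (?N * ?P\<^sup>2)" by simp
    have "inner (grad f x) (grad f x) \<le> ?S * (2 * ?N * ?P\<^sup>2)"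
      using 1 2 by (simp add: inner_prod_def power2_eq_square algebra_simps)
    also have "\<dots> \<le> (?N * M / \<kappa>) * (2 * ?N * ?P\<^sup>2)"
      using S by (intro mult_right_mono) auto
    also have "\<dots> = (2 * ?N\<^sup>2 * ?P\<^sup>2) / \<kappa> * M" by (simp add: power2_eq_square algebra_simps)
    also have "\<dots> \<le> ((2 * ?N\<^sup>2 * ?P\<^sup>2 + 1) / \<kappa>) * M"
      using M0 \<kappa>(1) by (intro mult_right_mono divide_right_mono) auto
    finally show ?thesis .
  qed
  moreover have "(2 * ?N\<^sup>2 * ?P\<^sup>2 + 1) / \<kappa> > 0"
    using \<kappa>(1) by (intro divide_pos_pos add_nonneg_pos) auto
  ultimately show ?thesis by blast
qed

text \<open>The one-dimensional version is needed for traces: \<open>\<mu>\<close> is polynomial on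
  each edge separately and need not extend to a single polynomial on the triangle.\<close>

lemma polyfun_sup_le_L2:
  "\<exists>K>0. \<forall>c :: nat \<Rightarrow> real. \<forall>s\<in>{0..1}. (\<Sum>k\<le>p. c k * s ^ k)\<^sup>2 \<le> K * integral {0..1} (\<lambda>t. (\<Sum>k\<le>p. c k * t ^ k)\<^sup>2)"
proof -
  define P where "P c t = (\<Sum>k\<le>p. c k * t ^ k)" for c and t :: real
  let ?B = "\<lambda>c d. integral {0..1} (\<lambda>t. P c t * P d t)"
  have cont: "continuous_on S (P c)" for S c unfolding P_def by (intro continuous_intros)
  have r: "lin_coeffs {..p} (?B c)" for c
    unfolding lin_coeffs_def
  proof (intro conjI allI impI)
    fix x y :: "nat \<Rightarrow> real" assume "\<forall>k\<in>{..p}. x k = y k"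
    then have "P x = P y" by (auto simp: P_def)
    then show "?B c x = ?B c y" by simp
  next
    fix x y
    have "P (\<lambda>k. x k + y k) t = P x t + P y t" for t by (simp add: P_def sum.distrib distrib_right)
    then show "?B c (\<lambda>k. x k + y k) = ?B c x + ?B c y"
      unfolding distrib_left
      by (simp only: distrib_left) (intro integral_add integrable_continuous_interval continuous_intros cont)
  next
    fix r x
    have "P (\<lambda>k. r * x k) t = r * P x t" for t by (simp add: P_def sum_distrib_left mult.assoc)
    then show "?B c (\<lambda>k. r * x k) = r * ?B c x" by (simp add: mult.left_commute)
  qed
  have l: "lin_coeffs {..p} (\<lambda>c. ?B c d)" for d
    using r[of d] by (simp add: mult.commute)
  have pos: "?B c c > 0" if c: "\<exists>k\<in>{..p}. c k \<noteq> 0" for c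
  proof -
    have "0 \<le> ?B c c" by (intro integral_nonneg integrable_continuous_interval continuous_intros cont) simp
    moreover have "?B c c \<noteq> 0"
    proof
      assume "?B c c = 0"
      then have z: "\<forall>t\<in>{0..1}. P c t * P c t = 0"
        by (subst (asm) integral_eq_0_iff) (auto intro!: continuous_intros cont)
      have "\<forall>k\<le>p. c k = 0"
      proof (rule polyfun_zero_at_points)
        show "inj_on (\<lambda>i. real i / real (Suc p)) {..p}" by (auto simp: inj_on_def)
        fix i assume "i \<le> p"
        then have "real i / real (Suc p) \<in> {0..1}" by (auto simp: field_simps)
        with z show "(\<Sum>k\<le>p. c k * (real i / real (Suc p)) ^ k) = 0" by (auto simp: P_def)
      qed
      with c show False by auto
    qed
    ultimately show ?thesis by simp
  qed
  obtain \<kappa> where \<kappa>: "\<kappa> > 0" "\<And>c. \<kappa> * (\<Sum>k\<in>{..p}. (c k)\<^sup>2) \<le> ?B c c"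
    using bilinear_coeffs_coercive[OF finite_atMost l r pos] by blast
  have "(P c s)\<^sup>2 \<le> real (Suc p) / \<kappa> * integral {0..1} (\<lambda>t. (P c t)\<^sup>2)" if s: "s \<in> {0..1}" for c s
  proof -
    have "(P c s)\<^sup>2 \<le> (\<Sum>k\<le>p. (c k)\<^sup>2) * (\<Sum>k\<le>p. (s ^ k)\<^sup>2)"
      unfolding P_def by (rule Cauchy_Schwarz_ineq_sum)
    also have "(\<Sum>k\<le>p. (s ^ k)\<^sup>2) \<le> (\<Sum>k\<le>p. 1)"
      using s by (intro sum_mono) (simp add: power_le_one)
    finally have "(P c s)\<^sup>2 \<le> (\<Sum>k\<le>p. (c k)\<^sup>2) * real (Suc p)"
      by (simp add: mult_left_mono sum_nonneg)
    also have "(\<Sum>k\<le>p. (c k)\<^sup>2) \<le> ?B c c / \<kappa>"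
      using \<kappa> by (simp add: pos_le_divide_eq mult.commute)
    finally show ?thesis by (simp add: power2_eq_square mult_right_mono mult.commute)
  qed
  moreover have "real (Suc p) / \<kappa> > 0" using \<kappa>(1) by (intro divide_pos_pos) auto
  ultimately show ?thesis unfolding P_def by blast
qed

section \<open>Scaled estimates on shape-regular triangles\<close>

text \<open>The determinant is twice the area up to sign. With one \<open>h\<close> for the entire
  mesh this joins shape regularity and quasi-uniformity, and every later constant depends on the
  geometry through \<open>\<kappa>\<close> alone. All orderings are quantified because
  \<open>V\<close> is a set.\<close>

definition tri_reg :: "real \<Rightarrow> real \<Rightarrow> pt set \<Rightarrow> bool" where
  "tri_reg \<kappa> h V \<longleftrightarrow> is_tri V \<and> (\<forall>x\<in>V. \<forall>y\<in>V. dist x y \<le> h) \<and>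
     (\<forall>a b c. V = {a, b, c} \<longrightarrow> \<kappa> * h\<^sup>2 \<le> \<bar>det2 (b - a) (c - a)\<bar>)"

lemma abs_det2_le: "\<bar>det2 u v\<bar> \<le> norm u * norm v"
proof -
  have "det2 u v = inner (perp u) v" by (simp add: det2_def perp_def inner_prod_def)
  moreover have "norm (perp u) = norm u" by (simp add: perp_def norm_prod_def add.commute)
  ultimately show ?thesis using Cauchy_Schwarz_ineq2[of "perp u" v] by simp
qed

text \<open>Twice the area is at most the product of two edge lengths, and the other edge is no
  longer than \<open>h\<close>.\<close>

lemma tri_reg_edge_length:
  assumes reg: "tri_reg \<kappa> h V" and h: "h > 0" and e: "e \<in> edges_of V" "e = {a, b}"
  shows "\<kappa> * h \<le> dist a b"
proof -
  have "is_tri V" using reg by (simp add: tri_reg_def)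
  from this e(1) obtain a' b' c where abc: "V = {a', b', c}" "e = {a', b'}"
    by (rule edges_of_third_vertex)
  have "\<kappa> * h\<^sup>2 \<le> \<bar>det2 (b' - a') (c - a')\<bar>" using reg abc(1) unfolding tri_reg_def by blast
  also have "\<dots> \<le> norm (b' - a') * norm (c - a')" by (rule abs_det2_le)
  also have "\<dots> \<le> norm (b' - a') * h"
    using reg abc(1) by (intro mult_left_mono) (auto simp: tri_reg_def dist_norm)
  finally have "(\<kappa> * h) * h \<le> dist a' b' * h" by (simp add: power2_eq_square dist_norm norm_minus_commute)
  then have "\<kappa> * h \<le> dist a' b'" using h by simp
  moreover have "dist a b = dist a' b'" using abc(2) e(2) by (auto simp: doubleton_eq_iff dist_commute)
  ultimately show ?thesis by simp
qed

lemma ref_int_le_const: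
  fixes f :: "pt \<Rightarrow> real"
  assumes "continuous_on UNIV f" "\<And>x. x \<in> ref_tri \<Longrightarrow> f x \<le> B" "0 \<le> B"
  shows "integral ref_tri f \<le> B"
proof -
  let ?Q = "cbox (0, 0) (1, 1) :: pt set"
  have "integral ref_tri f \<le> integral ref_tri (\<lambda>_. B)"
    using assms by (intro integral_le integral_eq_lborel(2) compact_ref_tri) (auto intro: continuous_on_subset)
  also have "\<dots> \<le> integral ?Q (\<lambda>_. B)"
    using assms(3) by (intro integral_subset_le integral_eq_lborel(2) compact_ref_tri compact_cbox continuous_intros)
      (auto simp: ref_tri_def cbox_Pair_eq)
  also have "\<dots> = B" by (simp add: content_Pair)
  finally show ?thesis .
qed

text \<open>Pulled back to the reference triangle, the edge contributes its length, at most
  \<open>h\<close>, and the integral its determinant, at least \<open>\<kappa> * h\<^sup>2\<close>;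
  the quotient is the factor \<open>1 / (\<kappa> * h)\<close>.\<close>

lemma edge_trace_inequality:
  "\<exists>K>0. \<forall>\<kappa> h V e f. tri_reg \<kappa> h V \<longrightarrow> \<kappa> > 0 \<longrightarrow> h > 0 \<longrightarrow> e \<in> edges_of V \<longrightarrow> f \<in> poly2 p \<longrightarrow>
     edge_int e (\<lambda>x. (f x)\<^sup>2) \<le> K / (\<kappa> * h) * integral (tri V) (\<lambda>x. (f x)\<^sup>2)"
proof -
  obtain K where K: "K > 0" "\<And>f x. f \<in> poly2 p \<Longrightarrow> x \<in> ref_tri \<Longrightarrow> (f x)\<^sup>2 \<le> K * integral ref_tri (\<lambda>x. (f x)\<^sup>2)"
    using ref_sup_le_L2 by blast
  have "edge_int e (\<lambda>x. (f x)\<^sup>2) \<le> K / (\<kappa> * h) * integral (tri V) (\<lambda>x. (f x)\<^sup>2)"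
    if reg: "tri_reg \<kappa> h V" and \<kappa>: "\<kappa> > 0" and h: "h > 0" and e: "e \<in> edges_of V" and f: "f \<in> poly2 p" for \<kappa> h V e f
  proof -
    have "is_tri V" using reg by (simp add: tri_reg_def)
    from this e obtain a b c where abc: "V = {a, b, c}" "e = {a, b}" "a \<noteq> b" and D0: "det2 (b - a) (c - a) \<noteq> 0"
      by (rule edges_of_third_vertex)
    let ?D = "\<bar>det2 (b - a) (c - a)\<bar>" and ?J = "integral ref_tri (\<lambda>x. (f (amap a b c x))\<^sup>2)"
      and ?I = "integral (tri V) (\<lambda>x. (f x)\<^sup>2)"
    have I: "?I = ?D * ?J" unfolding abc(1) by (intro integral_tri D0 continuous_intros poly2_continuous[OF f])
    have D: "\<kappa> * h\<^sup>2 \<le> ?D" using reg abc(1) unfolding tri_reg_def by blast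
    have \<kappa>h: "0 < \<kappa> * h\<^sup>2" using \<kappa> h by simp
    have I0: "0 \<le> ?I" by (intro tri_int_nonneg \<open>is_tri V\<close> continuous_intros poly2_continuous[OF f]) simp
    have dh: "dist a b \<le> h" using reg abc(1) by (auto simp: tri_reg_def)
    have line: "(1 - t) *\<^sub>R a + t *\<^sub>R b = amap a b c (t, 0)" for t by (simp add: amap_def algebra_simps)
    have cl: "continuous_on {0..1} (\<lambda>t. f (amap a b c (t, 0)))"
      by (rule continuous_on_compose2[OF poly2_continuous[OF poly2_amap[OF f], of UNIV]]) (auto intro!: continuous_intros)
    have "integral {0..1} (\<lambda>t. (f (amap a b c (t, 0)))\<^sup>2) \<le> integral {0..1} (\<lambda>t::real. K * ?J)"
      by (intro integral_le integrable_continuous_interval continuous_intros cl K(2)[OF poly2_amap[OF f]])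
        (auto simp: ref_tri_def)
    then have "edge_int e (\<lambda>x. (f x)\<^sup>2) \<le> dist a b * (K * ?J)"
      unfolding abc(2) edge_int_eq[OF abc(3)] line by (intro mult_left_mono) auto
    also have "\<dots> = dist a b * (K * ?I / ?D)" using D0 by (simp add: I)
    also have "\<dots> \<le> h * (K * ?I / ?D)" using dh K(1) I0 by (intro mult_right_mono) auto
    also have "\<dots> \<le> h * (K * ?I / (\<kappa> * h\<^sup>2))"
      using D \<kappa>h K(1) I0 h D0 by (intro mult_left_mono divide_left_mono) auto
    also have "\<dots> = K / (\<kappa> * h) * ?I" using h \<kappa> by (simp add: power2_eq_square field_simps)
    finally show ?thesis .
  qed
  with K(1) show ?thesis by blast
qed

lemma grad_amap:
  assumes "f \<in> poly2 p"
  shows "grad (\<lambda>x. f (amap a b c x)) x = (inner (grad f (amap a b c x)) (b - a), inner (grad f (amap a b c x)) (c - a))"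
proof (rule grad_eqI)
  have dA: "(amap a b c has_derivative (\<lambda>h. fst h *\<^sub>R (b - a) + snd h *\<^sub>R (c - a))) (at x)"
    unfolding amap_def[abs_def]
    by (rule has_derivative_eq_rhs, (rule derivative_intros)+, simp)
  show "((\<lambda>x. f (amap a b c x)) has_derivative
      inner (inner (grad f (amap a b c x)) (b - a), inner (grad f (amap a b c x)) (c - a))) (at x)"
    by (rule has_derivative_eq_rhs[OF has_derivative_compose[OF dA poly2_has_derivative[OF assms]]])
      (auto simp: fun_eq_iff inner_add_right mult.commute)
qed

lemma amap_in_nodes:
  assumes "i + j \<le> p" "p > 0"
  shows "amap a b c (real i / real p, real j / real p) \<in> nodes p {a, b, c}"
proof -
  have "amap a b c (real i / real p, real j / real p)
    = (real (p - i - j) / real p) *\<^sub>R a + (real i / real p) *\<^sub>R b + (real j / real p) *\<^sub>R c"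
    using assms by (simp add: amap_def algebra_simps of_nat_diff diff_divide_distrib add_divide_distrib scaleR_left_diff_distrib)
  moreover have "(p - i - j) + i + j = p" using assms by simp
  ultimately show ?thesis unfolding nodes_def by blast
qed

text \<open>No power of \<open>h\<close> remains: the squared gradient scales like
  \<open>h\<^sup>2 / D\<^sup>2\<close> and the area like \<open>\<bar>D\<bar>\<close>, where
  \<open>D\<close> is the determinant of the triangle and at least
  \<open>\<kappa> * h\<^sup>2\<close> in absolute value.\<close>

lemma grad_le_nodal_values:
  assumes p: "p > 0"
  shows "\<exists>K>0. \<forall>\<kappa> h V f M. tri_reg \<kappa> h V \<longrightarrow> \<kappa> > 0 \<longrightarrow> h > 0 \<longrightarrow> f \<in> poly2 p \<longrightarrow>
     (\<forall>z\<in>nodes p V. (f z)\<^sup>2 \<le> M) \<longrightarrow> integral (tri V) (\<lambda>x. inner (grad f x) (grad f x)) \<le> K / \<kappa> * M"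
proof -
  obtain K where K: "K > 0" "\<And>f M x. f \<in> poly2 p \<Longrightarrow> (\<forall>i j. i + j \<le> p \<longrightarrow> (f (real i / real p, real j / real p))\<^sup>2 \<le> M)
     \<Longrightarrow> x \<in> ref_tri \<Longrightarrow> inner (grad f x) (grad f x) \<le> K * M"
    using ref_grad_le_nodal[OF p] by blast
  have "integral (tri V) (\<lambda>x. inner (grad f x) (grad f x)) \<le> (2 * K) / \<kappa> * M"
    if reg: "tri_reg \<kappa> h V" and \<kappa>: "\<kappa> > 0" and h: "h > 0" and f: "f \<in> poly2 p"
      and M: "\<forall>z\<in>nodes p V. (f z)\<^sup>2 \<le> M" for \<kappa> h V f M
  proof -
    have "is_tri V" using reg by (simp add: tri_reg_def)
    then obtain a b c where abc: "V = {a, b, c}" and D0: "det2 (b - a) (c - a) \<noteq> 0"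
      by (rule is_tri_cases)
    let ?A = "amap a b c"
    define D where "D = det2 (b - a) (c - a)"
    define u v where "u = b - a" and "v = c - a"
    have D: "\<kappa> * h\<^sup>2 \<le> \<bar>D\<bar>" using reg abc(1) unfolding tri_reg_def D_def by blast
    have \<kappa>h: "0 < \<kappa> * h\<^sup>2" using \<kappa> h by simp
    have uv: "norm u \<le> h" "norm v \<le> h" using reg by (auto simp: tri_reg_def abc u_def v_def dist_norm)
    have nodal: "\<forall>i j. i + j \<le> p \<longrightarrow> (f (?A (real i / real p, real j / real p)))\<^sup>2 \<le> M"
      using M amap_in_nodes[OF _ p] unfolding abc by blast
    have "(f (?A (real 0 / real p, real 0 / real p)))\<^sup>2 \<le> M" using nodal[rule_format, of 0 0] by simp
    then have M0: "M \<ge> 0" using zero_le_power2[of "f (?A (real 0 / real p, real 0 / real p))"] by linarith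
    have pointwise: "inner (grad f (?A x)) (grad f (?A x)) \<le> 2 * h\<^sup>2 / D\<^sup>2 * (K * M)" if x: "x \<in> ref_tri" for x
    proof -
      define g where "g = grad f (?A x)"
      define s t where "s = inner g u" and "t = inner g v"
      have "s\<^sup>2 + t\<^sup>2 \<le> K * M"
        using K(2)[OF poly2_amap[OF f] nodal x] by (simp add: grad_amap[OF f] s_def t_def g_def u_def v_def inner_prod_def power2_eq_square)
      \<comment> \<open>Cramer's rule recovers \<open>g\<close> from its products \<open>s\<close>
        and \<open>t\<close> with the two edge vectors: \<open>D\<close> times \<open>g\<close> is
        the vector on the right turned by a right angle.\<close>
      moreover have "D\<^sup>2 * inner g g = (norm (s *\<^sub>R v - t *\<^sub>R u))\<^sup>2"
        unfolding power2_norm_eq_inner s_def t_def D_def u_def[symmetric] v_def[symmetric]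
        by (simp add: det2_def inner_prod_def power2_eq_square algebra_simps)
      moreover have "norm (s *\<^sub>R v - t *\<^sub>R u) \<le> h * (\<bar>s\<bar> + \<bar>t\<bar>)"
      proof -
        have "norm (s *\<^sub>R v - t *\<^sub>R u) \<le> \<bar>s\<bar> * norm v + \<bar>t\<bar> * norm u"
          using norm_triangle_ineq4[of "s *\<^sub>R v" "t *\<^sub>R u"] by simp
        also have "\<dots> \<le> \<bar>s\<bar> * h + \<bar>t\<bar> * h" using uv by (intro add_mono mult_left_mono) auto
        finally show ?thesis by (simp add: algebra_simps)
      qed
      then have "(norm (s *\<^sub>R v - t *\<^sub>R u))\<^sup>2 \<le> (h * (\<bar>s\<bar> + \<bar>t\<bar>))\<^sup>2" by (rule power_mono) simp
      moreover have "(h * (\<bar>s\<bar> + \<bar>t\<bar>))\<^sup>2 \<le> h\<^sup>2 * (2 * (s\<^sup>2 + t\<^sup>2))"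
        unfolding power_mult_distrib using sum_squares_bound[of "\<bar>s\<bar>" "\<bar>t\<bar>"]
        by (intro mult_left_mono) (auto simp: power2_sum)
      ultimately have "D\<^sup>2 * inner g g \<le> h\<^sup>2 * (2 * (K * M))"
        by (smt (verit) mult_left_mono zero_le_power2)
      then show ?thesis using D0 by (simp add: g_def D_def field_simps)
    qed
    have "integral (tri V) (\<lambda>x. inner (grad f x) (grad f x)) = \<bar>D\<bar> * integral ref_tri (\<lambda>x. inner (grad f (?A x)) (grad f (?A x)))"
      unfolding abc(1) D_def by (intro integral_tri D0 continuous_intros vpoly2_continuous[OF vpoly2_grad[OF f]])
    also have "\<dots> \<le> \<bar>D\<bar> * (2 * h\<^sup>2 / D\<^sup>2 * (K * M))"
    proof (intro mult_left_mono ref_int_le_const pointwise)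
      show "continuous_on UNIV (\<lambda>x. inner (grad f (?A x)) (grad f (?A x)))"
        by (intro continuous_intros continuous_on_compose2[OF vpoly2_continuous[OF vpoly2_grad[OF f]] continuous_on_amap]) auto
      show "0 \<le> 2 * h\<^sup>2 / D\<^sup>2 * (K * M)" using K(1) M0 by simp
    qed auto
    also have "\<dots> = 2 * K * M * h\<^sup>2 / \<bar>D\<bar>"
    proof -
      have "D\<^sup>2 = \<bar>D\<bar> * \<bar>D\<bar>" by (simp add: power2_eq_square)
      then show ?thesis using D0 by (simp add: D_def field_simps)
    qed
    also have "\<dots> \<le> 2 * K * M * h\<^sup>2 / (\<kappa> * h\<^sup>2)"
      using D \<kappa>h K(1) M0 D0 by (intro divide_left_mono) (auto simp: D_def)
    also have "\<dots> = (2 * K) / \<kappa> * M" using h \<kappa> by (simp add: field_simps)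
    finally show ?thesis .
  qed
  moreover have "2 * K > 0" using K(1) by simp
  ultimately show ?thesis by blast
qed

text \<open>The factor is the reciprocal of the edge length, which is at least
  \<open>\<kappa> * h\<close>.\<close>

lemma edge_poly_sup_le_L2:
  "\<exists>K>0. \<forall>\<kappa> h V e g. tri_reg \<kappa> h V \<longrightarrow> \<kappa> > 0 \<longrightarrow> h > 0 \<longrightarrow> e \<in> edges_of V \<longrightarrow> edge_poly p e g \<longrightarrow>
     (\<forall>x\<in>seg e. (g x)\<^sup>2 \<le> K / (\<kappa> * h) * edge_int e (\<lambda>x. (g x)\<^sup>2))"
proof -
  obtain K where K: "K > 0" "\<And>c s. s \<in> {0..1} \<Longrightarrow> (\<Sum>k\<le>p. c k * s ^ k)\<^sup>2 \<le> K * integral {0..1} (\<lambda>t::real. (\<Sum>k\<le>p. c k * t ^ k)\<^sup>2)"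
    using polyfun_sup_le_L2[of p] by blast
  have "(g x)\<^sup>2 \<le> K / (\<kappa> * h) * edge_int e (\<lambda>x. (g x)\<^sup>2)"
    if reg: "tri_reg \<kappa> h V" and \<kappa>: "\<kappa> > 0" and h: "h > 0" and e: "e \<in> edges_of V" and g: "edge_poly p e g"
      and x: "x \<in> seg e" for \<kappa> h V e g x
  proof -
    obtain a b c where ab: "e = {a, b}" "a \<noteq> b"
      and c: "\<And>t. t \<in> {0..1} \<Longrightarrow> g ((1 - t) *\<^sub>R a + t *\<^sub>R b) = (\<Sum>k\<le>p. c k * t ^ k)"
      using g by (auto simp: edge_poly_def)
    obtain s where s: "s \<in> {0..1}" "x = (1 - s) *\<^sub>R a + s *\<^sub>R b"
      using x by (auto simp: ab seg_doubleton in_segment)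
    let ?J = "integral {0..1} (\<lambda>t. (\<Sum>k\<le>p. c k * t ^ k)\<^sup>2)"
    have J: "edge_int e (\<lambda>x. (g x)\<^sup>2) = dist a b * ?J"
      unfolding ab(1) edge_int_eq[OF ab(2)] by (intro arg_cong2[where f = "(*)"] refl integral_cong) (simp add: c)
    have J0: "0 \<le> ?J" by (intro integral_nonneg integrable_continuous_interval continuous_intros) simp
    have l: "\<kappa> * h \<le> dist a b" by (rule tri_reg_edge_length[OF reg h e ab(1)])
    have "(g x)\<^sup>2 \<le> K * ?J" using K(2)[OF s(1), of c] by (simp only: s(2) c[OF s(1)])
    also have "\<dots> \<le> K / (\<kappa> * h) * (dist a b * ?J)"
    proof -
      have "(\<kappa> * h) * (K * ?J) \<le> dist a b * (K * ?J)" using l K(1) J0 by (intro mult_right_mono) auto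
      then show ?thesis using \<kappa> h by (simp add: field_simps)
    qed
    finally show ?thesis by (simp add: J)
  qed
  with K(1) show ?thesis by blast
qed

lemma edge_poly_econt:
  assumes "edge_poly p e g"
  shows "econt e g"
proof -
  obtain a b c where ab: "e = {a, b}" "a \<noteq> b"
    and c: "\<And>t. t \<in> {0..1} \<Longrightarrow> g ((1 - t) *\<^sub>R a + t *\<^sub>R b) = (\<Sum>k\<le>p. c k * t ^ k)"
    using assms by (auto simp: edge_poly_def)
  have 1: "continuous_on {0..1} (\<lambda>t. g ((1 - t) *\<^sub>R a + t *\<^sub>R b))"
    by (rule continuous_on_eq[of _ "\<lambda>t. \<Sum>k\<le>p. c k * t ^ k"]) (auto simp: c intro!: continuous_intros)
  have 2: "continuous_on {0..1} (\<lambda>t. g ((1 - t) *\<^sub>R b + t *\<^sub>R a))"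
  proof (rule continuous_on_eq[of _ "\<lambda>t. \<Sum>k\<le>p. c k * (1 - t) ^ k"])
    show "continuous_on {0..1} (\<lambda>t. \<Sum>k\<le>p. c k * (1 - t) ^ k)" by (intro continuous_intros)
    fix t :: real assume "t \<in> {0..1}"
    then show "(\<Sum>k\<le>p. c k * (1 - t) ^ k) = g ((1 - t) *\<^sub>R b + t *\<^sub>R a)"
      using c[of "1 - t"] by (simp add: add.commute)
  qed
  show ?thesis unfolding econt_def
  proof (intro conjI allI impI)
    show "card e = 2" using ab by simp
    fix a' b' assume "e = {a', b'}"
    with ab have "a' = a \<and> b' = b \<or> a' = b \<and> b' = a" by (auto simp: doubleton_eq_iff)
    with 1 2 show "continuous_on {0..1} (\<lambda>t. g ((1 - t) *\<^sub>R a' + t *\<^sub>R b'))" by blast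
  qed
qed

lemma edge_poly_diff_poly2:
  assumes "edge_poly p e g" "U \<in> poly2 p"
  shows "edge_poly p e (\<lambda>x. U x - g x)"
proof -
  obtain a b c where ab: "e = {a, b}" "a \<noteq> b"
    and c: "\<And>t. t \<in> {0..1} \<Longrightarrow> g ((1 - t) *\<^sub>R a + t *\<^sub>R b) = (\<Sum>k\<le>p. c k * t ^ k)"
    using assms by (auto simp: edge_poly_def)
  obtain d where d: "\<And>t. U (a + t *\<^sub>R (b - a)) = (\<Sum>k\<le>p. d k * t ^ k)"
    using poly2_along_line[OF assms(2), of a "b - a"] by blast
  have "(1 - t) *\<^sub>R a + t *\<^sub>R b = a + t *\<^sub>R (b - a)" for t by (simp add: algebra_simps)
  then have "\<forall>t\<in>{0..1}. U ((1 - t) *\<^sub>R a + t *\<^sub>R b) - g ((1 - t) *\<^sub>R a + t *\<^sub>R b) = (\<Sum>k\<le>p. (d k - c k) * t ^ k)"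
    using c d by (simp add: left_diff_distrib sum_subtractf)
  then show ?thesis unfolding edge_poly_def using ab
    by (intro exI[of _ a] exI[of _ b] exI[of _ "\<lambda>k. d k - c k"]) simp
qed

definition loc_energy :: "nat \<Rightarrow> real \<Rightarrow> pt set \<Rightarrow> (pt set \<Rightarrow> pt \<Rightarrow> real) \<Rightarrow> real" where
  "loc_energy p \<tau> V m = integral (tri V) (\<lambda>x. inner (loc_Q p \<tau> V m x) (loc_Q p \<tau> V m x))
     + \<tau> * bd_int V (\<lambda>e x. (loc_U p \<tau> V m x - m e x)\<^sup>2)"

lemma hat_a_diag: "hat_a p \<tau> \<T> m m = (\<Sum>V\<in>\<T>. loc_energy p \<tau> V m)"
  by (simp add: hat_a_def loc_energy_def bd_int_def power2_eq_square)

text \<open>The boundary term is split by Young's inequality with a weight tuned so that the trace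
  of \<open>v = Q + grad U\<close> is absorbed. The mismatch \<open>U - m\<close> then carries a
  factor of order \<open>1 / h\<close>, which \<open>\<tau>\<close> dominates.\<close>

lemma local_sol_gradient_bound:
  "\<exists>K>0. \<forall>\<kappa> h V \<tau> c1 m Q U. tri_reg \<kappa> h V \<longrightarrow> \<kappa> > 0 \<longrightarrow> h > 0 \<longrightarrow> c1 > 0 \<longrightarrow> c1 / h \<le> \<tau> \<longrightarrow>
     (\<forall>e\<in>edges_of V. econt e (m e)) \<longrightarrow> local_sol p \<tau> V m Q U \<longrightarrow>
     integral (tri V) (\<lambda>x. inner (grad U x) (grad U x)) \<le>
       (2 + K / (\<kappa> * c1)) * (integral (tri V) (\<lambda>x. inner (Q x) (Q x)) + \<tau> * bd_int V (\<lambda>e x. (U x - m e x)\<^sup>2))"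
proof -
  obtain K where K: "K > 0" "\<And>\<kappa> h V e f. tri_reg \<kappa> h V \<Longrightarrow> \<kappa> > 0 \<Longrightarrow> h > 0 \<Longrightarrow> e \<in> edges_of V \<Longrightarrow> f \<in> poly2 p \<Longrightarrow>
     edge_int e (\<lambda>x. (f x)\<^sup>2) \<le> K / (\<kappa> * h) * integral (tri V) (\<lambda>x. (f x)\<^sup>2)"
    using edge_trace_inequality[of p] by blast
  have "integral (tri V) (\<lambda>x. inner (grad U x) (grad U x)) \<le>
       (2 + (6 * K) / (\<kappa> * c1)) * (integral (tri V) (\<lambda>x. inner (Q x) (Q x)) + \<tau> * bd_int V (\<lambda>e x. (U x - m e x)\<^sup>2))"
    if reg: "tri_reg \<kappa> h V" and \<kappa>: "\<kappa> > 0" and h: "h > 0" and c1: "c1 > 0" and \<tau>: "c1 / h \<le> \<tau>"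
      and m: "\<forall>e\<in>edges_of V. econt e (m e)" and s: "local_sol p \<tau> V m Q U" for \<kappa> h V \<tau> c1 m Q U
  proof -
    have V: "is_tri V" using reg by (simp add: tri_reg_def)
    have m': "\<And>e. e \<in> edges_of V \<Longrightarrow> econt e (m e)" using m by blast
    from s have Q: "Q \<in> vpoly2 p" and U: "U \<in> poly2 p" by (auto simp: local_sol_def)
    define v where "v x = Q x + grad U x" for x
    have v: "v \<in> vpoly2 p" unfolding v_def by (intro vpoly2_add Q vpoly2_grad U)
    note C = vpoly2_continuous[OF Q] poly2_continuous[OF U] vpoly2_continuous[OF vpoly2_grad[OF U]] vpoly2_continuous[OF v]
    let ?vv = "integral (tri V) (\<lambda>x. inner (v x) (v x))" and ?b = "bd_int V (\<lambda>e x. (U x - m e x)\<^sup>2)"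
      and ?QQ = "integral (tri V) (\<lambda>x. inner (Q x) (Q x))"
    \<comment> \<open>Three edges times the trace constant: the whole boundary integral of the
      squared \<open>v\<close> is at most \<open>\<theta>\<close> times its integral over the
      triangle.\<close>
    define \<theta> where "\<theta> = 3 * K / (\<kappa> * h)"
    have \<theta>: "\<theta> > 0" using K(1) \<kappa> h by (simp add: \<theta>_def)
    have QQ0: "0 \<le> ?QQ" by (intro tri_int_nonneg V continuous_intros C) simp
    have b0: "0 \<le> ?b" by (intro bd_int_nonneg econt_power econt_diff poly2_econt[OF _ U] m' edges_card) auto
    \<comment> \<open>One factor \<open>v\<close> is opened up: the part with \<open>Q\<close> is
      given by the first local equation, the part with \<open>grad U\<close> by integration by
      parts, and the divergence terms cancel.\<close>
    have "?vv = integral (tri V) (\<lambda>x. inner (Q x) (v x)) + integral (tri V) (\<lambda>x. inner (v x) (grad U x))"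
    proof -
      have "(\<lambda>x. inner (v x) (v x)) = (\<lambda>x. inner (Q x) (v x) + inner (v x) (grad U x))"
        by (simp add: fun_eq_iff v_def inner_add_left inner_add_right inner_commute)
      then show ?thesis by (simp only:) (intro tri_int_add V continuous_intros C)
    qed
    also have "\<dots> = bd_int V (\<lambda>e x. U x * inner (v x) (normal V e)) - bd_int V (\<lambda>e x. m e x * inner (v x) (normal V e))"
      using s v tri_integration_by_parts[OF V U v] unfolding local_sol_def bd_int_def[symmetric] by force
    also have "\<dots> = bd_int V (\<lambda>e x. U x * inner (v x) (normal V e) - m e x * inner (v x) (normal V e))"
      by (rule bd_int_diff[symmetric]; intro econt_mult poly2_econt[OF _ U] vpoly2_econt[OF _ v] m' edges_card)
    \<comment> \<open>The weight \<open>1 / (2 * \<theta>)\<close> leaves exactly half of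
      \<open>?vv\<close> on the right after the trace inequality.\<close>
    also have "\<dots> \<le> bd_int V (\<lambda>e x. \<theta> / 2 * (U x - m e x)\<^sup>2 + 1 / (2 * \<theta>) * inner (v x) (v x))"
    proof (rule bd_int_mono)
      fix e x assume e: "e \<in> edges_of V"
      define a where "a = U x - m e x"
      define b where "b = inner (v x) (normal V e)"
      have "b\<^sup>2 \<le> inner (v x) (v x) * inner (normal V e) (normal V e)"
        unfolding b_def by (rule Cauchy_Schwarz_ineq)
      also have "inner (normal V e) (normal V e) = 1" using norm_normal[OF V e] by (simp add: norm_eq_1)
      finally have b: "b\<^sup>2 \<le> inner (v x) (v x)" by simp
      have "0 \<le> (\<theta> * a - b)\<^sup>2" by simp
      then have "2 * \<theta> * (a * b) \<le> \<theta>\<^sup>2 * a\<^sup>2 + b\<^sup>2" by (simp add: power2_eq_square algebra_simps)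
      then have "2 * \<theta> * (a * b) \<le> \<theta>\<^sup>2 * a\<^sup>2 + inner (v x) (v x)" using b by simp
      then have "a * b \<le> \<theta> / 2 * a\<^sup>2 + 1 / (2 * \<theta>) * inner (v x) (v x)"
        using \<theta> by (simp add: field_simps power2_eq_square)
      then show "U x * inner (v x) (normal V e) - m e x * inner (v x) (normal V e)
        \<le> \<theta> / 2 * (U x - m e x)\<^sup>2 + 1 / (2 * \<theta>) * inner (v x) (v x)"
        by (simp add: a_def b_def left_diff_distrib)
    next
      fix e assume e: "e \<in> edges_of V"
      have vv: "econt e (\<lambda>x. inner (v x) (v x))" using e by (intro econt_continuous edges_card continuous_intros C)
      show "econt e (\<lambda>x. U x * inner (v x) (normal V e) - m e x * inner (v x) (normal V e))"
        using e by (intro econt_diff econt_mult poly2_econt[OF _ U] vpoly2_econt[OF _ v] m' edges_card)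
      show "econt e (\<lambda>x. \<theta> / 2 * (U x - m e x)\<^sup>2 + 1 / (2 * \<theta>) * inner (v x) (v x))"
        using e by (intro econt_add econt_mult econt_const econt_power econt_diff poly2_econt[OF _ U] m' edges_card vv)
    qed
    also have "\<dots> = bd_int V (\<lambda>e x. \<theta> / 2 * (U x - m e x)\<^sup>2) + bd_int V (\<lambda>e x. 1 / (2 * \<theta>) * inner (v x) (v x))"
    proof (rule bd_int_add)
      fix e assume e: "e \<in> edges_of V"
      show "econt e (\<lambda>x. \<theta> / 2 * (U x - m e x)\<^sup>2)"
        using e by (intro econt_mult econt_const econt_power econt_diff poly2_econt[OF _ U] m' edges_card)
      show "econt e (\<lambda>x. 1 / (2 * \<theta>) * inner (v x) (v x))"
        using e by (intro econt_continuous edges_card continuous_intros C)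
    qed
    also have "\<dots> = \<theta> / 2 * ?b + 1 / (2 * \<theta>) * bd_int V (\<lambda>e x. inner (v x) (v x))"
      by (simp only: bd_int_cmult)
    also have "bd_int V (\<lambda>e x. inner (v x) (v x)) \<le> \<theta> * ?vv"
    proof -
      have v12: "(\<lambda>x. fst (v x)) \<in> poly2 p" "(\<lambda>x. snd (v x)) \<in> poly2 p" using v by (auto simp: vpoly2_iff)
      note C12 = poly2_continuous[OF v12(1)] poly2_continuous[OF v12(2)]
      have sq: "(\<lambda>x. inner (v x) (v x)) = (\<lambda>x. (fst (v x))\<^sup>2 + (snd (v x))\<^sup>2)"
        by (simp add: inner_prod_def power2_eq_square)
      have "edge_int e (\<lambda>x. inner (v x) (v x)) \<le> K / (\<kappa> * h) * ?vv" if e: "e \<in> edges_of V" for e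
      proof -
        have "edge_int e (\<lambda>x. inner (v x) (v x)) = edge_int e (\<lambda>x. (fst (v x))\<^sup>2) + edge_int e (\<lambda>x. (snd (v x))\<^sup>2)"
          unfolding sq using e by (intro edge_int_add econt_continuous continuous_on_power C12 edges_card)
        also have "\<dots> \<le> K / (\<kappa> * h) * integral (tri V) (\<lambda>x. (fst (v x))\<^sup>2) + K / (\<kappa> * h) * integral (tri V) (\<lambda>x. (snd (v x))\<^sup>2)"
          by (intro add_mono K(2)[OF reg \<kappa> h e] v12)
        also have "\<dots> = K / (\<kappa> * h) * (integral (tri V) (\<lambda>x. (fst (v x))\<^sup>2) + integral (tri V) (\<lambda>x. (snd (v x))\<^sup>2))"
          by (simp only: distrib_left)
        also have "integral (tri V) (\<lambda>x. (fst (v x))\<^sup>2) + integral (tri V) (\<lambda>x. (snd (v x))\<^sup>2) = ?vv"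
          unfolding sq by (intro tri_int_add[symmetric] V continuous_on_power C12)
        finally show ?thesis .
      qed
      then have "bd_int V (\<lambda>e x. inner (v x) (v x)) \<le> real (card (edges_of V)) * (K / (\<kappa> * h) * ?vv)"
        unfolding bd_int_def by (intro sum_bounded_above) auto
      moreover have "card (edges_of V) = 3"
      proof -
        obtain a b c where "V = {a, b, c}" "a \<noteq> b" "b \<noteq> c" "a \<noteq> c" using V by (rule is_tri_cases)
        then have "real (card (edges_of V)) = 3" using sum_edges_of_tri[of a b c "\<lambda>_. 1"] by simp
        then show ?thesis by simp
      qed
      ultimately show ?thesis by (simp add: \<theta>_def)
    qed
    then have "\<theta> / 2 * ?b + 1 / (2 * \<theta>) * bd_int V (\<lambda>e x. inner (v x) (v x)) \<le> \<theta> / 2 * ?b + 1 / (2 * \<theta>) * (\<theta> * ?vv)"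
      using \<theta> by (intro add_left_mono mult_left_mono) auto
    finally have "?vv \<le> \<theta> / 2 * ?b + 1 / (2 * \<theta>) * (\<theta> * ?vv)" .
    then have "?vv \<le> \<theta> * ?b" using \<theta> by simp
    also have "\<theta> * ?b \<le> (3 * K) / (\<kappa> * c1) * (\<tau> * ?b)"
    proof -
      have "1 / h \<le> \<tau> / c1" using \<tau> c1 by (simp add: field_simps)
      then have "3 * K / \<kappa> * (1 / h) \<le> 3 * K / \<kappa> * (\<tau> / c1)" using K(1) \<kappa> by (intro mult_left_mono) auto
      then have "\<theta> \<le> (3 * K) / (\<kappa> * c1) * \<tau>" by (simp add: \<theta>_def)
      from mult_right_mono[OF this b0] show ?thesis by (simp add: mult.assoc)
    qed
    finally have vv: "?vv \<le> (3 * K) / (\<kappa> * c1) * (\<tau> * ?b)" .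
    have \<tau>0: "\<tau> > 0" using \<tau> c1 h by (smt (verit) divide_pos_pos)
    \<comment> \<open>\<open>grad U = v - Q\<close>, and the square of a difference is at most twice
      the sum of the squares.\<close>
    have "integral (tri V) (\<lambda>x. inner (grad U x) (grad U x)) \<le> integral (tri V) (\<lambda>x. 2 * inner (v x) (v x) + 2 * inner (Q x) (Q x))"
    proof (intro tri_int_mono V continuous_intros C)
      fix x
      have "0 \<le> inner (v x + Q x) (v x + Q x)" by simp
      then show "inner (grad U x) (grad U x) \<le> 2 * inner (v x) (v x) + 2 * inner (Q x) (Q x)"
        by (simp add: v_def inner_add_left inner_add_right inner_commute)
    qed
    also have "\<dots> = 2 * ?vv + 2 * ?QQ"
      by (subst tri_int_add) (auto intro!: V continuous_intros C)
    also have "\<dots> \<le> 2 * ((3 * K) / (\<kappa> * c1) * (\<tau> * ?b)) + 2 * ?QQ" using vv by simp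
    also have "\<dots> \<le> (2 + (6 * K) / (\<kappa> * c1)) * (?QQ + \<tau> * ?b)"
    proof -
      have "0 \<le> (6 * K) / (\<kappa> * c1) * ?QQ" "0 \<le> \<tau> * ?b" using K(1) \<kappa> c1 QQ0 \<tau>0 b0 by simp_all
      then show ?thesis by (simp add: algebra_simps)
    qed
    finally show ?thesis .
  qed
  moreover have "6 * K > 0" using K(1) by simp
  ultimately show ?thesis by blast
qed

section \<open>Lagrange nodes and conforming meshes\<close>

text \<open>\<open>nodes\<close> treats the triangle as an unordered set, so its witnesses may come
  in any of six orders. Permuting the weights brings them to the given one.\<close>

lemma nodes_tri_cases:
  assumes V: "is_tri {a, b, c}" and z: "z \<in> nodes p {a, b, c}" and p: "p > 0"
  obtains i j where "i + j \<le> p" "z = amap a b c (real i / real p, real j / real p)"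
proof -
  from z obtain a' b' c' i j k where e: "{a, b, c} = {a', b', c'}" and s: "i + j + k = p"
    and z': "z = (real i / real p) *\<^sub>R a' + (real j / real p) *\<^sub>R b' + (real k / real p) *\<^sub>R c'"
    unfolding nodes_def by blast
  have d: "a \<noteq> b \<and> b \<noteq> c \<and> a \<noteq> c" using V by (rule is_tri_distinct)
  have d': "a' \<noteq> b' \<and> b' \<noteq> c' \<and> a' \<noteq> c'" using V unfolding e by (rule is_tri_distinct)
  have "a' \<in> {a, b, c}" "b' \<in> {a, b, c}" "c' \<in> {a, b, c}" using e by simp_all
  with d d' consider "a' = a" "b' = b" "c' = c" | "a' = a" "b' = c" "c' = b" | "a' = b" "b' = a" "c' = c"
    | "a' = b" "b' = c" "c' = a" | "a' = c" "b' = a" "c' = b" | "a' = c" "b' = b" "c' = a"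
    by auto
  then obtain i1 j1 k1 where s1: "i1 + j1 + k1 = p"
    and z1: "z = (real i1 / real p) *\<^sub>R a + (real j1 / real p) *\<^sub>R b + (real k1 / real p) *\<^sub>R c"
  proof cases
    case 1 with s z' that show ?thesis by blast
  next
    case 2 with s z' that[of i k j] show ?thesis by (simp add: ac_simps)
  next
    case 3 with s z' that[of j i k] show ?thesis by (simp add: ac_simps)
  next
    case 4 with s z' that[of k i j] show ?thesis by (simp add: ac_simps)
  next
    case 5 with s z' that[of j k i] show ?thesis by (simp add: ac_simps)
  next
    case 6 with s z' that[of k j i] show ?thesis by (simp add: ac_simps)
  qed
  have "real i1 + real j1 + real k1 = real p" unfolding s1[symmetric] by simp
  then have "real i1 / real p + real j1 / real p + real k1 / real p = 1"
    using p by (simp add: add_divide_distrib[symmetric])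
  then have i1: "real i1 / real p = 1 - real j1 / real p - real k1 / real p" by linarith
  have "z = amap a b c (real j1 / real p, real k1 / real p)"
    unfolding z1 i1 by (simp add: amap_def algebra_simps)
  with s1 that[of j1 k1] show ?thesis by simp
qed

lemma nodes_subset_tri:
  assumes "is_tri V" "z \<in> nodes p V" "p > 0"
  shows "z \<in> tri V"
proof -
  obtain a b c where abc: "V = {a, b, c}" using assms(1) by (rule is_tri_cases)
  obtain i j where ij: "i + j \<le> p" "z = amap a b c (real i / real p, real j / real p)"
    using nodes_tri_cases[OF assms[unfolded abc]] .
  have "real i / real p + real j / real p \<le> 1"
    using ij(1) assms(3) by (simp add: add_divide_distrib[symmetric] flip: of_nat_add)
  then show ?thesis unfolding abc tri_amap ij(2) by (auto simp: ref_tri_def)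
qed

lemma poly2_zero_on_nodes:
  assumes V: "is_tri V" and p: "p > 0" and f: "f \<in> poly2 p" and z: "\<And>z. z \<in> nodes p V \<Longrightarrow> f z = 0"
  shows "f x = 0"
proof -
  obtain a b c where abc: "V = {a, b, c}" and D: "det2 (b - a) (c - a) \<noteq> 0"
    using V by (rule is_tri_cases)
  have "f (amap a b c y) = 0" for y
  proof (rule poly2_zero_on_scaled_grid[OF poly2_amap[OF f]])
    show "1 / real p \<noteq> 0" using p by simp
    fix i j assume "i + j \<le> p"
    from amap_in_nodes[OF this p, of a b c] show "f (amap a b c (1 / real p * real i, 1 / real p * real j)) = 0"
      using z unfolding abc by simp
  qed
  from this[of "acoord a b c x"] show ?thesis by (simp add: amap_acoord[OF D])
qed

text \<open>Nodes and monomials are both indexed by \<open>exps p\<close>, so the interpolation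
  system is square and unisolvence makes it solvable. With uniqueness the description in
  \<open>interp\<close> is meaningful.\<close>

lemma interp_spec:
  assumes V: "is_tri V" and p: "p > 0"
  shows "interp p V g \<in> poly2 p \<and> (\<forall>z\<in>nodes p V. interp p V g z = g z)"
proof -
  obtain a b c where abc: "V = {a, b, c}" and D: "det2 (b - a) (c - a) \<noteq> 0"
    using V by (rule is_tri_cases)
  define nd where "nd k = amap a b c (real (fst k) / real p, real (snd k) / real p)" for k :: "nat \<times> nat"
  have nodes: "\<exists>k\<in>exps p. z = nd k" if z: "z \<in> nodes p V" for z
  proof -
    obtain i j where "i + j \<le> p" "z = amap a b c (real i / real p, real j / real p)"
      using nodes_tri_cases[OF V[unfolded abc] z[unfolded abc] p] .
    then show ?thesis by (intro bexI[of _ "(i, j)"]) (auto simp: nd_def in_exps)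
  qed
  have "\<exists>x. \<forall>i\<in>exps p. (\<Sum>j\<in>exps p. monom2 j (nd i) * x j) = g (nd i)"
  proof (rule square_system_solvable[OF finite_exps])
    fix x assume "\<forall>i\<in>exps p. (\<Sum>j\<in>exps p. monom2 j (nd i) * x j) = 0"
    then have "\<forall>i\<in>exps p. pol p x (nd i) = 0" by (simp add: pol_def mult.commute)
    then have "pol p x z = 0" if "z \<in> nodes p V" for z using nodes[OF that] by force
    then have "pol p x y = 0" for y by (rule poly2_zero_on_nodes[OF V p pol_poly2])
    then have "pol p x = (\<lambda>y. 0)" by blast
    then show "\<forall>j\<in>exps p. x j = 0" by (simp add: pol_zero_iff)
  qed
  then obtain x where "\<forall>i\<in>exps p. pol p x (nd i) = g (nd i)" by (auto simp: pol_def mult.commute)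
  then have x: "\<forall>z\<in>nodes p V. pol p x z = g z" using nodes by force
  have "interp p V g = pol p x" unfolding interp_def
  proof (rule the_equality)
    show "pol p x \<in> poly2 p \<and> (\<forall>z\<in>nodes p V. pol p x z = g z)" using x pol_poly2 by blast
    fix P assume P: "P \<in> poly2 p \<and> (\<forall>z\<in>nodes p V. P z = g z)"
    then have PP: "(\<lambda>y. P y - pol p x y) \<in> poly2 p" using pol_poly2 by (intro poly2_diff) auto
    have "P y - pol p x y = 0" for y by (rule poly2_zero_on_nodes[OF V p PP]) (use P x in auto)
    then show "P = pol p x" by auto
  qed
  with x pol_poly2 show ?thesis by auto
qed

lemma acoord_rotate:
  assumes "det2 (b - a) (c - a) \<noteq> 0"
  shows "acoord b c a x = (snd (acoord a b c x), 1 - fst (acoord a b c x) - snd (acoord a b c x))"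
proof -
  let ?D = "det2 (b - a) (c - a)"
  have D: "det2 (c - b) (a - b) = ?D" by (simp add: det2_def algebra_simps)
  have 1: "det2 (x - b) (a - b) = det2 (b - a) (x - a)" by (simp add: det2_def algebra_simps)
  have 2: "det2 (c - b) (x - b) = ?D - det2 (x - a) (c - a) - det2 (b - a) (x - a)"
    by (simp add: det2_def algebra_simps)
  show ?thesis using assms unfolding acoord_def D 1 2 by (simp add: diff_divide_distrib)
qed

lemma acoord_swap: "acoord a c b x = (snd (acoord a b c x), fst (acoord a b c x))"
proof -
  have "det2 (c - a) (b - a) = - det2 (b - a) (c - a)" "det2 (x - a) (b - a) = - det2 (b - a) (x - a)"
    "det2 (c - a) (x - a) = - det2 (x - a) (c - a)"
    by (simp_all add: det2_def)
  then show ?thesis unfolding acoord_def by (simp only: minus_divide_divide fst_conv snd_conv)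
qed

lemma det2_rotate: "det2 (c - b) (a - b) = det2 (b - a) (c - a)"
  by (simp add: det2_def algebra_simps)

lemma acoord_affine:
  "acoord a b c (u *\<^sub>R x + v *\<^sub>R y) = u *\<^sub>R acoord a b c x + v *\<^sub>R acoord a b c y" if "u + v = 1"
proof -
  have u: "u = 1 - v" using that by simp
  have "det2 (u *\<^sub>R x + v *\<^sub>R y - a) w = u * det2 (x - a) w + v * det2 (y - a) w"
    "det2 w (u *\<^sub>R x + v *\<^sub>R y - a) = u * det2 w (x - a) + v * det2 w (y - a)" for w
    unfolding u by (simp_all add: det2_def algebra_simps)
  then show ?thesis by (simp add: acoord_def add_divide_distrib)
qed

lemma acoord_vertices:
  assumes "det2 (b - a) (c - a) \<noteq> 0"
  shows "acoord a b c a = (0, 0)" "acoord a b c b = (1, 0)" "acoord a b c c = (0, 1)"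
  using assms by (auto simp: acoord_def det2_def)

text \<open>The coordinate at \<open>c\<close> is affine and vanishes at \<open>a\<close> and
  \<open>b\<close>. Used in the contrapositive: a point where it is nonzero lies on no face that
  omits \<open>c\<close>.\<close>

lemma hull_avoiding_vertex:
  assumes D: "det2 (b - a) (c - a) \<noteq> 0" and F: "F \<subseteq> {a, b}" and x: "x \<in> convex hull F"
  shows "snd (acoord a b c x) = 0"
proof -
  have "convex hull F \<subseteq> {x. snd (acoord a b c x) = 0}"
  proof (rule hull_minimal)
    show "F \<subseteq> {x. snd (acoord a b c x) = 0}" using F acoord_vertices[OF D] by auto
    show "convex {x. snd (acoord a b c x) = 0}"
      unfolding convex_def by (auto simp: acoord_affine)
  qed
  with x show ?thesis by auto
qed

definition tri_mesh :: "pt set set \<Rightarrow> bool" where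
  "tri_mesh \<T> \<longleftrightarrow> finite \<T> \<and> (\<forall>V\<in>\<T>. is_tri V) \<and>
     (\<forall>V\<in>\<T>. \<forall>W\<in>\<T>. V \<noteq> W \<longrightarrow> tri V \<inter> tri W = convex hull (V \<inter> W))"

lemma conforming_tri_mesh: "conforming \<Omega> \<T> \<Longrightarrow> tri_mesh \<T>"
  by (simp add: conforming_def tri_mesh_def)

lemma tri_mesh_is_tri: "tri_mesh \<T> \<Longrightarrow> V \<in> \<T> \<Longrightarrow> is_tri V"
  by (simp add: tri_mesh_def)

lemma tri_mesh_Int:
  "tri_mesh \<T> \<Longrightarrow> V \<in> \<T> \<Longrightarrow> W \<in> \<T> \<Longrightarrow> V \<noteq> W \<Longrightarrow> tri V \<inter> tri W = convex hull (V \<inter> W)"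
  by (simp add: tri_mesh_def)

text \<open>Otherwise the intersection of the two triangles would be a face without
  \<open>c\<close>. The facts below about shared vertices, edges and interiors follow by putting one
  vertex after another in the last place.\<close>

lemma tri_mesh_vertex_mem:
  assumes T: "tri_mesh \<T>" and V: "V \<in> \<T>" "{a, b, c} \<in> \<T>" and x: "x \<in> tri V" "x \<in> tri {a, b, c}"
    and nz: "snd (acoord a b c x) \<noteq> 0"
  shows "c \<in> V"
proof (rule ccontr)
  assume c: "c \<notin> V"
  then have "V \<noteq> {a, b, c}" by auto
  then have "tri V \<inter> tri {a, b, c} = convex hull (V \<inter> {a, b, c})" by (rule tri_mesh_Int[OF T V])
  with x have "x \<in> convex hull (V \<inter> {a, b, c})" by blast
  moreover have "V \<inter> {a, b, c} \<subseteq> {a, b}" using c by auto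
  moreover have "det2 (b - a) (c - a) \<noteq> 0" by (rule is_tri_det2[OF tri_mesh_is_tri[OF T V(2)]])
  ultimately show False using nz hull_avoiding_vertex by blast
qed

lemma tri_mesh_vertex_in_tri:
  assumes T: "tri_mesh \<T>" and V: "V \<in> \<T>" "W \<in> \<T>" and z: "z \<in> W" "z \<in> tri V"
  shows "z \<in> V"
proof -
  obtain a b where W: "W = {a, b, z}"
  proof -
    obtain u v w where "W = {u, v, w}" using tri_mesh_is_tri[OF T V(2)] by (rule is_tri_cases)
    with z(1) have "W = {v, w, z} \<or> W = {u, w, z} \<or> W = {u, v, z}" by auto
    with that show ?thesis by blast
  qed
  have D: "det2 (b - a) (z - a) \<noteq> 0" using is_tri_det2 tri_mesh_is_tri[OF T V(2)] unfolding W by blast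
  show ?thesis
    by (rule tri_mesh_vertex_mem[OF T V(1) _ z(2)])
      (use V(2) W acoord_vertices(3)[OF D] in \<open>auto simp: tri_def hull_inc\<close>)
qed

lemma tri_mesh_edge_in_tri:
  assumes T: "tri_mesh \<T>" and V: "V \<in> \<T>" "W \<in> \<T>" and e: "e \<in> edges_of W"
    and x: "x \<in> seg e" "x \<notin> e" "x \<in> tri V"
  shows "e \<in> edges_of V"
proof -
  obtain a b c where abc: "W = {a, b, c}" "e = {a, b}" "a \<noteq> b" and D: "det2 (b - a) (c - a) \<noteq> 0"
    using tri_mesh_is_tri[OF T V(2)] e by (rule edges_of_third_vertex)
  obtain t where t: "x = (1 - t) *\<^sub>R a + t *\<^sub>R b" "0 \<le> t" "t \<le> 1"
    using x(1) by (auto simp: abc seg_doubleton in_segment)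
  have t01: "t \<noteq> 0" "t \<noteq> 1" using t x(2) abc(2) by auto
  have xW: "x \<in> tri W"
    using x(1) hull_mono[of e W convex] abc by (auto simp: seg_def tri_def)
  have ac: "acoord a b c x = (t, 0)"
    unfolding t(1) by (subst acoord_affine) (auto simp: acoord_vertices[OF D])
  have "a \<in> V"
  proof (rule tri_mesh_vertex_mem[OF T V(1) _ x(3)])
    show "{b, c, a} \<in> \<T>" "x \<in> tri {b, c, a}" using V(2) abc(1) xW by (auto simp: insert_commute)
    show "snd (acoord b c a x) \<noteq> 0" using t01 by (simp add: acoord_rotate[OF D] ac)
  qed
  moreover have "b \<in> V"
  proof (rule tri_mesh_vertex_mem[OF T V(1) _ x(3)])
    show "{a, c, b} \<in> \<T>" "x \<in> tri {a, c, b}" using V(2) abc(1) xW by (auto simp: insert_commute)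
    show "snd (acoord a c b x) \<noteq> 0" using t01 by (simp add: acoord_swap[of a c b] ac)
  qed
  ultimately show ?thesis using abc by (auto simp: edges_of_def)
qed

lemma tri_mesh_inner_point:
  assumes T: "tri_mesh \<T>" and V: "{a, b, c} \<in> \<T>" "W \<in> \<T>"
    and pos: "fst (acoord a b c x) > 0" "snd (acoord a b c x) > 0" "fst (acoord a b c x) + snd (acoord a b c x) < 1"
    and x: "x \<in> tri W"
  shows "W = {a, b, c}"
proof -
  have tr: "is_tri {a, b, c}" "is_tri W" using T V by (auto intro: tri_mesh_is_tri)
  have D: "det2 (b - a) (c - a) \<noteq> 0" using tr(1) by (rule is_tri_det2)
  have xV: "x \<in> tri {a, b, c}" using pos by (auto simp: tri_acoord[OF D] ref_tri_def)
  have perm: "{b, c, a} = {a, b, c}" "{a, c, b} = {a, b, c}" by auto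
  have "c \<in> W" by (rule tri_mesh_vertex_mem[OF T V(2,1) x xV]) (use pos in auto)
  moreover have "a \<in> W"
    by (rule tri_mesh_vertex_mem[OF T V(2) _ x, of b c]) (use V xV pos in \<open>auto simp: perm acoord_rotate[OF D]\<close>)
  moreover have "b \<in> W"
    by (rule tri_mesh_vertex_mem[OF T V(2) _ x, of a c]) (use V xV pos in \<open>auto simp: perm acoord_swap[of a c b]\<close>)
  ultimately have "{a, b, c} \<subseteq> W" by simp
  moreover have "card {a, b, c} = card W" using tr by (simp only: is_tri_def)
  ultimately show ?thesis using card_subset_eq[OF is_tri_finite[OF tr(2)]] by metis
qed

text \<open>An interior point can be moved a little in every direction. Moving against each
  coordinate and against their sum makes the three inequalities strict.\<close>

lemma interior_tri:
  assumes D: "det2 (b - a) (c - a) \<noteq> 0"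
  shows "x \<in> interior (tri {a, b, c}) \<longleftrightarrow>
    fst (acoord a b c x) > 0 \<and> snd (acoord a b c x) > 0 \<and> fst (acoord a b c x) + snd (acoord a b c x) < 1"
proof -
  let ?O = "{x. fst (acoord a b c x) > 0} \<inter> {x. snd (acoord a b c x) > 0} \<inter> {x. fst (acoord a b c x) + snd (acoord a b c x) < 1}"
  have fC: "continuous_on UNIV (\<lambda>x. fst (acoord a b c x))" and sC: "continuous_on UNIV (\<lambda>x. snd (acoord a b c x))"
    by (intro continuous_intros continuous_on_acoord)+
  have "open ?O"
    by (intro open_Int open_Collect_less continuous_intros fC sC)
  moreover have "?O \<subseteq> tri {a, b, c}" by (auto simp: tri_acoord[OF D] ref_tri_def)
  ultimately have 1: "?O \<subseteq> interior (tri {a, b, c})" by (rule interior_maximal[rotated])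
  have shift: "acoord a b c (x + r *\<^sub>R (amap a b c k - a)) = acoord a b c x + r *\<^sub>R k" for r k x
  proof -
    have "x + r *\<^sub>R (amap a b c k - a) = amap a b c (acoord a b c x) + r *\<^sub>R (amap a b c k - a)"
      by (simp add: amap_acoord[OF D])
    also have "\<dots> = amap a b c (acoord a b c x + r *\<^sub>R k)" by (simp add: amap_def algebra_simps)
    finally show ?thesis by (simp add: acoord_amap[OF D])
  qed
  have 2: "\<exists>r>0. acoord a b c x + r *\<^sub>R k \<in> ref_tri" if x: "x \<in> interior (tri {a, b, c})" for x k
  proof -
    have "((\<lambda>r. x + r *\<^sub>R (amap a b c k - a)) \<longlongrightarrow> x + 0 *\<^sub>R (amap a b c k - a)) (at_right 0)"
      by (intro tendsto_intros)
    then have "\<forall>\<^sub>F r in at_right 0. x + r *\<^sub>R (amap a b c k - a) \<in> interior (tri {a, b, c})"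
      using x by (intro topological_tendstoD) auto
    then have "\<forall>\<^sub>F r in at_right 0. r > 0 \<and> acoord a b c x + r *\<^sub>R k \<in> ref_tri"
      using eventually_at_right_less[of 0]
    proof eventually_elim
      case (elim r)
      then have "x + r *\<^sub>R (amap a b c k - a) \<in> tri {a, b, c}" using interior_subset by blast
      then show ?case using elim by (simp add: tri_acoord[OF D] shift)
    qed
    then show ?thesis using eventually_happens[of _ "at_right (0::real)"] by auto
  qed
  have "x \<in> ?O" if x: "x \<in> interior (tri {a, b, c})"
  proof -
    obtain r1 r2 r3 where r: "r1 > 0" "acoord a b c x + r1 *\<^sub>R (-1, 0) \<in> ref_tri"
       "r2 > 0" "acoord a b c x + r2 *\<^sub>R (0, -1) \<in> ref_tri"
       "r3 > 0" "acoord a b c x + r3 *\<^sub>R (1, 0) \<in> ref_tri"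
      using 2[OF x] by metis
    then show ?thesis by (auto simp: ref_tri_def)
  qed
  with 1 show ?thesis by blast
qed

lemma segment_nodes:
  assumes V: "is_tri V" and ab: "a \<in> V" "b \<in> V" "a \<noteq> b" and i: "i \<le> p" "p > 0"
  shows "a + (real i / real p) *\<^sub>R (b - a) \<in> nodes p V"
proof -
  have "{a, b} \<in> edges_of V" using ab by (auto simp: edges_of_def)
  with V obtain a' b' c where abc: "V = {a', b', c}" "{a, b} = {a', b'}" by (metis edges_of_third_vertex)
  then have "V = {a, b, c}" by (auto simp: doubleton_eq_iff)
  then show ?thesis using amap_in_nodes[of i 0 p a b c] i by (simp add: amap_def)
qed

text \<open>A segment carries \<open>p + 1\<close> nodes, enough to determine a polynomial of degree
  \<open>p\<close> along it.\<close>

lemma poly2_agree_on_segment: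
  assumes P: "P \<in> poly2 p" "R \<in> poly2 p" and p: "p > 0"
    and eq: "\<And>i. i \<le> p \<Longrightarrow> P (a + (real i / real p) *\<^sub>R (b - a)) = R (a + (real i / real p) *\<^sub>R (b - a))"
  shows "P (a + t *\<^sub>R (b - a)) = R (a + t *\<^sub>R (b - a))"
proof -
  have "(\<lambda>x. P x - R x) \<in> poly2 p" using P by (rule poly2_diff)
  from poly2_along_line[OF this, of a "b - a"] obtain d
    where d: "\<And>t. P (a + t *\<^sub>R (b - a)) - R (a + t *\<^sub>R (b - a)) = (\<Sum>k\<le>p. d k * t ^ k)" by blast
  have "\<forall>k\<le>p. d k = 0"
  proof (rule polyfun_zero_at_points)
    show "inj_on (\<lambda>i. real i / real p) {..p}" using p by (auto simp: inj_on_def)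
    fix i assume "i \<le> p"
    from eq[OF this] show "(\<Sum>k\<le>p. d k * (real i / real p) ^ k) = 0" unfolding d[symmetric] by simp
  qed
  then show ?thesis using d[of t] by simp
qed

text \<open>Continuity of the Lagrange interpolant: \<open>IW\<close> evaluates on an arbitrarily
  chosen triangle, and on a common face both interpolants are determined by the nodes of that
  face.\<close>

lemma IW_eq_interp:
  assumes T: "tri_mesh \<T>" and p: "p > 0" and V: "V \<in> \<T>" and x: "x \<in> tri V"
  shows "IW p \<tau> \<T> m x = interp p V (nodal_val p \<tau> \<T> m) x"
proof -
  let ?g = "nodal_val p \<tau> \<T> m"
  define W where "W = (SOME V. V \<in> \<T> \<and> x \<in> tri V)"
  have W: "W \<in> \<T> \<and> x \<in> tri W" unfolding W_def by (rule someI[of _ V]) (use V x in auto)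
  have IW: "IW p \<tau> \<T> m x = interp p W ?g x" unfolding IW_def W_def using V x by auto
  have tr: "is_tri V" "is_tri W" using T V W by (auto intro: tri_mesh_is_tri)
  note sV = interp_spec[OF tr(1) p, of ?g] and sW = interp_spec[OF tr(2) p, of ?g]
  show ?thesis
  proof (cases "V = W")
    case False
    then have xF: "x \<in> convex hull (V \<inter> W)" using tri_mesh_Int[OF T V, of W] W x by blast
    obtain v where v: "v \<in> V" "v \<notin> W"
    proof -
      have "\<not> V \<subseteq> W"
        using False card_subset_eq[OF is_tri_finite[OF tr(2)], of V] tr unfolding is_tri_def by metis
      with that show ?thesis by blast
    qed
    have "card (V - {v}) = 2" using v tr(1) by (simp add: is_tri_def)
    then obtain a b where ab: "V - {v} = {a, b}" "a \<noteq> b" by (auto simp: card_2_iff)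
    then have F: "V \<inter> W \<subseteq> {a, b}" "a \<in> V" "b \<in> V" using v by auto
    \<comment> \<open>The common face misses the vertex \<open>v\<close>, so it is empty, a single
      vertex or the edge opposite to \<open>v\<close>.\<close>
    consider "V \<inter> W = {}" | y where "V \<inter> W = {y}" | "V \<inter> W = {a, b}" using F(1) by blast
    then show ?thesis
    proof cases
      case 1
      with xF show ?thesis by simp
    next
      case 2
      with xF have xy: "x \<in> V" "x \<in> W" by auto
      obtain y where y: "y \<in> V" "x \<noteq> y" using ab F by blast
      obtain y' where y': "y' \<in> W" "x \<noteq> y'"
      proof -
        obtain a b c where "W = {a, b, c}" "a \<noteq> b" using tr(2) by (rule is_tri_cases)
        with that[of a] that[of b] show ?thesis by blast
      qed
      have "x \<in> nodes p V" using segment_nodes[OF tr(1) xy(1) y(1) y(2), of 0 p] p by simp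
      moreover have "x \<in> nodes p W" using segment_nodes[OF tr(2) xy(2) y'(1) y'(2), of 0 p] p by simp
      ultimately show ?thesis using sV sW IW by simp
    next
      case 3
      then have abW: "a \<in> W" "b \<in> W" by auto
      obtain t where t: "x = (1 - t) *\<^sub>R a + t *\<^sub>R b"
        using xF unfolding 3 by (auto simp: segment_convex_hull[symmetric] in_segment)
      then have t': "x = a + t *\<^sub>R (b - a)" by (simp add: algebra_simps)
      have "interp p W ?g (a + t *\<^sub>R (b - a)) = interp p V ?g (a + t *\<^sub>R (b - a))"
      proof (rule poly2_agree_on_segment[OF _ _ p])
        fix i assume "i \<le> p"
        then show "interp p W ?g (a + (real i / real p) *\<^sub>R (b - a)) = interp p V ?g (a + (real i / real p) *\<^sub>R (b - a))"
          using sV sW segment_nodes[OF tr(1) F(2,3) ab(2) _ p] segment_nodes[OF tr(2) abW ab(2) _ p] by simp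
      qed (use sV sW in auto)
      then show ?thesis using IW t' by simp
    qed
  qed (use IW in simp)
qed

section \<open>Vertex stars and boundary edges\<close>

definition vcone :: "pt \<Rightarrow> pt set \<Rightarrow> pt set" where
  "vcone z V = {z + r *\<^sub>R (y - z) | r y. 0 \<le> r \<and> y \<in> tri V}"

lemma amap_ray: "z + r *\<^sub>R (amap z b c k - z) = amap z b c (r *\<^sub>R k)"
  by (simp add: amap_def algebra_simps)

lemma vcone_iff:
  assumes D: "det2 (b - z) (c - z) \<noteq> 0"
  shows "x \<in> vcone z {z, b, c} \<longleftrightarrow> 0 \<le> fst (acoord z b c x) \<and> 0 \<le> snd (acoord z b c x)"
proof
  assume "x \<in> vcone z {z, b, c}"
  then obtain r k where rk: "0 \<le> r" "k \<in> ref_tri" "x = z + r *\<^sub>R (amap z b c k - z)"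
    unfolding vcone_def tri_amap by blast
  then show "0 \<le> fst (acoord z b c x) \<and> 0 \<le> snd (acoord z b c x)"
    by (simp add: amap_ray acoord_amap[OF D] ref_tri_def)
next
  define k where "k = acoord z b c x"
  assume "0 \<le> fst (acoord z b c x) \<and> 0 \<le> snd (acoord z b c x)"
  then have k: "0 \<le> fst k" "0 \<le> snd k" by (auto simp: k_def)
  \<comment> \<open>The \<open>+ 1\<close> keeps \<open>r\<close> positive at the apex too, where
    both coordinates are 0.\<close>
  define r where "r = fst k + snd k + 1"
  have r: "r > 0" using k by (simp add: r_def)
  have "(fst k + snd k) / r \<le> 1" using r by (subst divide_le_eq_1_pos) (auto simp: r_def)
  then have "(1 / r) *\<^sub>R k \<in> ref_tri" using k r by (auto simp: ref_tri_def add_divide_distrib)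
  then have "amap z b c ((1 / r) *\<^sub>R k) \<in> tri {z, b, c}" by (auto simp: tri_amap)
  moreover have "x = z + r *\<^sub>R (amap z b c ((1 / r) *\<^sub>R k) - z)"
    unfolding amap_ray using r by (simp add: k_def amap_acoord[OF D])
  ultimately show "x \<in> vcone z {z, b, c}" unfolding vcone_def using r less_imp_le by blast
qed

lemma is_tri_vertex_cases:
  assumes "is_tri V" "z \<in> V"
  obtains b c where "V = {z, b, c}" "det2 (b - z) (c - z) \<noteq> 0"
proof -
  obtain u v w where V: "V = {u, v, w}" using assms(1) by (rule is_tri_cases)
  with assms(2) have "V = {z, v, w} \<or> V = {z, u, w} \<or> V = {z, u, v}" by auto
  then obtain b c where "V = {z, b, c}" by blast
  with that assms(1) is_tri_det2 show ?thesis by blast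
qed

text \<open>If both third vertices lay on the same side of the common edge, the triangles would
  overlap near \<open>z\<close>, and a point interior to one of them and contained in the other
  would make them equal.\<close>

lemma adjacent_opposite_side:
  assumes T: "tri_mesh \<T>" and V: "{z, b, c} \<in> \<T>" "{z, b, c'} \<in> \<T>" "{z, b, c} \<noteq> {z, b, c'}"
  shows "snd (acoord z b c c') < 0"
proof -
  have D: "det2 (b - z) (c - z) \<noteq> 0" "det2 (b - z) (c' - z) \<noteq> 0"
    using is_tri_det2 tri_mesh_is_tri[OF T] V(1,2) by blast+
  define \<alpha> \<beta> where "\<alpha> = fst (acoord z b c c')" and "\<beta> = snd (acoord z b c c')"
  have \<beta>0: "\<beta> \<noteq> 0" using D by (simp add: \<beta>_def acoord_def)
  have c': "c' = amap z b c (\<alpha>, \<beta>)" by (simp add: \<alpha>_def \<beta>_def amap_acoord[OF D(1)])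
  have False if \<beta>: "\<beta> > 0"
  proof -
    \<comment> \<open>\<open>K\<close> tilts the direction towards the common edge far enough that
      \<open>K + \<alpha>\<close> is positive. \<open>\<epsilon>\<close> then shortens it until the
      coordinate sums in both triangles are below 1.\<close>
    define K where "K = \<bar>\<alpha>\<bar> + 1"
    define \<epsilon> where "\<epsilon> = 1 / (K + \<bar>\<alpha>\<bar> + \<beta> + 2)"
    define x where "x = amap z b c' (\<epsilon> * K, \<epsilon>)"
    have den: "K + \<bar>\<alpha>\<bar> + \<beta> + 2 > 0" using \<beta> by (simp add: K_def)
    have \<epsilon>: "\<epsilon> > 0" using den by (simp add: \<epsilon>_def)
    have \<epsilon>1: "\<epsilon> * (K + \<bar>\<alpha>\<bar> + \<beta> + 2) = 1" using den by (simp add: \<epsilon>_def)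
    have x: "x = amap z b c (\<epsilon> * (K + \<alpha>), \<epsilon> * \<beta>)"
      unfolding x_def amap_def[of z b c'] unfolding c' by (simp add: amap_def algebra_simps)
    have xc: "acoord z b c x = (\<epsilon> * (K + \<alpha>), \<epsilon> * \<beta>)" unfolding x by (rule acoord_amap[OF D(1)])
    have xc': "acoord z b c' x = (\<epsilon> * K, \<epsilon>)" unfolding x_def by (rule acoord_amap[OF D(2)])
    have "\<epsilon> * (K + \<alpha> + \<beta>) < \<epsilon> * (K + \<bar>\<alpha>\<bar> + \<beta> + 2)" using \<epsilon> by (intro mult_strict_left_mono) auto
    then have lt1: "\<epsilon> * (K + \<alpha>) + \<epsilon> * \<beta> < 1" using \<epsilon>1 by (simp add: distrib_left)
    have "\<epsilon> * (K + 1) < \<epsilon> * (K + \<bar>\<alpha>\<bar> + \<beta> + 2)" using \<epsilon> \<beta> by (intro mult_strict_left_mono) auto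
    then have lt2: "\<epsilon> * K + \<epsilon> < 1" using \<epsilon>1 by (simp add: distrib_left)
    have K: "K > 0" "K + \<alpha> > 0" by (auto simp: K_def)
    have "x \<in> tri {z, b, c'}" using lt2 \<epsilon> K(1) by (simp add: tri_acoord[OF D(2)] xc' ref_tri_def)
    then have "{z, b, c'} = {z, b, c}"
      by (intro tri_mesh_inner_point[OF T V(1,2), of x]) (use lt1 \<epsilon> \<beta> K(2) in \<open>simp_all add: xc\<close>)
    with V(3) show False by simp
  qed
  with \<beta>0 show ?thesis unfolding \<beta>_def[symmetric] by (metis linorder_neqE_linordered_idom)
qed

text \<open>A set of triangles at \<open>z\<close> without boundary edges at \<open>z\<close> spans cones whose union is both
  open and closed in the punctured plane, so it must contain every triangle at \<open>z\<close>.\<close>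

lemma vertex_star_closed_component:
  assumes T: "tri_mesh \<T>" and D: "D \<subseteq> {V\<in>\<T>. z \<in> V}" "D \<noteq> {}"
    and closed: "\<And>V e. V \<in> D \<Longrightarrow> e \<in> edges_of V \<Longrightarrow> z \<in> e \<Longrightarrow> \<exists>V'\<in>D. V' \<noteq> V \<and> e \<in> edges_of V'"
  shows "D = {V\<in>\<T>. z \<in> V}"
proof -
  have DT: "V \<in> \<T>" "z \<in> V" "is_tri V" if "V \<in> D" for V using D that tri_mesh_is_tri[OF T] by auto
  have finD: "finite D" by (rule finite_subset[OF D(1)]) (use T in \<open>simp add: tri_mesh_def\<close>)
  let ?C = "\<Union>V\<in>D. vcone z V"
  have closedC: "closed (vcone z V)" if V: "V \<in> D" for V
  proof -
    obtain b c where bc: "V = {z, b, c}" "det2 (b - z) (c - z) \<noteq> 0"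
      using DT(3,2)[OF V] by (rule is_tri_vertex_cases)
    have "vcone z V = {x. 0 \<le> fst (acoord z b c x)} \<inter> {x. 0 \<le> snd (acoord z b c x)}"
      unfolding bc(1) using vcone_iff[OF bc(2)] by blast
    then show ?thesis
      by (simp only:) (intro closed_Int closed_Collect_le continuous_intros continuous_on_acoord)
  qed
  \<comment> \<open>On an edge ray the cone of \<open>V\<close> covers one side, and the neighbour
    across the edge, which lies on the opposite side, covers the other.\<close>
  have edge_ray: "\<exists>N. open N \<and> y \<in> N \<and> N \<subseteq> ?C"
    if V: "V \<in> D" and bc: "V = {z, b, c}" "det2 (b - z) (c - z) \<noteq> 0"
      and y: "fst (acoord z b c y) > 0" "snd (acoord z b c y) = 0" for V b c y
  proof -
    have "is_tri {z, b, c}" using DT(3)[OF V] bc(1) by simp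
    then have dis: "z \<noteq> b" using is_tri_distinct by blast
    have "{z, b} \<in> edges_of V" using dis by (simp add: edges_of_def bc)
    then obtain V' where V': "V' \<in> D" "V' \<noteq> V" "{z, b} \<in> edges_of V'" using closed[OF V] by blast
    obtain z1 b1 c' where "V' = {z1, b1, c'}" "{z, b} = {z1, b1}"
      using DT(3)[OF V'(1)] V'(3) by (rule edges_of_third_vertex)
    then have c': "V' = {z, b, c'}" by (auto simp: doubleton_eq_iff)
    have D': "det2 (b - z) (c' - z) \<noteq> 0" using DT(3)[OF V'(1)] unfolding c' by (rule is_tri_det2)
    define \<alpha> \<beta> where "\<alpha> = fst (acoord z b c c')" and "\<beta> = snd (acoord z b c c')"
    have \<beta>: "\<beta> < 0" unfolding \<beta>_def
      by (rule adjacent_opposite_side[OF T]) (use DT(1)[OF V] DT(1)[OF V'(1)] V'(2) bc c' in auto)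
    have c'eq: "c' = amap z b c (\<alpha>, \<beta>)" by (simp add: \<alpha>_def \<beta>_def amap_acoord[OF bc(2)])
    let ?s = "\<lambda>x. fst (acoord z b c x)" and ?t = "\<lambda>x. snd (acoord z b c x)"
    \<comment> \<open>The second condition is positivity of the first coordinate relative to the
      neighbour with third vertex \<open>c'\<close>.\<close>
    define N where "N = {x. 0 < ?s x} \<inter> {x. 0 < ?s x - \<alpha> / \<beta> * ?t x}"
    have "open N" unfolding N_def by (intro open_Int open_Collect_less continuous_intros continuous_on_acoord)
    moreover have "y \<in> N" using y by (simp add: N_def)
    moreover have "N \<subseteq> ?C"
    proof
      fix x assume x: "x \<in> N"
      show "x \<in> ?C"
      proof (cases "?t x \<ge> 0")
        case True
        then have "x \<in> vcone z V" using x unfolding bc(1) by (simp add: vcone_iff[OF bc(2)] N_def)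
        then show ?thesis using V by blast
      next
        case False
        have "amap z b c' (?s x - \<alpha> / \<beta> * ?t x, ?t x / \<beta>) = amap z b c (acoord z b c x)"
        proof -
          have "c' - z = \<alpha> *\<^sub>R (b - z) + \<beta> *\<^sub>R (c - z)" unfolding c'eq by (simp add: amap_def)
          then have "(?t x / \<beta>) *\<^sub>R (c' - z) = (\<alpha> / \<beta> * ?t x) *\<^sub>R (b - z) + ?t x *\<^sub>R (c - z)"
            using \<beta> by (simp add: scaleR_add_right mult.commute)
          then show ?thesis by (simp add: amap_def scaleR_left_diff_distrib)
        qed
        then have "x = amap z b c' (?s x - \<alpha> / \<beta> * ?t x, ?t x / \<beta>)" by (simp add: amap_acoord[OF bc(2)])
        then have "acoord z b c' x = (?s x - \<alpha> / \<beta> * ?t x, ?t x / \<beta>)"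
          using acoord_amap[OF D', of "(?s x - \<alpha> / \<beta> * ?t x, ?t x / \<beta>)"] by simp
        moreover have "0 \<le> ?t x / \<beta>" using False \<beta> by (intro divide_nonpos_neg) auto
        ultimately have "x \<in> vcone z V'" using x unfolding c' by (simp add: vcone_iff[OF D'] N_def)
        then show ?thesis using V'(1) by blast
      qed
    qed
    ultimately show ?thesis by blast
  qed
  have openC: "\<exists>N. open N \<and> y \<in> N \<and> N \<subseteq> ?C" if y: "y \<in> ?C" "y \<noteq> z" for y
  proof -
    obtain V where V: "V \<in> D" "y \<in> vcone z V" using y by blast
    obtain b c where bc: "V = {z, b, c}" "det2 (b - z) (c - z) \<noteq> 0"
      using DT(3,2)[OF V(1)] by (rule is_tri_vertex_cases)
    have "det2 (c - z) (b - z) = - det2 (b - z) (c - z)" by (simp add: det2_def)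
    with bc have bc': "V = {z, c, b}" "det2 (c - z) (b - z) \<noteq> 0" by auto
    let ?s = "fst (acoord z b c y)" and ?t = "snd (acoord z b c y)"
    have st: "0 \<le> ?s" "0 \<le> ?t" using V(2) vcone_iff[OF bc(2)] unfolding bc(1) by blast+
    have "\<not> (?s = 0 \<and> ?t = 0)"
    proof
      assume "?s = 0 \<and> ?t = 0"
      then have "y = z" using amap_acoord[OF bc(2), of y] by (simp add: amap_def)
      with y show False by simp
    qed
    with st consider "?s > 0" "?t > 0" | "?s > 0" "?t = 0" | "?s = 0" "?t > 0" by linarith
    then show ?thesis
    proof cases
      case 1
      let ?N = "{x. 0 < fst (acoord z b c x)} \<inter> {x. 0 < snd (acoord z b c x)}"
      have "open ?N" by (intro open_Int open_Collect_less continuous_intros continuous_on_acoord)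
      moreover have "?N \<subseteq> vcone z V" unfolding bc(1) using vcone_iff[OF bc(2)] by force
      ultimately show ?thesis using 1 V(1) by (intro exI[of _ ?N]) blast
    next
      case 2
      then show ?thesis by (rule edge_ray[OF V(1) bc])
    next
      case 3
      then show ?thesis using acoord_swap[of z c b y] by (intro edge_ray[OF V(1) bc']) simp_all
    qed
  qed
  have "openin (top_of_set (- {z})) (?C - {z})"
  proof -
    have "open (?C - {z})"
    proof (subst open_subopen, intro ballI)
      fix y assume "y \<in> ?C - {z}"
      then obtain N where "open N" "y \<in> N" "N \<subseteq> ?C" using openC[of y] by blast
      then show "\<exists>T. open T \<and> y \<in> T \<and> T \<subseteq> ?C - {z}"
        using \<open>y \<in> ?C - {z}\<close> by (intro exI[of _ "N - {z}"]) auto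
    qed
    then show ?thesis by (intro open_openin_trans) auto
  qed
  moreover have "closedin (top_of_set (- {z})) (?C - {z})"
  proof -
    have "closed ?C" by (intro closed_UN finD ballI closedC)
    then have "closedin (top_of_set (- {z})) (- {z} \<inter> ?C)" by (rule closedin_closed_Int)
    then show ?thesis by (simp add: Diff_eq Int_commute)
  qed
  moreover have "connected (- {z})" by (rule connected_punctured_universe) simp
  ultimately have C: "?C - {z} = {} \<or> ?C - {z} = - {z}" unfolding connected_clopen by blast
  have "?C - {z} \<noteq> {}"
  proof -
    obtain V where V: "V \<in> D" using D(2) by blast
    obtain b c where bc: "V = {z, b, c}" "det2 (b - z) (c - z) \<noteq> 0"
      using DT(3,2)[OF V] by (rule is_tri_vertex_cases)
    have "b \<in> vcone z V" unfolding bc(1) by (simp add: vcone_iff[OF bc(2)] acoord_vertices[OF bc(2)])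
    moreover have "b \<noteq> z" using bc(2) by (auto simp: det2_def)
    ultimately show ?thesis using V by blast
  qed
  with C have all: "x \<in> ?C" if "x \<noteq> z" for x using that by blast
  \<comment> \<open>An inner point of \<open>W\<close> lies in the cone of some \<open>V\<close>
    from \<open>D\<close>. Pulled towards \<open>z\<close> it enters \<open>V\<close> itself while
    staying inside \<open>W\<close>, so the two triangles coincide.\<close>
  have "W \<in> D" if W: "W \<in> \<T>" "z \<in> W" for W
  proof -
    obtain b c where bc: "W = {z, b, c}" "det2 (b - z) (c - z) \<noteq> 0"
      using tri_mesh_is_tri[OF T W(1)] W(2) by (rule is_tri_vertex_cases)
    define x where "x = amap z b c (1/3, 1/3)"
    have "acoord z b c x = (1/3, 1/3)" unfolding x_def by (rule acoord_amap[OF bc(2)])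
    then have "x \<noteq> z" using acoord_vertices(1)[OF bc(2)] by auto
    then obtain V where V: "V \<in> D" "x \<in> vcone z V" using all by blast
    then obtain r y where ry: "0 \<le> r" "y \<in> tri V" "x = z + r *\<^sub>R (y - z)" by (auto simp: vcone_def)
    have r: "r > 0" using ry(1,3) \<open>x \<noteq> z\<close> by (cases "r = 0") auto
    \<comment> \<open>Makes \<open>q * r\<close> at most 1, so that the pulled point is a convex
      combination of \<open>z\<close> and \<open>y\<close>.\<close>
    define q where "q = 1 / (r + 1)"
    have q: "0 < q" "q \<le> 1" "0 \<le> q * r" "q * r \<le> 1" using r by (auto simp: q_def field_simps)
    have "z \<in> tri V" using DT(2)[OF V(1)] by (simp add: tri_def hull_inc)
    have "z + q *\<^sub>R (x - z) = (1 - q * r) *\<^sub>R z + (q * r) *\<^sub>R y" by (simp add: ry(3) algebra_simps)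
    also have "\<dots> \<in> tri V"
      using \<open>z \<in> tri V\<close> ry(2) q by (intro convexD) (auto simp: tri_def)
    finally have "z + q *\<^sub>R (x - z) \<in> tri V" .
    moreover have "acoord z b c (z + q *\<^sub>R (x - z)) = (q / 3, q / 3)"
      unfolding x_def amap_ray by (simp add: acoord_amap[OF bc(2)])
    ultimately have "V = {z, b, c}"
      using q W(1) DT(1)[OF V(1)] by (intro tri_mesh_inner_point[OF T]) (auto simp: bc(1))
    then show ?thesis using V(1) bc(1) by simp
  qed
  then show ?thesis using D(1) by blast
qed

text \<open>Around a point of \<open>\<Omega>\<close> inside the edge, all other triangles stay at a
  distance and a full neighbourhood would be covered by \<open>V\<close> alone, yet a step away from
  the opposite vertex leaves \<open>V\<close>.\<close>

lemma boundary_edge_in_frontier: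
  assumes conf: "conforming \<Omega> \<T>" and reg: "open \<Omega>" "\<Omega> = interior (closure \<Omega>)"
    and V: "V \<in> \<T>" and e: "e \<in> edges_of V" and only: "\<And>W. W \<in> \<T> \<Longrightarrow> e \<in> edges_of W \<Longrightarrow> W = V"
  shows "seg e \<subseteq> frontier \<Omega>"
proof -
  have T: "tri_mesh \<T>" using conf by (rule conforming_tri_mesh)
  have cl: "closure \<Omega> = \<Union>(tri ` \<T>)" using conf by (simp add: conforming_def)
  obtain a b c where abc: "V = {a, b, c}" "e = {a, b}" "a \<noteq> b" and D: "det2 (b - a) (c - a) \<noteq> 0"
    using tri_mesh_is_tri[OF T V] e by (rule edges_of_third_vertex)
  have "x \<in> frontier \<Omega>" if x: "x \<in> open_segment a b" for x
  proof -
    have xe: "x \<in> seg e" "x \<notin> e" using x by (auto simp: abc seg_doubleton open_segment_def)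
    have xV: "x \<in> tri V" using xe(1) hull_mono[of e V convex] abc by (auto simp: seg_def tri_def)
    have "x \<notin> \<Omega>"
    proof
      assume x\<Omega>: "x \<in> \<Omega>"
      \<comment> \<open>Closed, and it misses \<open>x\<close>, because another triangle through
        \<open>x\<close> would have \<open>e\<close> as an edge.\<close>
      define C where "C = \<Union>(tri ` (\<T> - {V}))"
      have "closed C" unfolding C_def
        using T by (intro closed_Union) (auto simp: tri_mesh_def intro!: compact_imp_closed compact_tri is_tri_finite)
      have "x \<notin> C"
      proof
        assume "x \<in> C"
        then obtain W where W: "W \<in> \<T>" "W \<noteq> V" "x \<in> tri W" by (auto simp: C_def)
        from tri_mesh_edge_in_tri[OF T W(1) V e xe W(3)] only W show False by blast
      qed
      have N: "\<Omega> - C \<subseteq> tri V"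
      proof
        fix y assume y: "y \<in> \<Omega> - C"
        then have "y \<in> closure \<Omega>" using closure_subset by blast
        then show "y \<in> tri V" using y unfolding cl C_def by blast
      qed
      have "open (\<Omega> - C)" using reg(1) \<open>closed C\<close> by (rule open_Diff)
      moreover have "((\<lambda>r. x + r *\<^sub>R (a - c)) \<longlongrightarrow> x + 0 *\<^sub>R (a - c)) (at_right 0)"
        by (intro tendsto_intros)
      ultimately have "\<forall>\<^sub>F r in at_right 0. x + r *\<^sub>R (a - c) \<in> \<Omega> - C"
        using x\<Omega> \<open>x \<notin> C\<close> by (intro topological_tendstoD) auto
      then have "\<forall>\<^sub>F r in at_right 0. (r::real) > 0 \<and> x + r *\<^sub>R (a - c) \<in> tri V"
        using eventually_at_right_less[of 0] by eventually_elim (use N in blast)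
      then obtain r where r: "r > 0" "x + r *\<^sub>R (a - c) \<in> tri V"
        using eventually_happens[of _ "at_right (0::real)"] by auto
      obtain t where t: "x = (1 - t) *\<^sub>R a + t *\<^sub>R b" using xe(1) by (auto simp: abc seg_doubleton in_segment)
      have "x + r *\<^sub>R (a - c) = amap a b c (t, - r)" by (simp add: t amap_def algebra_simps)
      then have "acoord a b c (x + r *\<^sub>R (a - c)) = (t, - r)" by (simp add: acoord_amap[OF D])
      with r show False unfolding abc(1) by (simp add: tri_acoord[OF D] ref_tri_def)
    qed
    moreover have "x \<in> closure \<Omega>" unfolding cl using xV V by blast
    ultimately show ?thesis using reg(1) by (simp add: frontier_def interior_open)
  qed
  \<comment> \<open>The endpoints are gained by closure, as other triangles may meet them.\<close>
  then have "closure (open_segment a b) \<subseteq> frontier \<Omega>"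
    by (intro closure_minimal) auto
  then show ?thesis using abc by (simp add: seg_doubleton)
qed

section \<open>Triangles overlap in null sets; additivity of integrals\<close>

text \<open>The intersection omits a vertex of \<open>V\<close>, hence lies on the line through the
  other two.\<close>

lemma negligible_tri_Int:
  assumes T: "tri_mesh \<T>" and V: "V \<in> \<T>" "W \<in> \<T>" "V \<noteq> W"
  shows "negligible (tri V \<inter> tri W)"
proof -
  have tr: "is_tri V" "is_tri W" using tri_mesh_is_tri[OF T] V by auto
  have "\<not> V \<subseteq> W" using V(3) card_subset_eq[OF is_tri_finite[OF tr(2)], of V] tr unfolding is_tri_def by metis
  then obtain c where c: "c \<in> V" "c \<notin> W" by blast
  obtain a b where ab: "V = {c, a, b}" "det2 (a - c) (b - c) \<noteq> 0" using tr(1) c(1) by (rule is_tri_vertex_cases)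
  have D: "det2 (b - a) (c - a) \<noteq> 0" using ab(2) by (simp add: det2_rotate)
  have "tri V \<inter> tri W \<subseteq> {x. inner (perp (b - a)) x = inner (perp (b - a)) a}"
  proof
    fix x assume "x \<in> tri V \<inter> tri W"
    then have "x \<in> convex hull (V \<inter> W)" using tri_mesh_Int[OF T V] by simp
    moreover have "V \<inter> W \<subseteq> {a, b}" using ab c by auto
    ultimately have "snd (acoord a b c x) = 0" using hull_avoiding_vertex[OF D] by blast
    then have "det2 (b - a) (x - a) = 0" using D by (simp add: acoord_def)
    then show "x \<in> {x. inner (perp (b - a)) x = inner (perp (b - a)) a}"
      by (simp add: det2_def perp_def inner_prod_def algebra_simps)
  qed
  moreover have "perp (b - a) \<noteq> 0" using D by (auto simp: perp_def det2_def prod_eq_iff)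
  then have "negligible {x. inner (perp (b - a)) x = inner (perp (b - a)) a}" by (intro negligible_hyperplane) simp
  ultimately show ?thesis using negligible_subset by blast
qed

text \<open>Used twice: with the constant 1 to count the triangles at a vertex by area, and with the
  squared gradient to collect the fine triangles inside a coarse one.\<close>

lemma sum_tri_integrals_le:
  fixes f :: "pt \<Rightarrow> real"
  assumes T: "tri_mesh \<T>" and S: "S \<subseteq> \<T>" "\<And>V. V \<in> S \<Longrightarrow> tri V \<subseteq> B" and B: "compact B"
    and f: "continuous_on UNIV f" "\<And>x. 0 \<le> f x"
  shows "(\<Sum>V\<in>S. integral (tri V) f) \<le> integral B f"
proof -
  have "finite S" using S(1) T finite_subset by (auto simp: tri_mesh_def)
  have "(f has_integral (\<Sum>V\<in>S. integral (tri V) f)) (\<Union>V\<in>S. tri V)"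
  proof (rule has_integral_UN[OF \<open>finite S\<close>])
    show "pairwise (\<lambda>i i'. negligible (tri i \<inter> tri i')) S"
      unfolding pairwise_def using negligible_tri_Int[OF T] S(1) by blast
    fix V assume "V \<in> S"
    then show "(f has_integral integral (tri V) f) (tri V)"
      using tri_mesh_is_tri[OF T] S(1) f(1) by (intro integrable_integral tri_integrable) auto
  qed
  then have "(\<Sum>V\<in>S. integral (tri V) f) = integral (\<Union>V\<in>S. tri V) f" "f integrable_on (\<Union>V\<in>S. tri V)"
    by (auto simp: integral_unique[symmetric])
  moreover have "f integrable_on B" using B continuous_on_subset[OF f(1)] by (intro integral_eq_lborel(2)) auto
  ultimately show ?thesis using S(2) f(2) by (simp only:, intro integral_subset_le) auto
qed

section \<open>Quasi-uniform meshes and nodal values\<close>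

text \<open>The reference triangle lies between the squares of side \<open>1/2\<close> and 1; these
  crude bounds replace its exact area \<open>1/2\<close>.\<close>

lemma tri_area_bounds:
  assumes D: "det2 (b - a) (c - a) \<noteq> 0"
  shows "\<bar>det2 (b - a) (c - a)\<bar> / 4 \<le> integral (tri {a, b, c}) (\<lambda>_. 1)"
    and "integral (tri {a, b, c}) (\<lambda>_. 1) \<le> \<bar>det2 (b - a) (c - a)\<bar>"
proof -
  let ?B = "cbox (0, 0) (1/2, 1/2 :: real) :: pt set"
  have eq: "integral (tri {a, b, c}) (\<lambda>_. 1) = \<bar>det2 (b - a) (c - a)\<bar> * integral ref_tri (\<lambda>_. 1)"
    by (rule integral_tri[OF D]) (rule continuous_on_const)
  have "integral ?B (\<lambda>_. 1 :: real) \<le> integral ref_tri (\<lambda>_. 1)"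
    by (intro integral_subset_le integral_eq_lborel(2) compact_ref_tri compact_cbox continuous_intros)
      (auto simp: ref_tri_def cbox_Pair_eq)
  then have "1 / 4 \<le> integral ref_tri (\<lambda>_. 1 :: real)" by (simp add: content_Pair)
  then have "\<bar>det2 (b - a) (c - a)\<bar> * (1 / 4) \<le> \<bar>det2 (b - a) (c - a)\<bar> * integral ref_tri (\<lambda>_. 1)"
    by (intro mult_left_mono) auto
  then show "\<bar>det2 (b - a) (c - a)\<bar> / 4 \<le> integral (tri {a, b, c}) (\<lambda>_. 1)" by (simp add: eq)
  have "integral ref_tri (\<lambda>_. 1 :: real) \<le> 1" by (rule ref_int_le_const) auto
  then have "\<bar>det2 (b - a) (c - a)\<bar> * integral ref_tri (\<lambda>_. 1) \<le> \<bar>det2 (b - a) (c - a)\<bar> * 1"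
    by (intro mult_left_mono) auto
  then show "integral (tri {a, b, c}) (\<lambda>_. 1) \<le> \<bar>det2 (b - a) (c - a)\<bar>" by (simp add: eq)
qed

text \<open>A ball of radius \<open>r\<close> contains the concentric square of side
  \<open>r\<close>, whose area is at most that of the triangle.\<close>

lemma inradius_le_sqrt_det2:
  assumes D: "det2 (b - a) (c - a) \<noteq> 0"
  shows "inradius {a, b, c} \<le> sqrt \<bar>det2 (b - a) (c - a)\<bar>"
  unfolding inradius_def
proof (rule cSup_least)
  \<comment> \<open>The radius 0 belongs to the set, since its ball is empty.\<close>
  show "{r. \<exists>x. ball x r \<subseteq> tri {a, b, c}} \<noteq> {}" by (auto intro!: exI[of _ 0])
  fix r assume "r \<in> {r. \<exists>x. ball x r \<subseteq> tri {a, b, c}}"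
  then obtain x where x: "ball x r \<subseteq> tri {a, b, c}" by blast
  show "r \<le> sqrt \<bar>det2 (b - a) (c - a)\<bar>"
  proof (cases "r > 0")
    case True
    obtain x1 x2 where x12: "x = (x1, x2)" by (cases x)
    let ?B = "cbox (x1 - r/2, x2 - r/2) (x1 + r/2, x2 + r/2) :: pt set"
    have "?B \<subseteq> ball x r"
    proof
      fix y assume y: "y \<in> ?B"
      obtain y1 y2 where y12: "y = (y1, y2)" by (cases y)
      have "x1 - r/2 \<le> y1" "y1 \<le> x1 + r/2" "x2 - r/2 \<le> y2" "y2 \<le> x2 + r/2"
        using y by (auto simp: y12 cbox_Pair_eq)
      then have "\<bar>x1 - y1\<bar> \<le> r / 2" "\<bar>x2 - y2\<bar> \<le> r / 2" unfolding abs_le_iff by linarith+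
      then have "(x1 - y1)\<^sup>2 \<le> (r / 2)\<^sup>2" "(x2 - y2)\<^sup>2 \<le> (r / 2)\<^sup>2"
        by (metis abs_ge_zero power_mono power2_abs)+
      then have "(x1 - y1)\<^sup>2 + (x2 - y2)\<^sup>2 \<le> r\<^sup>2 / 2" by (simp add: power_divide)
      also have "\<dots> < r\<^sup>2" using True by simp
      finally have "sqrt ((x1 - y1)\<^sup>2 + (x2 - y2)\<^sup>2) < r"
        using True by (metis less_eq_real_def real_sqrt_less_iff real_sqrt_unique)
      then show "y \<in> ball x r" by (simp add: x12 y12 dist_Pair_Pair dist_real_def)
    qed
    with x have "?B \<subseteq> tri {a, b, c}" by blast
    then have "integral ?B (\<lambda>_. 1 :: real) \<le> integral (tri {a, b, c}) (\<lambda>_. 1)"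
      by (intro integral_subset_le integral_eq_lborel(2) compact_tri compact_cbox continuous_intros) auto
    also have "\<dots> \<le> \<bar>det2 (b - a) (c - a)\<bar>" by (rule tri_area_bounds(2)[OF D])
    finally have "r\<^sup>2 \<le> \<bar>det2 (b - a) (c - a)\<bar>" using True by (simp add: content_Pair power2_eq_square)
    then show ?thesis by (rule real_le_rsqrt)
  next
    case False
    then show ?thesis by (meson abs_ge_zero linorder_not_le order_trans real_sqrt_ge_zero)
  qed
qed

text \<open>Chaining quasi-uniformity, shape regularity and the inradius bound gives \<open>\<rho> *
  h \<le> \<sigma> * sqrt \<bar>det2 (b - a) (c - a)\<bar>\<close>; squaring it produces
  \<open>\<kappa> = \<rho>\<^sup>2 / \<sigma>\<^sup>2\<close>.\<close>

lemma mesh_tri_reg: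
  assumes conf: "conforming \<Omega> \<T>" and "shape_regular \<sigma> \<T>" "quasi_uniform \<rho> \<T>" and \<sigma>: "\<sigma> > 0" and \<rho>: "\<rho> > 0"
  shows "meshsize \<T> > 0" "\<And>V. V \<in> \<T> \<Longrightarrow> tri_reg (\<rho>\<^sup>2 / \<sigma>\<^sup>2) (meshsize \<T>) V"
proof -
  have T: "tri_mesh \<T>" using conf by (rule conforming_tri_mesh)
  have fin: "finite \<T>" "\<T> \<noteq> {}" using conf by (auto simp: conforming_def)
  have diam: "dist x y \<le> diam_tri V" if "V \<in> \<T>" "x \<in> V" "y \<in> V" for V x y
    unfolding diam_tri_def using that tri_mesh_is_tri[OF T]
    by (intro diameter_bounded_bound compact_imp_bounded compact_tri is_tri_finite) (auto simp: tri_def hull_inc)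
  have dh: "diam_tri V \<le> meshsize \<T>" if "V \<in> \<T>" for V
    unfolding meshsize_def using fin that by (intro Max_ge) auto
  show h: "meshsize \<T> > 0"
  proof -
    obtain V where V: "V \<in> \<T>" using fin by blast
    obtain a b c where abc: "V = {a, b, c}" "a \<noteq> b" using tri_mesh_is_tri[OF T V] by (rule is_tri_cases)
    have "0 < dist a b" using abc by simp
    also have "\<dots> \<le> diam_tri V" using V abc by (intro diam) auto
    also have "\<dots> \<le> meshsize \<T>" by (rule dh[OF V])
    finally show ?thesis .
  qed
  fix V assume V: "V \<in> \<T>"
  show "tri_reg (\<rho>\<^sup>2 / \<sigma>\<^sup>2) (meshsize \<T>) V" unfolding tri_reg_def
  proof (intro conjI allI impI ballI)
    show "is_tri V" by (rule tri_mesh_is_tri[OF T V])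
    show "dist x y \<le> meshsize \<T>" if "x \<in> V" "y \<in> V" for x y
      using diam[OF V that] dh[OF V] by linarith
    fix a b c assume abc: "V = {a, b, c}"
    have D: "det2 (b - a) (c - a) \<noteq> 0" using tri_mesh_is_tri[OF T V] unfolding abc by (rule is_tri_det2)
    have "\<rho> * meshsize \<T> \<le> diam_tri V" using assms(3) V by (simp add: quasi_uniform_def)
    also have "\<dots> \<le> \<sigma> * inradius V" using assms(2) V by (simp add: shape_regular_def)
    also have "\<dots> \<le> \<sigma> * sqrt \<bar>det2 (b - a) (c - a)\<bar>"
      unfolding abc using inradius_le_sqrt_det2[OF D] \<sigma> by simp
    finally have "(\<rho> * meshsize \<T>)\<^sup>2 \<le> (\<sigma> * sqrt \<bar>det2 (b - a) (c - a)\<bar>)\<^sup>2"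
      using \<rho> h by (intro power_mono) auto
    then have "\<rho>\<^sup>2 * (meshsize \<T>)\<^sup>2 \<le> \<sigma>\<^sup>2 * \<bar>det2 (b - a) (c - a)\<bar>" by (simp add: power_mult_distrib)
    then show "\<rho>\<^sup>2 / \<sigma>\<^sup>2 * (meshsize \<T>)\<^sup>2 \<le> \<bar>det2 (b - a) (c - a)\<bar>" using \<sigma> by (simp add: field_simps)
  qed
qed

text \<open>Area count: each triangle at \<open>z\<close> has area at least
  \<open>\<kappa> * h\<^sup>2 / 4\<close>, and all of them fit without overlap into a square of area
  \<open>4 * h\<^sup>2\<close>.\<close>

lemma vertex_star_card:
  assumes T: "tri_mesh \<T>" and reg: "\<And>V. V \<in> \<T> \<Longrightarrow> tri_reg \<kappa> h V" and \<kappa>: "\<kappa> > 0" and h: "h > 0"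
  shows "real (card {V\<in>\<T>. z \<in> V}) \<le> 16 / \<kappa>"
proof -
  let ?S = "{V\<in>\<T>. z \<in> V}" and ?B = "cbox (fst z - h, snd z - h) (fst z + h, snd z + h) :: pt set"
  have "real (card ?S) * (\<kappa> * h\<^sup>2 / 4) \<le> (\<Sum>V\<in>?S. integral (tri V) (\<lambda>_. 1))"
  proof (rule sum_bounded_below)
    fix V assume "V \<in> ?S"
    then have V: "V \<in> \<T>" by simp
    obtain a b c where abc: "V = {a, b, c}" and D: "det2 (b - a) (c - a) \<noteq> 0"
      using tri_mesh_is_tri[OF T V] by (rule is_tri_cases)
    have "\<kappa> * h\<^sup>2 \<le> \<bar>det2 (b - a) (c - a)\<bar>" using reg[OF V] abc unfolding tri_reg_def by blast
    then show "\<kappa> * h\<^sup>2 / 4 \<le> integral (tri V) (\<lambda>_. 1)" using tri_area_bounds(1)[OF D] unfolding abc by linarith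
  qed
  also have "\<dots> \<le> integral ?B (\<lambda>_. 1)"
  proof (rule sum_tri_integrals_le[OF T])
    fix V assume V: "V \<in> ?S"
    show "tri V \<subseteq> ?B" unfolding tri_def
    proof (rule hull_minimal)
      show "V \<subseteq> ?B"
      proof
        fix y assume "y \<in> V"
        then have "dist z y \<le> h" using V reg unfolding tri_reg_def by blast
        then have "dist (fst z) (fst y) \<le> h" "dist (snd z) (snd y) \<le> h"
          using dist_fst_le[of z y] dist_snd_le[of z y] by linarith+
        then show "y \<in> ?B" by (cases y) (auto simp: cbox_Pair_eq dist_real_def)
      qed
    qed (rule convex_box)
  qed auto
  also have "\<dots> = 4 * h\<^sup>2" using h by (simp add: content_Pair power2_eq_square)
  finally have "real (card ?S) * \<kappa> * h\<^sup>2 \<le> 16 * h\<^sup>2" by simp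
  then show ?thesis using h \<kappa> by (simp add: field_simps)
qed

section \<open>Oscillation around a vertex and closeness of nodal values\<close>

lemma relpow_oscillation:
  fixes u :: "'a \<Rightarrow> real"
  assumes "\<And>x y. (x, y) \<in> R \<Longrightarrow> \<bar>u x - u y\<bar> \<le> \<delta>" "(x, y) \<in> R ^^ n"
  shows "\<bar>u x - u y\<bar> \<le> real n * \<delta>"
  using assms(2)
proof (induction n arbitrary: y)
  case (Suc n)
  then obtain w where "(x, w) \<in> R ^^ n" "(w, y) \<in> R" by auto
  with Suc.IH[of w] assms(1)[of w y] have "\<bar>u x - u y\<bar> \<le> real n * \<delta> + \<delta>" by simp
  then show ?case by (simp add: algebra_simps)
qed simp

text \<open>In a finite relation every reachable point is reached within \<open>card R\<close>
  steps, so the bound does not depend on the path.\<close>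

lemma rtrancl_oscillation:
  fixes u :: "'a \<Rightarrow> real"
  assumes "finite R" "\<And>x y. (x, y) \<in> R \<Longrightarrow> \<bar>u x - u y\<bar> \<le> \<delta>" "0 \<le> \<delta>" "(x, y) \<in> R\<^sup>*"
  shows "\<bar>u x - u y\<bar> \<le> real (card R) * \<delta>"
proof -
  obtain n where n: "n \<le> card R" "(x, y) \<in> R ^^ n"
    using assms(4) unfolding rtrancl_finite_eq_relpow[OF assms(1)] by blast
  have "\<bar>u x - u y\<bar> \<le> real n * \<delta>" by (rule relpow_oscillation[OF assms(2) n(2)])
  also have "\<dots> \<le> real (card R) * \<delta>" using n(1) assms(3) by (intro mult_right_mono) auto
  finally show ?thesis .
qed

text \<open>Around an interior vertex the triangles form one edge-connected cycle. Around a boundary vertex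
  the star may fall apart into several fans (the domain may touch itself there), but then every fan
  ends in a boundary edge, on which the trace vanishes.\<close>

lemma vertex_star_oscillation:
  fixes u lam :: "pt set \<Rightarrow> real"
  assumes conf: "conforming \<Omega> \<T>" and reg: "open \<Omega>" "\<Omega> = interior (closure \<Omega>)"
    and near: "\<And>V e. V \<in> \<T> \<Longrightarrow> e \<in> edges_of V \<Longrightarrow> z \<in> e \<Longrightarrow> \<bar>lam e - u V\<bar> \<le> \<delta>"
    and bdry: "\<And>e. e \<in> mesh_edges \<T> \<Longrightarrow> seg e \<subseteq> frontier \<Omega> \<Longrightarrow> z \<in> e \<Longrightarrow> lam e = 0"
    and N: "real (card {V\<in>\<T>. z \<in> V}) \<le> N" and \<delta>: "0 \<le> \<delta>"
    and V: "V \<in> \<T>" "z \<in> V" and W: "W \<in> \<T>" "z \<in> W"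
  shows "\<bar>u V - u W\<bar> \<le> (4 * N\<^sup>2 + 2) * \<delta>"
proof -
  let ?S = "{V\<in>\<T>. z \<in> V}"
  have T: "tri_mesh \<T>" using conf by (rule conforming_tri_mesh)
  have finS: "finite ?S" using T by (simp add: tri_mesh_def)
  \<comment> \<open>Neighbours across an edge at \<open>z\<close>. One step costs
    \<open>2 * \<delta>\<close>, because both triangles are compared with the same trace
    \<open>lam e\<close>.\<close>
  define R where "R = {(V, W). V \<in> ?S \<and> W \<in> ?S \<and> (\<exists>e. z \<in> e \<and> e \<in> edges_of V \<and> e \<in> edges_of W)}"
  have Rsub: "R \<subseteq> ?S \<times> ?S" by (auto simp: R_def)
  then have finR: "finite R" using finS finite_subset by blast
  have "card R \<le> card (?S \<times> ?S)" using Rsub finS by (intro card_mono) auto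
  then have "card R \<le> card ?S * card ?S" by (simp only: card_cartesian_product)
  then have "real (card R) \<le> real (card ?S * card ?S)" by (simp only: of_nat_le_iff)
  then have "real (card R) \<le> real (card ?S) * real (card ?S)" by (simp only: of_nat_mult)
  also have "\<dots> \<le> N\<^sup>2" unfolding power2_eq_square using N by (intro mult_mono) auto
  finally have cR: "real (card R) \<le> N\<^sup>2" .
  have R\<delta>: "\<bar>u X - u Y\<bar> \<le> 2 * \<delta>" if XY: "(X, Y) \<in> R" for X Y
  proof -
    obtain e where e: "z \<in> e" "e \<in> edges_of X" "e \<in> edges_of Y" "X \<in> \<T>" "Y \<in> \<T>" using XY by (auto simp: R_def)
    show ?thesis using near[OF e(4,2,1)] near[OF e(5,3,1)] by linarith
  qed
  have path: "\<bar>u X - u Y\<bar> \<le> N\<^sup>2 * (2 * \<delta>)" if "(X, Y) \<in> R\<^sup>*" for X Y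
  proof -
    have "\<bar>u X - u Y\<bar> \<le> real (card R) * (2 * \<delta>)"
      using rtrancl_oscillation[OF finR R\<delta> _ that] \<delta> by simp
    also have "\<dots> \<le> N\<^sup>2 * (2 * \<delta>)" using cR \<delta> by (intro mult_right_mono) auto
    finally show ?thesis .
  qed
  have reachS: "Y \<in> ?S" if "X \<in> ?S" "(X, Y) \<in> R\<^sup>*" for X Y
    using that(2) that(1)
  proof (induction rule: rtrancl_induct)
    case (step Y Y')
    then show ?case using Rsub by blast
  qed
  show ?thesis
  \<comment> \<open>Either some fan has no edge at \<open>z\<close> that belongs to a single
    triangle, and then it is the whole star, or every fan contains such an edge, which lies on the
    boundary.\<close>
  proof (cases "\<exists>V0\<in>?S. \<forall>X\<in>R\<^sup>* `` {V0}. \<forall>e\<in>edges_of X. z \<in> e \<longrightarrow> (\<exists>Y\<in>\<T>. Y \<noteq> X \<and> e \<in> edges_of Y)")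
    case True
    then obtain V0 where V0: "V0 \<in> ?S" and
      cl: "\<And>X e. X \<in> R\<^sup>* `` {V0} \<Longrightarrow> e \<in> edges_of X \<Longrightarrow> z \<in> e \<Longrightarrow> \<exists>Y\<in>\<T>. Y \<noteq> X \<and> e \<in> edges_of Y"
      by (elim bexE) (erule that, simp)
    have "R\<^sup>* `` {V0} = ?S"
    proof (rule vertex_star_closed_component[OF T])
      show "R\<^sup>* `` {V0} \<subseteq> ?S" using reachS[OF V0] by blast
      show "R\<^sup>* `` {V0} \<noteq> {}" by blast
      fix X e assume X: "X \<in> R\<^sup>* `` {V0}" "e \<in> edges_of X" "z \<in> e"
      obtain Y where Y: "Y \<in> \<T>" "Y \<noteq> X" "e \<in> edges_of Y" using cl[OF X] by blast
      have "X \<in> ?S" using X(1) reachS[OF V0] by blast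
      moreover have "Y \<in> ?S" using Y X(3) by (auto simp: edges_of_def)
      ultimately have "(X, Y) \<in> R" using X Y by (auto simp: R_def)
      then have "Y \<in> R\<^sup>* `` {V0}" using X(1) by (auto intro: rtrancl_into_rtrancl)
      with Y show "\<exists>V'\<in>R\<^sup>* `` {V0}. V' \<noteq> X \<and> e \<in> edges_of V'" by blast
    qed
    then have "(V0, V) \<in> R\<^sup>*" "(V0, W) \<in> R\<^sup>*" using V W by blast+
    from this[THEN path] have "\<bar>u V - u W\<bar> \<le> 2 * (N\<^sup>2 * (2 * \<delta>))" by linarith
    also have "\<dots> \<le> (4 * N\<^sup>2 + 2) * \<delta>" using \<delta> by (simp add: algebra_simps)
    finally show ?thesis .
  next
    case False
    have small: "\<bar>u V0\<bar> \<le> N\<^sup>2 * (2 * \<delta>) + \<delta>" if V0: "V0 \<in> \<T>" "z \<in> V0" for V0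
    proof -
      from False V0 obtain X e where X: "(V0, X) \<in> R\<^sup>*" "e \<in> edges_of X" "z \<in> e"
        and no: "\<not> (\<exists>Y\<in>\<T>. Y \<noteq> X \<and> e \<in> edges_of Y)" by auto
      have XT: "X \<in> \<T>" using reachS[OF _ X(1)] V0 by blast
      have "seg e \<subseteq> frontier \<Omega>"
        by (rule boundary_edge_in_frontier[OF conf reg XT X(2)]) (use no in blast)
      moreover have "e \<in> mesh_edges \<T>" using XT X(2) by (auto simp: mesh_edges_def)
      ultimately have "lam e = 0" using bdry X(3) by blast
      with near[OF XT X(2,3)] have "\<bar>u X\<bar> \<le> \<delta>" by simp
      with path[OF X(1)] show ?thesis by linarith
    qed
    \<comment> \<open>In different fans the two values cannot be linked by a path, but each is small
      by itself.\<close>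
    have "\<bar>u V - u W\<bar> \<le> \<bar>u V\<bar> + \<bar>u W\<bar>" by (rule abs_triangle_ineq4)
    also have "\<dots> \<le> (N\<^sup>2 * (2 * \<delta>) + \<delta>) + (N\<^sup>2 * (2 * \<delta>) + \<delta>)" by (intro add_mono small V W)
    also have "\<dots> = (4 * N\<^sup>2 + 2) * \<delta>" by (simp add: algebra_simps)
    finally show ?thesis .
  qed
qed

lemma average_close:
  fixes f :: "'a \<Rightarrow> real"
  assumes "finite E" "E \<noteq> {}" "\<And>e. e \<in> E \<Longrightarrow> \<bar>f e - c\<bar> \<le> B"
  shows "\<bar>(\<Sum>e\<in>E. f e) / real (card E) - c\<bar> \<le> B"
proof -
  have n: "real (card E) > 0" using assms(1,2) by (simp add: card_gt_0_iff)
  have "(\<Sum>e\<in>E. f e) / real (card E) - c = (\<Sum>e\<in>E. f e - c) / real (card E)"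
    using n by (simp add: sum_subtractf field_simps)
  also have "\<bar>\<dots>\<bar> \<le> (real (card E) * B) / real (card E)"
  proof -
    have "\<bar>\<Sum>e\<in>E. f e - c\<bar> \<le> (\<Sum>e\<in>E. \<bar>f e - c\<bar>)" by (rule sum_abs)
    also have "\<dots> \<le> real (card E) * B" using assms(3) by (intro sum_bounded_above) auto
    finally show ?thesis using n by (simp add: pos_divide_le_eq mult.commute)
  qed
  finally show ?thesis using n by simp
qed

text \<open>\<open>E\<close> abstracts the local energy. The right side sums it over all triangles
  touching \<open>V\<close>, since a vertex value involves its entire star. The constant is the
  oscillation \<open>4 * N\<^sup>2 + 2\<close> plus one further step from a trace to the
  \<open>U\<close> of its own triangle.\<close>

lemma nodal_val_close:
  fixes E :: "pt set \<Rightarrow> real"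
  assumes conf: "conforming \<Omega> \<T>" and reg: "open \<Omega>" "\<Omega> = interior (closure \<Omega>)" and p: "p > 0"
    and bdry: "\<And>e x. e \<in> mesh_edges \<T> \<Longrightarrow> seg e \<subseteq> frontier \<Omega> \<Longrightarrow> x \<in> seg e \<Longrightarrow> m e x = 0"
    and near: "\<And>V e x. V \<in> \<T> \<Longrightarrow> e \<in> edges_of V \<Longrightarrow> x \<in> seg e \<Longrightarrow> (loc_U p \<tau> V m x - m e x)\<^sup>2 \<le> K * E V"
    and E: "\<And>V. V \<in> \<T> \<Longrightarrow> 0 \<le> E V" and K: "0 \<le> K" and N: "\<And>z. real (card {V\<in>\<T>. z \<in> V}) \<le> N"
    and V: "V \<in> \<T>" and z: "z \<in> nodes p V"
  shows "(nodal_val p \<tau> \<T> m z - loc_U p \<tau> V m z)\<^sup>2 \<le> (4 * N\<^sup>2 + 3)\<^sup>2 * K * (\<Sum>W\<in>{W\<in>\<T>. W \<inter> V \<noteq> {}}. E W)"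
proof -
  have T: "tri_mesh \<T>" using conf by (rule conforming_tri_mesh)
  have finT: "finite \<T>" using T by (simp add: tri_mesh_def)
  have trV: "is_tri V" by (rule tri_mesh_is_tri[OF T V])
  have zV: "z \<in> tri V" by (rule nodes_subset_tri[OF trV z p])
  define A where "A = (\<Sum>W\<in>{W\<in>\<T>. W \<inter> V \<noteq> {}}. E W)"
  \<comment> \<open>A common bound for the mismatch between trace and \<open>U\<close> on all
    triangles that touch \<open>V\<close>.\<close>
  define \<delta> where "\<delta> = sqrt (K * A)"
  have EA: "E W \<le> A" if "W \<in> \<T>" "W \<inter> V \<noteq> {}" for W
    unfolding A_def using that E finT by (intro member_le_sum) auto
  have "V \<noteq> {}" using trV by (auto simp: is_tri_def)
  then have EV: "E V \<le> A" using EA[OF V] by simp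
  have A0: "A \<ge> 0" unfolding A_def by (intro sum_nonneg) (auto intro: E)
  have \<delta>0: "\<delta> \<ge> 0" using K A0 by (simp add: \<delta>_def)
  have near': "\<bar>m e x - loc_U p \<tau> W m x\<bar> \<le> \<delta>" if "W \<in> \<T>" "W \<inter> V \<noteq> {}" "e \<in> edges_of W" "x \<in> seg e" for W e x
  proof -
    have "(loc_U p \<tau> W m x - m e x)\<^sup>2 \<le> K * E W" by (rule near[OF that(1,3,4)])
    also have "\<dots> \<le> K * A" using EA[OF that(1,2)] K by (rule mult_left_mono)
    finally have "\<bar>loc_U p \<tau> W m x - m e x\<bar> \<le> \<delta>" unfolding \<delta>_def by (simp add: real_le_rsqrt)
    then show ?thesis by (simp add: abs_minus_commute)
  qed
  have "\<bar>nodal_val p \<tau> \<T> m z - loc_U p \<tau> V m z\<bar> \<le> (4 * N\<^sup>2 + 3) * \<delta>"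
  proof (cases "z \<in> \<Union>\<T>")
    case True
    then obtain W0 where "W0 \<in> \<T>" "z \<in> W0" by blast
    then have zinV: "z \<in> V" using tri_mesh_vertex_in_tri[OF T V] zV by blast
    let ?Ez = "{e\<in>mesh_edges \<T>. z \<in> e}"
    have nv: "nodal_val p \<tau> \<T> m z = (\<Sum>e\<in>?Ez. m e z) / real (card ?Ez)" using True by (simp add: nodal_val_def)
    have "finite (mesh_edges \<T>)" unfolding mesh_edges_def
      using finT tri_mesh_is_tri[OF T] by (auto intro!: finite_edges_of is_tri_finite)
    then have finE: "finite ?Ez" by simp
    have neE: "?Ez \<noteq> {}"
    proof -
      obtain b c where bc: "V = {z, b, c}" using trV zinV by (rule is_tri_vertex_cases)
      have "z \<noteq> b" using is_tri_distinct trV unfolding bc by blast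
      then have "{z, b} \<in> edges_of V" by (simp add: edges_of_def bc)
      then show ?thesis using V by (auto simp: mesh_edges_def)
    qed
    have seg: "z \<in> seg e" if "z \<in> e" for e using that by (simp add: seg_def hull_inc)
    have osc: "\<bar>loc_U p \<tau> W m z - loc_U p \<tau> V m z\<bar> \<le> (4 * N\<^sup>2 + 2) * \<delta>" if W: "W \<in> \<T>" "z \<in> W" for W
    proof (rule vertex_star_oscillation[where lam = "\<lambda>e. m e z" and u = "\<lambda>W. loc_U p \<tau> W m z", OF conf reg _ _ N \<delta>0 W V zinV])
      fix X e assume X: "X \<in> \<T>" "e \<in> edges_of X" "z \<in> e"
      then have "X \<inter> V \<noteq> {}" using zinV by (auto simp: edges_of_def)
      then show "\<bar>m e z - loc_U p \<tau> X m z\<bar> \<le> \<delta>" using near' X seg by blast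
    next
      fix e assume "e \<in> mesh_edges \<T>" "seg e \<subseteq> frontier \<Omega>" "z \<in> e"
      then show "m e z = 0" using bdry seg by blast
    qed
    show ?thesis unfolding nv
    proof (rule average_close[OF finE neE])
      fix e assume "e \<in> ?Ez"
      then obtain W where W: "W \<in> \<T>" "e \<in> edges_of W" "z \<in> e" by (auto simp: mesh_edges_def)
      then have zW: "z \<in> W" by (auto simp: edges_of_def)
      then have "W \<inter> V \<noteq> {}" using zinV by blast
      then have "\<bar>m e z - loc_U p \<tau> W m z\<bar> \<le> \<delta>" using near' W seg by blast
      then have "\<bar>m e z - loc_U p \<tau> V m z\<bar> \<le> \<delta> + (4 * N\<^sup>2 + 2) * \<delta>" using osc[OF W(1) zW] by linarith
      then show "\<bar>m e z - loc_U p \<tau> V m z\<bar> \<le> (4 * N\<^sup>2 + 3) * \<delta>" by (simp add: algebra_simps)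
    qed
  next
    case nv: False
    show ?thesis
    proof (cases "\<exists>V\<in>\<T>. z \<in> interior (tri V)")
      case True
      define W where "W = (SOME V. V \<in> \<T> \<and> z \<in> interior (tri V))"
      have W: "W \<in> \<T> \<and> z \<in> interior (tri W)" unfolding W_def by (rule someI_ex) (use True in blast)
      obtain a b c where abc: "W = {a, b, c}" "det2 (b - a) (c - a) \<noteq> 0"
        using tri_mesh_is_tri[OF T] W by (metis is_tri_cases)
      \<comment> \<open>A point interior to \<open>W\<close> lies in no other triangle, so the
        choice returns \<open>V\<close> and the difference is 0.\<close>
      have "V = W" unfolding abc(1)
        by (rule tri_mesh_inner_point[OF T _ V _ _ _ zV]) (use W abc interior_tri[OF abc(2)] in auto)
      moreover have "nodal_val p \<tau> \<T> m z = loc_U p \<tau> W m z"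
        unfolding nodal_val_def W_def using nv True by (simp only: if_False if_True)
      ultimately have "nodal_val p \<tau> \<T> m z = loc_U p \<tau> V m z" by simp
      then show ?thesis using \<delta>0 by simp
    next
      case False
      define e where "e = (SOME e. e \<in> mesh_edges \<T> \<and> z \<in> seg e)"
      have ex: "\<exists>e. e \<in> mesh_edges \<T> \<and> z \<in> seg e"
      proof -
        obtain a b c where abc: "V = {a, b, c}" "a \<noteq> b" "b \<noteq> c" "a \<noteq> c" "det2 (b - a) (c - a) \<noteq> 0"
          using trV by (rule is_tri_cases)
        have edges: "{a, b} \<in> mesh_edges \<T>" "{b, c} \<in> mesh_edges \<T>" "{a, c} \<in> mesh_edges \<T>"
          using V abc edges_of_tri[OF abc(2-4)] unfolding mesh_edges_def by blast+
        define s t where "s = fst (acoord a b c z)" and "t = snd (acoord a b c z)"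
        have zeq: "z = a + s *\<^sub>R (b - a) + t *\<^sub>R (c - a)"
          using amap_acoord[OF abc(5), of z] by (simp add: amap_def s_def t_def)
        have st: "0 \<le> s" "0 \<le> t" "s + t \<le> 1"
          using zV unfolding abc(1) tri_acoord[OF abc(5)] by (auto simp: ref_tri_def s_def t_def)
        have "\<not> (0 < s \<and> 0 < t \<and> s + t < 1)"
          using False V interior_tri[OF abc(5), of z] unfolding abc(1) s_def t_def by blast
        with st consider "s = 0" | "t = 0" | "s = 1 - t" by linarith
        then show ?thesis
        proof cases
          case 1
          have "z = (1 - t) *\<^sub>R a + t *\<^sub>R c" unfolding zeq 1 by (simp add: algebra_simps)
          then have "z \<in> seg {a, c}" unfolding seg_doubleton in_segment using st 1 by auto
          then show ?thesis using edges by blast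
        next
          case 2
          have "z = (1 - s) *\<^sub>R a + s *\<^sub>R b" unfolding zeq 2 by (simp add: algebra_simps)
          then have "z \<in> seg {a, b}" unfolding seg_doubleton in_segment using st 2 by auto
          then show ?thesis using edges by blast
        next
          case 3
          have "z = (1 - t) *\<^sub>R b + t *\<^sub>R c" unfolding zeq 3 by (simp add: algebra_simps)
          then have "z \<in> seg {b, c}" unfolding seg_doubleton in_segment using st 3 by auto
          then show ?thesis using edges by blast
        qed
      qed
      have e: "e \<in> mesh_edges \<T>" "z \<in> seg e" using someI_ex[OF ex] unfolding e_def by blast+
      then obtain W where W: "W \<in> \<T>" "e \<in> edges_of W" by (auto simp: mesh_edges_def)
      have "z \<notin> e" using nv W by (auto simp: edges_of_def)
      \<comment> \<open>Whichever edge the choice returns, \<open>z\<close> is not an endpoint of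
        it, so conformity makes it an edge of \<open>V\<close>.\<close>
      then have eV: "e \<in> edges_of V" using tri_mesh_edge_in_tri[OF T V W] e(2) zV by blast
      have nval: "nodal_val p \<tau> \<T> m z = m e z"
        unfolding nodal_val_def e_def using nv False by (simp only: if_False)
      have "\<bar>nodal_val p \<tau> \<T> m z - loc_U p \<tau> V m z\<bar> \<le> \<delta>"
        unfolding nval by (rule near'[OF V _ eV e(2)]) (use \<open>V \<noteq> {}\<close> in simp)
      also have "\<dots> \<le> (4 * N\<^sup>2 + 3) * \<delta>" using mult_right_mono[of 1 "4 * N\<^sup>2 + 3" \<delta>] \<delta>0 by simp
      finally show ?thesis .
    qed
  qed
  then have "\<bar>nodal_val p \<tau> \<T> m z - loc_U p \<tau> V m z\<bar>\<^sup>2 \<le> ((4 * N\<^sup>2 + 3) * \<delta>)\<^sup>2"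
    by (rule power_mono) simp
  moreover have "\<delta>\<^sup>2 = K * A" using K A0 by (simp add: \<delta>_def)
  ultimately show ?thesis by (simp add: power_mult_distrib A_def mult.assoc)
qed

section \<open>Stability of the intergrid transfer\<close>

lemma econt_cong: "econt e f \<Longrightarrow> (\<And>x. x \<in> seg e \<Longrightarrow> f x = g x) \<Longrightarrow> econt e g"
proof -
  assume f: "econt e f" and eq: "\<And>x. x \<in> seg e \<Longrightarrow> f x = g x"
  show ?thesis unfolding econt_def
  proof (intro conjI allI impI)
    show "card e = 2" using f by (rule econt_card)
    fix a b assume e: "e = {a, b}"
    show "continuous_on {0..1} (\<lambda>t. g ((1 - t) *\<^sub>R a + t *\<^sub>R b))"
    proof (rule continuous_on_eq[OF econtD[OF f[unfolded e]]])
      fix t :: real assume "t \<in> {0..1}"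
      then have "(1 - t) *\<^sub>R a + t *\<^sub>R b \<in> seg e" by (auto simp: e seg_doubleton in_segment)
      then show "f ((1 - t) *\<^sub>R a + t *\<^sub>R b) = g ((1 - t) *\<^sub>R a + t *\<^sub>R b)" by (rule eq)
    qed
  qed
qed

lemma loc_energy_nonneg:
  assumes V: "is_tri V" and \<tau>: "\<tau> > 0" and m: "\<And>e. e \<in> edges_of V \<Longrightarrow> econt e (m e)"
  shows "0 \<le> loc_energy p \<tau> V m"
proof -
  have s: "local_sol p \<tau> V m (loc_Q p \<tau> V m) (loc_U p \<tau> V m)" by (rule local_sol_loc[OF V \<tau> m])
  then have Q: "loc_Q p \<tau> V m \<in> vpoly2 p" and U: "loc_U p \<tau> V m \<in> poly2 p" by (auto simp: local_sol_def)
  have "0 \<le> bd_int V (\<lambda>e x. (loc_U p \<tau> V m x - m e x)\<^sup>2)"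
    by (intro bd_int_nonneg econt_power econt_diff poly2_econt[OF _ U] m edges_card) auto
  moreover have "0 \<le> integral (tri V) (\<lambda>x. inner (loc_Q p \<tau> V m x) (loc_Q p \<tau> V m x))"
    by (intro tri_int_nonneg V continuous_intros vpoly2_continuous[OF Q]) simp
  ultimately show ?thesis unfolding loc_energy_def using \<tau> by simp
qed

text \<open>The factor \<open>1 / (\<kappa> * h)\<close> of the edge estimate is turned into a
  multiple of \<open>\<tau>\<close>, which is the weight of the mismatch in the energy; a pointwise
  bound without \<open>h\<close> results.\<close>

lemma loc_energy_edge_bound:
  "\<exists>K>0. \<forall>\<kappa> h V \<tau> c1 m e x. tri_reg \<kappa> h V \<longrightarrow> \<kappa> > 0 \<longrightarrow> h > 0 \<longrightarrow> c1 > 0 \<longrightarrow> c1 / h \<le> \<tau> \<longrightarrow>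
     (\<forall>e\<in>edges_of V. edge_poly p e (m e)) \<longrightarrow> e \<in> edges_of V \<longrightarrow> x \<in> seg e \<longrightarrow>
     (loc_U p \<tau> V m x - m e x)\<^sup>2 \<le> K / (\<kappa> * c1) * loc_energy p \<tau> V m"
proof -
  obtain K where K: "K > 0" "\<And>\<kappa> h V e g x. tri_reg \<kappa> h V \<Longrightarrow> \<kappa> > 0 \<Longrightarrow> h > 0 \<Longrightarrow> e \<in> edges_of V \<Longrightarrow> edge_poly p e g \<Longrightarrow>
     x \<in> seg e \<Longrightarrow> (g x)\<^sup>2 \<le> K / (\<kappa> * h) * edge_int e (\<lambda>x. (g x)\<^sup>2)"
    using edge_poly_sup_le_L2[of p] by blast
  have "(loc_U p \<tau> V m x - m e x)\<^sup>2 \<le> K / (\<kappa> * c1) * loc_energy p \<tau> V m"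
    if reg: "tri_reg \<kappa> h V" and \<kappa>: "\<kappa> > 0" and h: "h > 0" and c1: "c1 > 0" and \<tau>: "c1 / h \<le> \<tau>"
      and m: "\<forall>e\<in>edges_of V. edge_poly p e (m e)" and e: "e \<in> edges_of V" and x: "x \<in> seg e" for \<kappa> h V \<tau> c1 m e x
  proof -
    have V: "is_tri V" using reg by (simp add: tri_reg_def)
    have \<tau>0: "\<tau> > 0" using \<tau> c1 h by (smt (verit) divide_pos_pos)
    have m': "\<And>e. e \<in> edges_of V \<Longrightarrow> econt e (m e)" using m edge_poly_econt by blast
    let ?U = "loc_U p \<tau> V m" and ?Q = "loc_Q p \<tau> V m"
    have "local_sol p \<tau> V m ?Q ?U" by (rule local_sol_loc[OF V \<tau>0 m'])
    then have Q: "?Q \<in> vpoly2 p" and U: "?U \<in> poly2 p" by (auto simp: local_sol_def)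
    have ec: "econt e (\<lambda>x. (?U x - m e x)\<^sup>2)" if "e \<in> edges_of V" for e
      using that by (intro econt_power econt_diff poly2_econt[OF _ U] m' edges_card)
    have "edge_int e (\<lambda>x. (?U x - m e x)\<^sup>2) \<le> bd_int V (\<lambda>e x. (?U x - m e x)\<^sup>2)"
      unfolding bd_int_def
      by (rule member_le_sum[OF e]) (auto intro!: edge_int_nonneg ec finite_edges_of is_tri_finite V)
    moreover have e0: "0 \<le> edge_int e (\<lambda>x. (?U x - m e x)\<^sup>2)" by (intro edge_int_nonneg ec e) auto
    moreover have "0 \<le> integral (tri V) (\<lambda>x. inner (?Q x) (?Q x))"
      by (intro tri_int_nonneg V continuous_intros vpoly2_continuous[OF Q]) simp
    ultimately have le: "\<tau> * edge_int e (\<lambda>x. (?U x - m e x)\<^sup>2) \<le> loc_energy p \<tau> V m"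
      unfolding loc_energy_def using \<tau>0 by (simp add: add_increasing mult_left_mono)
    have "(?U x - m e x)\<^sup>2 \<le> K / (\<kappa> * h) * edge_int e (\<lambda>x. (?U x - m e x)\<^sup>2)"
      using K(2)[OF reg \<kappa> h e edge_poly_diff_poly2[OF _ U] x] m e by blast
    also have "\<dots> \<le> K / (\<kappa> * c1) * (\<tau> * edge_int e (\<lambda>x. (?U x - m e x)\<^sup>2))"
    proof -
      have "1 / h \<le> \<tau> / c1" using \<tau> c1 by (simp add: field_simps)
      then have "K / \<kappa> * (1 / h) \<le> K / \<kappa> * (\<tau> / c1)" using K(1) \<kappa> by (intro mult_left_mono) auto
      then have "K / (\<kappa> * h) \<le> K / (\<kappa> * c1) * \<tau>" by simp
      from mult_right_mono[OF this e0] show ?thesis by (simp add: mult.assoc)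
    qed
    also have "\<dots> \<le> K / (\<kappa> * c1) * loc_energy p \<tau> V m" using le K(1) \<kappa> c1 by (intro mult_left_mono) auto
    finally show ?thesis .
  qed
  with K(1) show ?thesis by blast
qed

text \<open>Finite overlap: after exchanging the sums, \<open>W\<close> is counted once for each
  triangle that shares one of its three vertices.\<close>

lemma sum_over_neighbours_le:
  assumes T: "tri_mesh \<T>" and E: "\<And>V. V \<in> \<T> \<Longrightarrow> 0 \<le> E V" and N: "\<And>z. real (card {V\<in>\<T>. z \<in> V}) \<le> N"
  shows "(\<Sum>V\<in>\<T>. \<Sum>W\<in>{W\<in>\<T>. W \<inter> V \<noteq> {}}. E W) \<le> 3 * N * (\<Sum>W\<in>\<T>. E W)"
proof -
  have fin: "finite \<T>" using T by (simp add: tri_mesh_def)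
  have "(\<Sum>V\<in>\<T>. \<Sum>W\<in>{W\<in>\<T>. W \<inter> V \<noteq> {}}. E W) = (\<Sum>W\<in>\<T>. \<Sum>V\<in>{V\<in>\<T>. W \<inter> V \<noteq> {}}. E W)"
    using sum.swap_restrict[OF fin fin, of "\<lambda>V W. E W" "\<lambda>V W. W \<inter> V \<noteq> {}"] by simp
  also have "\<dots> \<le> (\<Sum>W\<in>\<T>. 3 * N * E W)"
  proof (rule sum_mono)
    fix W assume W: "W \<in> \<T>"
    have tr: "is_tri W" by (rule tri_mesh_is_tri[OF T W])
    have finW: "finite W" using tr by (rule is_tri_finite)
    have "{V\<in>\<T>. W \<inter> V \<noteq> {}} = (\<Union>z\<in>W. {V\<in>\<T>. z \<in> V})" by blast
    then have "card {V\<in>\<T>. W \<inter> V \<noteq> {}} \<le> (\<Sum>z\<in>W. card {V\<in>\<T>. z \<in> V})"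
      using card_UN_le[OF finW] by simp
    then have "real (card {V\<in>\<T>. W \<inter> V \<noteq> {}}) \<le> real (\<Sum>z\<in>W. card {V\<in>\<T>. z \<in> V})" by (simp only: of_nat_le_iff)
    also have "\<dots> = (\<Sum>z\<in>W. real (card {V\<in>\<T>. z \<in> V}))" by (rule of_nat_sum)
    also have "\<dots> \<le> real (card W) * N" by (rule sum_bounded_above) (rule N)
    finally have "real (card {V\<in>\<T>. W \<inter> V \<noteq> {}}) \<le> 3 * N" using tr by (simp add: is_tri_def)
    then have "real (card {V\<in>\<T>. W \<inter> V \<noteq> {}}) * E W \<le> 3 * N * E W" using E[OF W] by (rule mult_right_mono)
    then show "(\<Sum>V\<in>{V\<in>\<T>. W \<inter> V \<noteq> {}}. E W) \<le> 3 * N * E W" by simp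
  qed
  finally show ?thesis by (simp add: sum_distrib_left)
qed

text \<open>\<open>C\<close> is fixed ahead of the domain, the mesh, \<open>h\<close> and
  \<open>\<tau>\<close>; this order of quantifiers makes the bound uniform over the levels.\<close>

lemma interpolant_gradient_bound:
  assumes p: "p > 0" and \<kappa>: "\<kappa> > 0" and c1: "c1 > 0"
  shows "\<exists>C\<ge>0. \<forall>\<Omega> \<T> h \<tau> m. conforming \<Omega> \<T> \<longrightarrow> open \<Omega> \<longrightarrow> \<Omega> = interior (closure \<Omega>) \<longrightarrow>
     (\<forall>V\<in>\<T>. tri_reg \<kappa> h V) \<longrightarrow> h > 0 \<longrightarrow> c1 / h \<le> \<tau> \<longrightarrow> m \<in> M0space p \<Omega> \<T> \<longrightarrow>
     (\<Sum>V\<in>\<T>. integral (tri V) (\<lambda>x. inner (grad (interp p V (nodal_val p \<tau> \<T> m)) x) (grad (interp p V (nodal_val p \<tau> \<T> m)) x)))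
       \<le> C * hat_a p \<tau> \<T> m m"
proof -
  obtain K1 where K1: "K1 > 0" "\<And>\<kappa> h V \<tau> c1 m Q U. tri_reg \<kappa> h V \<Longrightarrow> \<kappa> > 0 \<Longrightarrow> h > 0 \<Longrightarrow> c1 > 0 \<Longrightarrow> c1 / h \<le> \<tau> \<Longrightarrow>
     (\<forall>e\<in>edges_of V. econt e (m e)) \<Longrightarrow> local_sol p \<tau> V m Q U \<Longrightarrow>
     integral (tri V) (\<lambda>x. inner (grad U x) (grad U x)) \<le>
       (2 + K1 / (\<kappa> * c1)) * (integral (tri V) (\<lambda>x. inner (Q x) (Q x)) + \<tau> * bd_int V (\<lambda>e x. (U x - m e x)\<^sup>2))"
    using local_sol_gradient_bound[of p] by blast
  obtain K2 where K2: "K2 > 0" "\<And>\<kappa> h V f M. tri_reg \<kappa> h V \<Longrightarrow> \<kappa> > 0 \<Longrightarrow> h > 0 \<Longrightarrow> f \<in> poly2 p \<Longrightarrow>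
     (\<forall>z\<in>nodes p V. (f z)\<^sup>2 \<le> M) \<Longrightarrow> integral (tri V) (\<lambda>x. inner (grad f x) (grad f x)) \<le> K2 / \<kappa> * M"
    using grad_le_nodal_values[OF p] by blast
  obtain K3 where K3: "K3 > 0" "\<And>\<kappa> h V \<tau> c1 m e x. tri_reg \<kappa> h V \<Longrightarrow> \<kappa> > 0 \<Longrightarrow> h > 0 \<Longrightarrow> c1 > 0 \<Longrightarrow> c1 / h \<le> \<tau> \<Longrightarrow>
     (\<forall>e\<in>edges_of V. edge_poly p e (m e)) \<Longrightarrow> e \<in> edges_of V \<Longrightarrow> x \<in> seg e \<Longrightarrow>
     (loc_U p \<tau> V m x - m e x)\<^sup>2 \<le> K3 / (\<kappa> * c1) * loc_energy p \<tau> V m"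
    using loc_energy_edge_bound[of p] by blast
  define N where "N = 16 / \<kappa>"
  define A where "A = 2 + K1 / (\<kappa> * c1)"
  \<comment> \<open>Three factors in a chain: gradient from nodal values, nodal values from edge
    mismatches around the vertices, edge mismatches from the energy.\<close>
  define B where "B = K2 / \<kappa> * ((4 * N\<^sup>2 + 3)\<^sup>2 * (K3 / (\<kappa> * c1)))"
  have A0: "A \<ge> 0" using K1(1) \<kappa> c1 by (simp add: A_def)
  have B0: "B \<ge> 0" using K2(1) K3(1) \<kappa> c1 by (simp add: B_def)
  have N0: "N \<ge> 0" using \<kappa> by (simp add: N_def)
  \<comment> \<open>The gradient of the interpolant is split into that of \<open>U\<close> (constant
    \<open>A\<close>) and that of the difference (constant \<open>B\<close>), each doubled by
    squaring the sum; \<open>3 * N\<close> is the overlap of the neighbourhoods.\<close>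
  let ?C = "(2 * A + 2 * B) * (3 * N)"
  have "(\<Sum>V\<in>\<T>. integral (tri V) (\<lambda>x. inner (grad (interp p V (nodal_val p \<tau> \<T> m)) x) (grad (interp p V (nodal_val p \<tau> \<T> m)) x)))
       \<le> ?C * hat_a p \<tau> \<T> m m"
    if conf: "conforming \<Omega> \<T>" and \<Omega>: "open \<Omega>" "\<Omega> = interior (closure \<Omega>)" and reg: "\<forall>V\<in>\<T>. tri_reg \<kappa> h V"
      and h: "h > 0" and \<tau>: "c1 / h \<le> \<tau>" and m: "m \<in> M0space p \<Omega> \<T>" for \<Omega> \<T> h \<tau> m
  proof -
    have T: "tri_mesh \<T>" using conf by (rule conforming_tri_mesh)
    have fin: "finite \<T>" using T by (simp add: tri_mesh_def)
    have \<tau>0: "\<tau> > 0" using \<tau> c1 h by (smt (verit) divide_pos_pos)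
    have reg': "\<And>V. V \<in> \<T> \<Longrightarrow> tri_reg \<kappa> h V" using reg by blast
    have ep: "\<forall>e\<in>edges_of V. edge_poly p e (m e)" if "V \<in> \<T>" for V
      using m that by (auto simp: M0space_def Mspace_def mesh_edges_def)
    have ec: "\<And>e. e \<in> edges_of V \<Longrightarrow> econt e (m e)" if "V \<in> \<T>" for V
      using ep[OF that] edge_poly_econt by blast
    have bdry: "m e x = 0" if "e \<in> mesh_edges \<T>" "seg e \<subseteq> frontier \<Omega>" "x \<in> seg e" for e x
      using m that unfolding M0space_def by blast
    define E where "E V = loc_energy p \<tau> V m" for V
    define S where "S V = (\<Sum>W\<in>{W\<in>\<T>. W \<inter> V \<noteq> {}}. E W)" for V
    have E0: "0 \<le> E V" if "V \<in> \<T>" for V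
      unfolding E_def using that ec \<tau>0 tri_mesh_is_tri[OF T] by (intro loc_energy_nonneg) auto
    have Nz: "real (card {V\<in>\<T>. z \<in> V}) \<le> N" for z
      unfolding N_def by (rule vertex_star_card[OF T reg' \<kappa> h])
    have local: "integral (tri V) (\<lambda>x. inner (grad (interp p V (nodal_val p \<tau> \<T> m)) x) (grad (interp p V (nodal_val p \<tau> \<T> m)) x))
       \<le> (2 * A + 2 * B) * S V" if V: "V \<in> \<T>" for V
    proof -
      have tr: "is_tri V" by (rule tri_mesh_is_tri[OF T V])
      let ?P = "interp p V (nodal_val p \<tau> \<T> m)" and ?U = "loc_U p \<tau> V m"
      have s: "local_sol p \<tau> V m (loc_Q p \<tau> V m) ?U" by (rule local_sol_loc[OF tr \<tau>0 ec[OF V]])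
      then have U: "?U \<in> poly2 p" by (simp add: local_sol_def)
      have P: "?P \<in> poly2 p" and Pn: "\<And>z. z \<in> nodes p V \<Longrightarrow> ?P z = nodal_val p \<tau> \<T> m z"
        using interp_spec[OF tr p] by blast+
      have d: "(\<lambda>x. ?P x - ?U x) \<in> poly2 p" by (rule poly2_diff[OF P U])
      note C = vpoly2_continuous[OF vpoly2_grad[OF P]] vpoly2_continuous[OF vpoly2_grad[OF U]] vpoly2_continuous[OF vpoly2_grad[OF d]]
      have "V \<noteq> {}" using tr by (auto simp: is_tri_def)
      then have ES: "E V \<le> S V" unfolding S_def using V fin E0 by (intro member_le_sum) auto
      have 1: "integral (tri V) (\<lambda>x. inner (grad ?U x) (grad ?U x)) \<le> A * S V"
      proof -
        have "integral (tri V) (\<lambda>x. inner (grad ?U x) (grad ?U x)) \<le> A * E V"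
          unfolding A_def E_def loc_energy_def using ec[OF V] by (intro K1(2)[OF reg'[OF V] \<kappa> h c1 \<tau> _ s]) auto
        also have "\<dots> \<le> A * S V" using ES A0 by (rule mult_left_mono)
        finally show ?thesis .
      qed
      have 2: "integral (tri V) (\<lambda>x. inner (grad (\<lambda>x. ?P x - ?U x) x) (grad (\<lambda>x. ?P x - ?U x) x)) \<le> B * S V"
      proof -
        have "\<forall>z\<in>nodes p V. (?P z - ?U z)\<^sup>2 \<le> (4 * N\<^sup>2 + 3)\<^sup>2 * (K3 / (\<kappa> * c1)) * S V"
        proof
          fix z assume z: "z \<in> nodes p V"
          have "(nodal_val p \<tau> \<T> m z - ?U z)\<^sup>2 \<le> (4 * N\<^sup>2 + 3)\<^sup>2 * (K3 / (\<kappa> * c1)) * S V"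
            unfolding S_def
          proof (rule nodal_val_close[OF conf \<Omega> p bdry _ E0 _ Nz V z])
            fix X e x assume X: "X \<in> \<T>" "e \<in> edges_of X" "x \<in> seg e"
            show "(loc_U p \<tau> X m x - m e x)\<^sup>2 \<le> K3 / (\<kappa> * c1) * E X"
              unfolding E_def by (rule K3(2)[OF reg'[OF X(1)] \<kappa> h c1 \<tau> ep[OF X(1)] X(2,3)])
          qed (use K3(1) \<kappa> c1 in auto)
          then show "(?P z - ?U z)\<^sup>2 \<le> (4 * N\<^sup>2 + 3)\<^sup>2 * (K3 / (\<kappa> * c1)) * S V" by (simp add: Pn[OF z])
        qed
        from K2(2)[OF reg'[OF V] \<kappa> h d this] show ?thesis by (simp add: B_def mult.assoc)
      qed
      have "integral (tri V) (\<lambda>x. inner (grad ?P x) (grad ?P x))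
        \<le> integral (tri V) (\<lambda>x. 2 * inner (grad ?U x) (grad ?U x) + 2 * inner (grad (\<lambda>x. ?P x - ?U x) x) (grad (\<lambda>x. ?P x - ?U x) x))"
      proof (intro tri_int_mono tr continuous_intros C)
        fix x
        define u where "u = grad ?U x"
        define w where "w = grad (\<lambda>x. ?P x - ?U x) x"
        have "grad ?P x = u + w" by (simp add: u_def w_def grad_diff[OF P U])
        moreover have "0 \<le> inner (u - w) (u - w)" by simp
        ultimately have "inner (grad ?P x) (grad ?P x) \<le> 2 * inner u u + 2 * inner w w"
          by (simp add: inner_add_left inner_add_right inner_diff_left inner_diff_right inner_commute)
        then show "inner (grad ?P x) (grad ?P x)
          \<le> 2 * inner (grad ?U x) (grad ?U x) + 2 * inner (grad (\<lambda>x. ?P x - ?U x) x) (grad (\<lambda>x. ?P x - ?U x) x)"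
          by (simp add: u_def w_def)
      qed
      also have "\<dots> = integral (tri V) (\<lambda>x. 2 * inner (grad ?U x) (grad ?U x))
          + integral (tri V) (\<lambda>x. 2 * inner (grad (\<lambda>x. ?P x - ?U x) x) (grad (\<lambda>x. ?P x - ?U x) x))"
        by (intro tri_int_add tr continuous_intros C)
      also have "\<dots> \<le> 2 * (A * S V) + 2 * (B * S V)"
        using 1 2 by (simp only: integral_mult_right)
      finally show ?thesis by (simp add: algebra_simps)
    qed
    have "(\<Sum>V\<in>\<T>. integral (tri V) (\<lambda>x. inner (grad (interp p V (nodal_val p \<tau> \<T> m)) x) (grad (interp p V (nodal_val p \<tau> \<T> m)) x)))
       \<le> (\<Sum>V\<in>\<T>. (2 * A + 2 * B) * S V)" by (rule sum_mono) (rule local)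
    also have "\<dots> = (2 * A + 2 * B) * (\<Sum>V\<in>\<T>. S V)" by (simp add: sum_distrib_left)
    also have "\<dots> \<le> (2 * A + 2 * B) * (3 * N * (\<Sum>W\<in>\<T>. E W))"
      using sum_over_neighbours_le[OF T E0 Nz] A0 B0 unfolding S_def by (intro mult_left_mono) auto
    also have "\<dots> = ?C * hat_a p \<tau> \<T> m m" by (simp add: hat_a_diag E_def)
    finally show ?thesis .
  qed
  moreover have "?C \<ge> 0" using A0 B0 N0 by simp
  ultimately show ?thesis by blast
qed

lemma refines_chain:
  assumes ref: "\<And>k. k < L \<Longrightarrow> refines (\<T> (Suc k)) (\<T> k)" and l: "l \<le> L" and V: "V' \<in> \<T> L"
  shows "\<exists>V\<in>\<T> l. tri V' \<subseteq> tri V"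
  using l ref V
proof (induction L arbitrary: V' rule: dec_induct)
  case base
  then show ?case by blast
next
  case (step n)
  have "refines (\<T> (Suc n)) (\<T> n)" using step.prems(1) by simp
  then obtain V1 where V1: "V1 \<in> \<T> n" "tri V' \<subseteq> tri V1" using step.prems(2) by (auto simp: refines_def)
  obtain V where "V \<in> \<T> l" "tri V1 \<subseteq> tri V" using step.IH[OF _ V1(1)] step.prems(1) by auto
  with V1 show ?case by blast
qed

text \<open>The fine triangle lies inside one coarse triangle, where the transferred function is a
  single polynomial of degree \<open>p\<close>, so the energy identity applies with it as
  \<open>w\<close>.\<close>

lemma loc_energy_Itrans_le:
  assumes T: "tri_mesh \<T>" and p: "p > 0" and V: "V \<in> \<T>" and V': "is_tri V'" "tri V' \<subseteq> tri V" and \<tau>': "\<tau>' > 0"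
  shows "loc_energy p \<tau>' V' (Itrans p \<tau> \<T> m) \<le> integral (tri V')
    (\<lambda>x. inner (grad (interp p V (nodal_val p \<tau> \<T> m)) x) (grad (interp p V (nodal_val p \<tau> \<T> m)) x))"
proof -
  let ?P = "interp p V (nodal_val p \<tau> \<T> m)" and ?m = "Itrans p \<tau> \<T> m"
  have P: "?P \<in> poly2 p" using interp_spec[OF tri_mesh_is_tri[OF T V] p] by blast
  have mP: "?m e x = ?P x" if "e \<in> edges_of V'" "x \<in> seg e" for e x
  proof -
    have "seg e \<subseteq> tri V'" using that(1) unfolding seg_def tri_def edges_of_def by (intro hull_mono) auto
    then have "x \<in> tri V" using that(2) V'(2) by blast
    then show ?thesis unfolding Itrans_def by (rule IW_eq_interp[OF T p V])
  qed
  have "econt e (?m e)" if "e \<in> edges_of V'" for e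
    by (rule econt_cong[OF poly2_econt[OF edges_card[OF that] P]]) (simp add: mP[OF that])
  from local_sol_loc[OF V'(1) \<tau>' this] have "local_sol p \<tau>' V' ?m (loc_Q p \<tau>' V' ?m) (loc_U p \<tau>' V' ?m)" by simp
  from local_sol_energy_le_gradient[OF V'(1) P \<tau>' mP this] show ?thesis unfolding loc_energy_def .
qed

theorem theorem3p7:
  fixes p :: nat and \<Omega> :: "pt set" and \<sigma> \<rho> c1 c2 :: real
  assumes "p \<ge> 2" and "polygonal_domain \<Omega>"
    and "\<sigma> > 0" and "\<rho> > 0" and "c1 > 0" and "c2 > 0"
  shows "\<exists>C. \<forall>(\<T> :: nat \<Rightarrow> pt set set) (\<tau> :: nat \<Rightarrow> real) L l mu.
           mesh_family \<Omega> \<sigma> \<rho> \<T> L \<and>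
           (\<forall>k\<le>L. c1 / meshsize (\<T> k) \<le> \<tau> k \<and> \<tau> k \<le> c2 / meshsize (\<T> k)) \<and>
           l < L \<and> mu \<in> M0space p \<Omega> (\<T> l)
           \<longrightarrow> hat_a p (\<tau> L) (\<T> L) (Itrans p (\<tau> l) (\<T> l) mu) (Itrans p (\<tau> l) (\<T> l) mu)
               \<le> C * hat_a p (\<tau> l) (\<T> l) mu mu"
proof -
  have p: "p > 0" using assms(1) by simp
  have \<Omega>: "open \<Omega>" "\<Omega> = interior (closure \<Omega>)" using assms(2) by (auto simp: polygonal_domain_def)
  have \<kappa>: "\<rho>\<^sup>2 / \<sigma>\<^sup>2 > 0" using assms(3,4) by simp
  \<comment> \<open>Chosen before the family of meshes, for the regularity constant
    \<open>\<rho>\<^sup>2 / \<sigma>\<^sup>2\<close> shared by all levels.\<close>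
  obtain C where C: "\<And>\<T> h \<tau> m. conforming \<Omega> \<T> \<Longrightarrow> \<forall>V\<in>\<T>. tri_reg (\<rho>\<^sup>2 / \<sigma>\<^sup>2) h V \<Longrightarrow> h > 0 \<Longrightarrow> c1 / h \<le> \<tau> \<Longrightarrow>
     m \<in> M0space p \<Omega> \<T> \<Longrightarrow>
     (\<Sum>V\<in>\<T>. integral (tri V) (\<lambda>x. inner (grad (interp p V (nodal_val p \<tau> \<T> m)) x) (grad (interp p V (nodal_val p \<tau> \<T> m)) x)))
       \<le> C * hat_a p \<tau> \<T> m m"
    using interpolant_gradient_bound[OF p \<kappa> assms(5)] \<Omega> by blast
  have "hat_a p (\<tau> L) (\<T> L) (Itrans p (\<tau> l) (\<T> l) mu) (Itrans p (\<tau> l) (\<T> l) mu) \<le> C * hat_a p (\<tau> l) (\<T> l) mu mu"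
    if fam: "mesh_family \<Omega> \<sigma> \<rho> \<T> L" and \<tau>: "\<forall>k\<le>L. c1 / meshsize (\<T> k) \<le> \<tau> k \<and> \<tau> k \<le> c2 / meshsize (\<T> k)"
      and l: "l < L" and mu: "mu \<in> M0space p \<Omega> (\<T> l)" for \<T> \<tau> L l mu
  proof -
    have lev: "conforming \<Omega> (\<T> k)" "shape_regular \<sigma> (\<T> k)" "quasi_uniform \<rho> (\<T> k)" if "k \<le> L" for k
      using fam that unfolding mesh_family_def by blast+
    have hpos: "meshsize (\<T> k) > 0" if "k \<le> L" for k
      using mesh_tri_reg(1)[OF lev[OF that] assms(3,4)] .
    have Tl: "tri_mesh (\<T> l)" and TL: "tri_mesh (\<T> L)" using conforming_tri_mesh[OF lev(1)] l by simp_all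
    have "c1 / meshsize (\<T> L) > 0" using assms(5) hpos by simp
    then have \<tau>L: "\<tau> L > 0" using \<tau> by (meson order_refl order_less_le_trans)
    define g where "g V = (\<lambda>x. inner (grad (interp p V (nodal_val p (\<tau> l) (\<T> l) mu)) x)
      (grad (interp p V (nodal_val p (\<tau> l) (\<T> l) mu)) x))" for V
    have "\<forall>V'\<in>\<T> L. \<exists>V\<in>\<T> l. tri V' \<subseteq> tri V"
      using refines_chain[of L \<T> l] fam l unfolding mesh_family_def by auto
    \<comment> \<open>Each fine triangle is assigned one coarse triangle containing it.\<close>
    then obtain par where par: "\<And>V'. V' \<in> \<T> L \<Longrightarrow> par V' \<in> \<T> l \<and> tri V' \<subseteq> tri (par V')" by metis
    have fin: "finite (\<T> L)" "finite (\<T> l)" using Tl TL by (auto simp: tri_mesh_def)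
    have "hat_a p (\<tau> L) (\<T> L) (Itrans p (\<tau> l) (\<T> l) mu) (Itrans p (\<tau> l) (\<T> l) mu)
      = (\<Sum>V'\<in>\<T> L. loc_energy p (\<tau> L) V' (Itrans p (\<tau> l) (\<T> l) mu))" by (rule hat_a_diag)
    also have "\<dots> \<le> (\<Sum>V'\<in>\<T> L. integral (tri V') (g (par V')))"
      unfolding g_def using par tri_mesh_is_tri[OF TL]
      by (intro sum_mono loc_energy_Itrans_le[OF Tl p _ _ _ \<tau>L]) auto
    also have "\<dots> = (\<Sum>V\<in>\<T> l. \<Sum>V'\<in>{V'\<in>\<T> L. par V' = V}. integral (tri V') (g (par V')))"
      using par by (intro sum.group[symmetric] fin) auto
    also have "\<dots> = (\<Sum>V\<in>\<T> l. \<Sum>V'\<in>{V'\<in>\<T> L. par V' = V}. integral (tri V') (g V))"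
      by (intro sum.cong) auto
    \<comment> \<open>Fine triangles with the same parent lie inside it and overlap only in null
      sets.\<close>
    also have "\<dots> \<le> (\<Sum>V\<in>\<T> l. integral (tri V) (g V))"
    proof (rule sum_mono)
      fix V assume V: "V \<in> \<T> l"
      have tr: "is_tri V" by (rule tri_mesh_is_tri[OF Tl V])
      have P: "interp p V (nodal_val p (\<tau> l) (\<T> l) mu) \<in> poly2 p" using interp_spec[OF tr p] by blast
      show "(\<Sum>V'\<in>{V'\<in>\<T> L. par V' = V}. integral (tri V') (g V)) \<le> integral (tri V) (g V)"
      proof (rule sum_tri_integrals_le[OF TL])
        show "continuous_on UNIV (g V)" unfolding g_def
          by (intro continuous_intros vpoly2_continuous[OF vpoly2_grad[OF P]])
        show "compact (tri V)" by (intro compact_tri is_tri_finite tr)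
      qed (use par in \<open>auto simp: g_def\<close>)
    qed
    also have "\<dots> \<le> C * hat_a p (\<tau> l) (\<T> l) mu mu"
      unfolding g_def
    proof (rule C)
      show "conforming \<Omega> (\<T> l)" using lev(1) l by simp
      show "\<forall>V\<in>\<T> l. tri_reg (\<rho>\<^sup>2 / \<sigma>\<^sup>2) (meshsize (\<T> l)) V"
        using mesh_tri_reg(2)[OF lev assms(3,4)] l by simp
      show "meshsize (\<T> l) > 0" using hpos l by simp
      show "c1 / meshsize (\<T> l) \<le> \<tau> l" using \<tau> l by simp
    qed (rule mu)
    finally show ?thesis .
  qed
  then show ?thesis by blast
qed

end
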